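(* Let $(A_0,A_1)$ and $(B_0,B_1)$ be Banach couples with $A_j$ continuously imbedded in $B_j$ for $j=0,1$. Suppose, further, that $A_1$ is continuously imbedded in $A_0$. Let $\mathcal{D}$ be a group of linear operators $g:B_0+B_1\to B_0+B_1$ such that, for $j=0,1$ and every $g\in\mathcal{D}$, $g(A_j)\subset A_j$ and $g:A_j\to A_j$ is an isometry, and $g(B_j)\subset B_j$ and $g:B_j\to B_j$ is an isometry. Assume that there exists a family of $\mathcal{D}$-covariant mollifiers $\{M_t:A_0\to A_1\}_{t\in(0,1)}$ relative to $B_1$. If, furthermore, the imbedding of $A_1$ into $B_1$ is $\mathcal{D}$-cocompact, then, for every $\theta\in(0,1)$ and $q\in[1,\infty]$, the space $(A_0,A_1)_{\theta,q}$ is $\mathcal{D}$-cocompactly imbedded into $(B_0,B_1)_{\theta,q}$ and the space $[A_0,A_1]_\theta$ is $\mathcal{D}$-cocompactly imbedded into $[B_0,B_1]_\theta$.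
   Context: **$\mathcal{D}$-weak convergence.** Let $A$ be a Banach space and $\mathcal{D}$ a group (under composition) of continuous linear bijections of $A$. A sequence $\{u_k\}_{k\in\mathbb{N}}$ in $A$ is $\mathcal{D}$-weakly convergent to $u\in A$ if $g_k(u_k-u)\rightharpoonup 0$ weakly in $A$ for every choice of a sequence $\{g_k\}_{k\in\mathbb{N}}$ in $\mathcal{D}$. **Cocompactness.** If $A$ is continuously imbedded in a Banach space $B$, the imbedding is cocompact relative to $\mathcal{D}$ ($\mathcal{D}$-cocompact) if every sequence in $A$ that is $\mathcal{D}$-weakly convergent in $A$ converges in the norm of $B$. **Banach couples.** A Banach couple $(A_0,A_1)$ is a pair of (complex) Banach spaces that are linear subspaces of a common Hausdorff topological vector space, with continuous inclusions. $A_0+A_1$ has norm $\inf\{\|a_0\|_{A_0}+\|a_1\|_{A_1}: a=a_0+a_1,\ a_j\in A_j\}$. Operators in $\mathcal{D}$ act on subspaces, including the interpolation spaces, by restriction. **Real interpolation.** $K(t,a;A_0,A_1)=\inf\{\|a_0\|_{A_0}+t\|a_1\|_{A_1}: a=a_0+a_1\}$. For $\theta\in(0,1)$, $(A_0,A_1)_{\theta,q}$ is the space of $a\in A_0+A_1$ with finite norm $\left(\int_0^\infty (t^{-\theta}K(t,a;A_0,A_1))^q\frac{dt}{t}\right)^{1/q}$ if $1\le q<\infty$, and $\sup_{t>0}t^{-\theta}K(t,a;A_0,A_1)$ if $q=\infty$. **Complex interpolation.** $\mathcal{F}(A_0,A_1)$ is the space of functions $f$ that are bounded and continuous from the strip $0\le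 \mathrm{Re}\,z\le 1$ into $A_0+A_1$, analytic for $0<\mathrm{Re}\,z<1$, and such that for $j=0,1$ the map $y\mapsto f(j+iy)$ is continuous into $A_j$ with $\|f(j+iy)\|_{A_j}\to0$ as $|y|\to\infty$; its norm is $\|f\|_{\mathcal F}=\max_{j=0,1}\sup_{y\in\mathbb{R}}\|f(j+iy)\|_{A_j}$. Then $[A_0,A_1]_\theta=\{f(\theta):f\in\mathcal{F}(A_0,A_1)\}$ with norm $\|u\|=\inf\{\|f\|_{\mathcal F}:f(\theta)=u\}$. **$\mathcal{D}$-covariant mollifiers.** With $A_1$ continuously imbedded in $A_0$ and in $B_1$, a family of bounded linear operators $M_t:A_0\to A_1$, $t\in(0,1)$, is a family of $\mathcal{D}$-covariant mollifiers relative to $B_1$ if: (i) $\sup_{t\in(0,1)}\|M_t\|_{A_j\to A_j}<\infty$ for $j=0,1$; (ii) $\sigma(t):=\|I-M_t\|_{A_1\to B_1}$ satisfies $\lim_{t\to0}\sigma(t)=0$; (iii) for each $g\in\mathcal{D}$ and $t\in(0,1)$ there exists $h_{g,t}\in\mathcal{D}$ such that $gM_t=M_th_{g,t}$. *)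

theory Defs
  imports "HOL-Analysis.Analysis" "HOL-Algebra.Bij"
begin

section \<open>Complex Hausdorff topological vector spaces\<close>

class complex_tvs = topological_ab_group_add + t2_space +
  fixes scaleC :: "complex \<Rightarrow> 'a \<Rightarrow> 'a"  (infixr "*\<^sub>C" 75)
  assumes scaleC_add_right: "c *\<^sub>C (x + y) = c *\<^sub>C x + c *\<^sub>C y"
    and scaleC_add_left: "(c + d) *\<^sub>C x = c *\<^sub>C x + d *\<^sub>C x"
    and scaleC_scaleC: "c *\<^sub>C (d *\<^sub>C x) = (c * d) *\<^sub>C x"
    and scaleC_one: "1 *\<^sub>C x = x"
    and tendsto_scaleC_Pair: "LIM p (nhds c \<times>\<^sub>F nhds x). fst p *\<^sub>C snd p :> nhds (c *\<^sub>C x)"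

section \<open>Normed spaces inside an ambient vector space\<close>

text \<open>A normed space is a set of points of the ambient space together with a norm; only the
  values of the norm on the points matter.\<close>

record 'v nspace =
  points :: "'v set"
  nrm :: "'v \<Rightarrow> real"

definition tends_to_in :: "('v::complex_tvs) nspace \<Rightarrow> ('b \<Rightarrow> 'v) \<Rightarrow> 'v \<Rightarrow> 'b filter \<Rightarrow> bool" where
  "tends_to_in X f l F \<longleftrightarrow> ((\<lambda>x. nrm X (f x - l)) \<longlongrightarrow> 0) F"

definition banach_space :: "('v::complex_tvs) nspace \<Rightarrow> bool" where
  "banach_space X \<longleftrightarrow>
     0 \<in> points X \<and>
     (\<forall>x\<in>points X. \<forall>y\<in>points X. x + y \<in> points X) \<and>
     (\<forall>c. \<forall>x\<in>points X. c *\<^sub>C x \<in> points X) \<and>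
     (\<forall>x\<in>points X. 0 \<le> nrm X x) \<and>
     (\<forall>x\<in>points X. nrm X x = 0 \<longleftrightarrow> x = 0) \<and>
     (\<forall>x\<in>points X. \<forall>y\<in>points X. nrm X (x + y) \<le> nrm X x + nrm X y) \<and>
     (\<forall>c. \<forall>x\<in>points X. nrm X (c *\<^sub>C x) = cmod c * nrm X x) \<and>
     (\<forall>u::nat \<Rightarrow> 'v. (\<forall>n. u n \<in> points X) \<longrightarrow>
        (\<forall>e>0. \<exists>N. \<forall>m\<ge>N. \<forall>n\<ge>N. nrm X (u m - u n) < e) \<longrightarrow>
        (\<exists>l\<in>points X. tends_to_in X u l sequentially))"

definition continuously_included :: "('v::complex_tvs) nspace \<Rightarrow> bool" where
  "continuously_included X \<longleftrightarrow>
     (\<forall>U. open U \<and> 0 \<in> U \<longrightarrow> (\<exists>e>0. \<forall>x\<in>points X. nrm X x < e \<longrightarrow> x \<in> U))"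

definition banach_couple :: "('v::complex_tvs) nspace \<Rightarrow> 'v nspace \<Rightarrow> bool" where
  "banach_couple A0 A1 \<longleftrightarrow> banach_space A0 \<and> banach_space A1 \<and>
     continuously_included A0 \<and> continuously_included A1"

definition continuously_imbedded :: "('v::complex_tvs) nspace \<Rightarrow> 'v nspace \<Rightarrow> bool" where
  "continuously_imbedded X Y \<longleftrightarrow>
     points X \<subseteq> points Y \<and> (\<exists>C. \<forall>x\<in>points X. nrm Y x \<le> C * nrm X x)"

definition clinear_on :: "('v::complex_tvs) set \<Rightarrow> ('v \<Rightarrow> 'v) \<Rightarrow> bool" where
  "clinear_on S T \<longleftrightarrow>
     (\<forall>x\<in>S. \<forall>y\<in>S. T (x + y) = T x + T y) \<and> (\<forall>c. \<forall>x\<in>S. T (c *\<^sub>C x) = c *\<^sub>C T x)"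

definition bounded_operator :: "('v::complex_tvs) nspace \<Rightarrow> 'v nspace \<Rightarrow> ('v \<Rightarrow> 'v) \<Rightarrow> bool" where
  "bounded_operator X Y T \<longleftrightarrow>
     T \<in> points X \<rightarrow> points Y \<and> clinear_on (points X) T \<and>
     (\<exists>C. \<forall>x\<in>points X. nrm Y (T x) \<le> C * nrm X x)"

text \<open>A real supremum, hence meaningful only for bounded operators.\<close>

definition opnorm :: "('v::complex_tvs) nspace \<Rightarrow> 'v nspace \<Rightarrow> ('v \<Rightarrow> 'v) \<Rightarrow> real" where
  "opnorm X Y T = (SUP x\<in>{x\<in>points X. nrm X x \<le> 1}. nrm Y (T x))"

definition isometry_on :: "('v::complex_tvs) nspace \<Rightarrow> ('v \<Rightarrow> 'v) \<Rightarrow> bool" where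
  "isometry_on X g \<longleftrightarrow> g ` points X \<subseteq> points X \<and>
     (\<forall>x\<in>points X. \<forall>y\<in>points X. nrm X (g x - g y) = nrm X (x - y))"

definition bounded_functional :: "('v::complex_tvs) nspace \<Rightarrow> ('v \<Rightarrow> complex) \<Rightarrow> bool" where
  "bounded_functional X \<phi> \<longleftrightarrow>
     (\<forall>x\<in>points X. \<forall>y\<in>points X. \<phi> (x + y) = \<phi> x + \<phi> y) \<and>
     (\<forall>c. \<forall>x\<in>points X. \<phi> (c *\<^sub>C x) = c * \<phi> x) \<and>
     (\<exists>C. \<forall>x\<in>points X. cmod (\<phi> x) \<le> C * nrm X x)"

definition weakly_convergent_to :: "('v::complex_tvs) nspace \<Rightarrow> (nat \<Rightarrow> 'v) \<Rightarrow> 'v \<Rightarrow> bool" where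
  "weakly_convergent_to X u l \<longleftrightarrow>
     (\<forall>k. u k \<in> points X) \<and> l \<in> points X \<and>
     (\<forall>\<phi>. bounded_functional X \<phi> \<longrightarrow> (\<lambda>k. \<phi> (u k)) \<longlonglongrightarrow> \<phi> l)"

section \<open>Cocompactness\<close>

text \<open>The operators of \<open>D\<close> may be defined on a larger space and act on \<open>X\<close> by restriction; the
  restrictions are required to form a group of continuous linear bijections of \<open>X\<close>.\<close>

definition acts_on :: "('v::complex_tvs \<Rightarrow> 'v) set \<Rightarrow> 'v nspace \<Rightarrow> bool" where
  "acts_on D X \<longleftrightarrow>
     subgroup ((\<lambda>g. restrict g (points X)) ` D) (BijGroup (points X)) \<and>
     (\<forall>g\<in>D. bounded_operator X X g)"

definition D_weakly_convergent_to ::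
    "('v::complex_tvs \<Rightarrow> 'v) set \<Rightarrow> 'v nspace \<Rightarrow> (nat \<Rightarrow> 'v) \<Rightarrow> 'v \<Rightarrow> bool" where
  "D_weakly_convergent_to D X u l \<longleftrightarrow>
     (\<forall>k. u k \<in> points X) \<and> l \<in> points X \<and>
     (\<forall>g::nat \<Rightarrow> 'v \<Rightarrow> 'v. (\<forall>k. g k \<in> D) \<longrightarrow>
        weakly_convergent_to X (\<lambda>k. g k (u k - l)) 0)"

definition cocompactly_imbedded ::
    "('v::complex_tvs \<Rightarrow> 'v) set \<Rightarrow> 'v nspace \<Rightarrow> 'v nspace \<Rightarrow> bool" where
  "cocompactly_imbedded D X Y \<longleftrightarrow>
     acts_on D X \<and> continuously_imbedded X Y \<and>
     (\<forall>u. (\<exists>l. D_weakly_convergent_to D X u l) \<longrightarrow>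
        (\<exists>l\<in>points Y. tends_to_in Y u l sequentially))"

section \<open>Sum of a couple and real interpolation\<close>

definition K_functional ::
    "('v::complex_tvs) nspace \<Rightarrow> 'v nspace \<Rightarrow> real \<Rightarrow> 'v \<Rightarrow> real" where
  "K_functional A0 A1 t a =
     Inf {nrm A0 a0 + t * nrm A1 a1 | a0 a1. a0 \<in> points A0 \<and> a1 \<in> points A1 \<and> a = a0 + a1}"

definition sum_space :: "('v::complex_tvs) nspace \<Rightarrow> 'v nspace \<Rightarrow> 'v nspace" where
  "sum_space A0 A1 =
     \<lparr>points = {a0 + a1 | a0 a1. a0 \<in> points A0 \<and> a1 \<in> points A1},
      nrm = (\<lambda>a. Inf {nrm A0 a0 + nrm A1 a1 | a0 a1.
                        a0 \<in> points A0 \<and> a1 \<in> points A1 \<and> a = a0 + a1})\<rparr>"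

definition real_interp_norm ::
    "('v::complex_tvs) nspace \<Rightarrow> 'v nspace \<Rightarrow> real \<Rightarrow> ereal \<Rightarrow> 'v \<Rightarrow> ennreal" where
  "real_interp_norm A0 A1 \<theta> q a =
     (if q = \<infinity> then (SUP t\<in>{0<..}. ennreal (t powr (- \<theta>) * K_functional A0 A1 t a))
      else (let p = real_of_ereal q;
                I = (\<integral>\<^sup>+ t\<in>{0<..}.
                       ennreal ((t powr (- \<theta>) * K_functional A0 A1 t a) powr p / t) \<partial>lborel)
            in if I = \<infinity> then \<infinity> else ennreal (enn2real I powr (1 / p))))"

definition real_interp ::
    "('v::complex_tvs) nspace \<Rightarrow> 'v nspace \<Rightarrow> real \<Rightarrow> ereal \<Rightarrow> 'v nspace" where
  "real_interp A0 A1 \<theta> q =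
     \<lparr>points = {a \<in> points (sum_space A0 A1). real_interp_norm A0 A1 \<theta> q a < \<infinity>},
      nrm = (\<lambda>a. enn2real (real_interp_norm A0 A1 \<theta> q a))\<rparr>"

section \<open>Complex interpolation\<close>

definition continuous_on_into ::
    "('v::complex_tvs) nspace \<Rightarrow> 'b::topological_space set \<Rightarrow> ('b \<Rightarrow> 'v) \<Rightarrow> bool" where
  "continuous_on_into X S f \<longleftrightarrow>
     (\<forall>z\<in>S. f z \<in> points X \<and> tends_to_in X f (f z) (at z within S))"

text \<open>Used on open sets only, where analyticity means existence of the complex derivative in the
  norm of \<open>X\<close> at every point.\<close>

definition analytic_into ::
    "('v::complex_tvs) nspace \<Rightarrow> complex set \<Rightarrow> (complex \<Rightarrow> 'v) \<Rightarrow> bool" where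
  "analytic_into X S f \<longleftrightarrow>
     (\<forall>z\<in>S. f z \<in> points X \<and>
        (\<exists>d\<in>points X. tends_to_in X (\<lambda>w. inverse (w - z) *\<^sub>C (f w - f z)) d (at z)))"

definition F_space :: "('v::complex_tvs) nspace \<Rightarrow> 'v nspace \<Rightarrow> (complex \<Rightarrow> 'v) set" where
  "F_space A0 A1 = {f.
     (\<exists>C. \<forall>z\<in>{z. 0 \<le> Re z \<and> Re z \<le> 1}. nrm (sum_space A0 A1) (f z) \<le> C) \<and>
     continuous_on_into (sum_space A0 A1) {z. 0 \<le> Re z \<and> Re z \<le> 1} f \<and>
     analytic_into (sum_space A0 A1) {z. 0 < Re z \<and> Re z < 1} f \<and>
     continuous_on_into A0 UNIV (\<lambda>y. f (Complex 0 y)) \<and>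
     continuous_on_into A1 UNIV (\<lambda>y. f (Complex 1 y)) \<and>
     ((\<lambda>y. nrm A0 (f (Complex 0 y))) \<longlongrightarrow> 0) at_infinity \<and>
     ((\<lambda>y. nrm A1 (f (Complex 1 y))) \<longlongrightarrow> 0) at_infinity}"

definition F_norm :: "('v::complex_tvs) nspace \<Rightarrow> 'v nspace \<Rightarrow> (complex \<Rightarrow> 'v) \<Rightarrow> real" where
  "F_norm A0 A1 f = max (SUP y. nrm A0 (f (Complex 0 y))) (SUP y. nrm A1 (f (Complex 1 y)))"

definition complex_interp ::
    "('v::complex_tvs) nspace \<Rightarrow> 'v nspace \<Rightarrow> real \<Rightarrow> 'v nspace" where
  "complex_interp A0 A1 \<theta> =
     \<lparr>points = {f (of_real \<theta>) | f. f \<in> F_space A0 A1},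
      nrm = (\<lambda>u. Inf {F_norm A0 A1 f | f. f \<in> F_space A0 A1 \<and> f (of_real \<theta>) = u})\<rparr>"

section \<open>Covariant mollifiers\<close>

definition covariant_mollifiers ::
    "('v::complex_tvs \<Rightarrow> 'v) set \<Rightarrow> 'v nspace \<Rightarrow> 'v nspace \<Rightarrow> 'v nspace \<Rightarrow>
     (real \<Rightarrow> 'v \<Rightarrow> 'v) \<Rightarrow> bool" where
  "covariant_mollifiers D A0 A1 B1 M \<longleftrightarrow>
     (\<forall>t\<in>{0<..<1}. bounded_operator A0 A1 (M t)) \<and>
     bdd_above ((\<lambda>t. opnorm A0 A0 (M t)) ` {0<..<1}) \<and>
     bdd_above ((\<lambda>t. opnorm A1 A1 (M t)) ` {0<..<1}) \<and>
     ((\<lambda>t. opnorm A1 B1 (\<lambda>x. x - M t x)) \<longlongrightarrow> 0) (at_right 0) \<and>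
     (\<forall>g\<in>D. \<forall>t\<in>{0<..<1}. \<exists>h\<in>D. \<forall>x\<in>points A0. g (M t x) = M t (h x))"

end

theory Submission
  imports Defs "HOL-Complex_Analysis.Complex_Analysis"
begin

text \<open>Let \<open>v\<^sub>k\<close> be \<open>D\<close>-weakly null in an interpolation space \<open>X\<close> of \<open>(A0, A1)\<close>. It is bounded
  there, and since \<open>X\<close> is imbedded in \<open>A0\<close>, covariance makes \<open>M t v\<^sub>k\<close> \<open>D\<close>-weakly null in \<open>A1\<close>, hence null
  in \<open>B1\<close>, for every fixed \<open>t\<close>. Since \<open>M t v\<^sub>k\<close> is also bounded in \<open>B0\<close>, it is null in the interpolation
  space \<open>Y\<close> of \<open>(B0, B1)\<close>. The remainder \<open>v\<^sub>k - M t v\<^sub>k\<close> is small in \<open>Y\<close> uniformly in \<open>k\<close> as \<open>t\<close> tends to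
  \<open>0\<close>: the norm of \<open>I - M t\<close> from \<open>X\<close> to \<open>Y\<close> is at most the product of its bounded norm from \<open>A0\<close> to
  \<open>B0\<close>, raised to the power \<open>1 - \<theta>\<close>, and its vanishing norm from \<open>A1\<close> to \<open>B1\<close>, raised to the power \<open>\<theta>\<close>.\<close>

section \<open>Seminormed spaces of points of the ambient space\<close>

text \<open>Points of \<open>X\<close> need not lie in \<open>A1\<close>, so cocompactness of
  \<open>A1\<close> in \<open>B1\<close> does not apply to them directly; \<open>M t\<close> moves
  them into \<open>A1\<close>. For a sequence \<open>g k\<close> in \<open>D\<close>, covariance
  gives \<open>g k (M t v) = M t (h k v)\<close> with \<open>h k\<close> again in \<open>D\<close>,
  and a bounded functional on \<open>A1\<close> composed with \<open>M t\<close> is a bounded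
  functional on \<open>X\<close>; hence weak convergence of \<open>h k (v k)\<close> in
  \<open>X\<close> carries over. The bound of \<open>M t\<close> from \<open>A0\<close> to
  \<open>A1\<close> may blow up as \<open>t\<close> tends to 0, so \<open>t\<close> is fixed by the
  error allowed for the remainder before \<open>k\<close> grows. The factors of the product come
  from different devices. In the real method an operator dilates the argument of the K-functional,
  and the weight turns the dilation into the power \<theta>. In the complex method an exponential
  factor balances the two boundary lines. The imbedding of the complex space into \<open>A0\<close>
  rests on the maximum principle in a strip, transferred to vectors by a norming functional; the
  same norming functionals serve to bound weakly convergent sequences. Spaces here are carriers with
  a norm inside one ambient space, and Hahn-Banach is developed for such carriers.\<close>

lemma scaleC_zero_left [simp]: "0 *\<^sub>C (x::'v::complex_tvs) = 0"
  using scaleC_add_left[of 0 0 x] by simp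

lemma scaleC_zero_right [simp]: "c *\<^sub>C (0::'v::complex_tvs) = 0"
  using scaleC_add_right[of c 0 "0::'v"] by simp

lemma scaleC_minus_left: "(- c) *\<^sub>C (x::'v::complex_tvs) = - (c *\<^sub>C x)"
  by (metis add.right_inverse add_eq_0_iff scaleC_add_left scaleC_zero_left)

lemma scaleC_minus_right: "c *\<^sub>C (- (x::'v::complex_tvs)) = - (c *\<^sub>C x)"
  by (metis add.right_inverse add_eq_0_iff scaleC_add_right scaleC_zero_right)

lemma scaleC_minus_one: "(-1) *\<^sub>C (x::'v::complex_tvs) = - x"
  by (simp add: scaleC_minus_left scaleC_one)

lemma scaleC_diff_left: "(c - d) *\<^sub>C (x::'v::complex_tvs) = c *\<^sub>C x - d *\<^sub>C x"
  by (metis add_uminus_conv_diff scaleC_add_left scaleC_minus_left)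

lemma scaleC_diff_right: "c *\<^sub>C (x - (y::'v::complex_tvs)) = c *\<^sub>C x - c *\<^sub>C y"
  by (metis add_uminus_conv_diff scaleC_add_right scaleC_minus_right)

text \<open>Homogeneity is asked for as an inequality only, since this is what an operator bound for
  multiplication by \<open>c\<close> supplies in the sum and interpolation spaces; the inverse
  scalar then gives equality.\<close>

locale seminormed =
  fixes X :: "('v::complex_tvs) nspace"
  assumes zero_mem: "0 \<in> points X"
    and add_mem: "x \<in> points X \<Longrightarrow> y \<in> points X \<Longrightarrow> x + y \<in> points X"
    and scale_mem: "x \<in> points X \<Longrightarrow> c *\<^sub>C x \<in> points X"
    and nrm_nonneg: "x \<in> points X \<Longrightarrow> 0 \<le> nrm X x"
    and nrm_add: "x \<in> points X \<Longrightarrow> y \<in> points X \<Longrightarrow> nrm X (x + y) \<le> nrm X x + nrm X y"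
    and nrm_scale_le: "x \<in> points X \<Longrightarrow> nrm X (c *\<^sub>C x) \<le> cmod c * nrm X x"
begin

lemma nrm_scale: "x \<in> points X \<Longrightarrow> nrm X (c *\<^sub>C x) = cmod c * nrm X x"
proof (rule antisym)
  assume x: "x \<in> points X"
  show "nrm X (c *\<^sub>C x) \<le> cmod c * nrm X x" by (rule nrm_scale_le[OF x])
  show "cmod c * nrm X x \<le> nrm X (c *\<^sub>C x)"
  proof (cases "c = 0")
    case True
    then show ?thesis using nrm_nonneg[OF zero_mem] by simp
  next
    case False
    have "nrm X x = nrm X (inverse c *\<^sub>C (c *\<^sub>C x))"
      using False by (simp add: scaleC_scaleC scaleC_one)
    also have "\<dots> \<le> cmod (inverse c) * nrm X (c *\<^sub>C x)"
      by (rule nrm_scale_le) (rule scale_mem[OF x])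
    finally show ?thesis using False by (simp add: norm_inverse norm_divide field_simps)
  qed
qed

lemma nrm_zero [simp]: "nrm X 0 = 0"
  using nrm_scale[OF zero_mem, of 0] by simp

lemma minus_mem: "x \<in> points X \<Longrightarrow> - x \<in> points X"
  by (metis scaleC_minus_one scale_mem)

lemma nrm_minus: "x \<in> points X \<Longrightarrow> nrm X (- x) = nrm X x"
  using nrm_scale[of x "-1"] by (simp add: scaleC_minus_one)

lemma diff_mem: "x \<in> points X \<Longrightarrow> y \<in> points X \<Longrightarrow> x - y \<in> points X"
  using add_mem[OF _ minus_mem] by fastforce

lemma nrm_diff: "x \<in> points X \<Longrightarrow> y \<in> points X \<Longrightarrow> nrm X (x - y) \<le> nrm X x + nrm X y"
  using nrm_add[OF _ minus_mem] nrm_minus by fastforce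

lemma nrm_diff_commute: "x \<in> points X \<Longrightarrow> y \<in> points X \<Longrightarrow> nrm X (x - y) = nrm X (y - x)"
  by (metis diff_mem minus_diff_eq nrm_minus)

lemma nrm_triangle_diff:
  "x \<in> points X \<Longrightarrow> y \<in> points X \<Longrightarrow> nrm X x \<le> nrm X (x - y) + nrm X y"
  using nrm_add[of "x - y" y] diff_mem by simp

lemma abs_nrm_diff_le:
  "x \<in> points X \<Longrightarrow> y \<in> points X \<Longrightarrow> \<bar>nrm X x - nrm X y\<bar> \<le> nrm X (x - y)"
  using nrm_triangle_diff[of x y] nrm_triangle_diff[of y x] nrm_diff_commute[of x y] by linarith

end

lemma banach_space_seminormed: "banach_space X \<Longrightarrow> seminormed X"
  unfolding banach_space_def by unfold_locales auto

section \<open>The Hahn--Banach theorem\<close>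

text \<open>Only strictly positive dilations and only inequalities, because this form passes to
  infima over tilts and over chains; \<open>q 0 = 0\<close> and equality for dilations
  follow.\<close>

definition sublinear_on :: "('v::complex_tvs) set \<Rightarrow> ('v \<Rightarrow> real) \<Rightarrow> bool" where
  "sublinear_on S q \<longleftrightarrow> (\<forall>x\<in>S. \<forall>y\<in>S. q (x + y) \<le> q x + q y) \<and>
     (\<forall>r>0. \<forall>x\<in>S. q (complex_of_real r *\<^sub>C x) \<le> r * q x)"

lemma sublinear_onD:
  assumes "sublinear_on S q"
  shows "\<And>x y. x \<in> S \<Longrightarrow> y \<in> S \<Longrightarrow> q (x + y) \<le> q x + q y"
    "\<And>r x. 0 < r \<Longrightarrow> x \<in> S \<Longrightarrow> q (complex_of_real r *\<^sub>C x) \<le> r * q x"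
  using assms unfolding sublinear_on_def by auto

lemma (in seminormed) sublinear_on_nrm: "sublinear_on (points X) (nrm X)"
  unfolding sublinear_on_def using nrm_add nrm_scale by auto

context seminormed
begin

lemma sublinear_zero:
  assumes "sublinear_on (points X) q" shows "q 0 = 0"
proof -
  have "q 0 \<le> 1/2 * q 0"
    using sublinear_onD(2)[OF assms, of "1/2" 0] zero_mem by simp
  moreover have "q 0 \<le> q 0 + q 0"
    using sublinear_onD(1)[OF assms zero_mem zero_mem] by simp
  ultimately show ?thesis by linarith
qed

lemma sublinear_lower:
  assumes "sublinear_on (points X) q" "x \<in> points X" shows "- q (- x) \<le> q x"
  using sublinear_onD(1)[OF assms(1,2) minus_mem[OF assms(2)]] sublinear_zero[OF assms(1)] by simp

lemma sublinear_scale: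
  assumes q: "sublinear_on (points X) q" and x: "x \<in> points X" and r: "0 \<le> r"
  shows "q (complex_of_real r *\<^sub>C x) = r * q x"
proof (cases "r = 0")
  case True
  then show ?thesis using sublinear_zero[OF q] by simp
next
  case False
  then have r: "0 < r" using r by simp
  have "q x = q (complex_of_real (inverse r) *\<^sub>C (complex_of_real r *\<^sub>C x))"
    using False by (simp add: scaleC_scaleC scaleC_one flip: of_real_mult)
  also have "\<dots> \<le> inverse r * q (complex_of_real r *\<^sub>C x)"
    using r by (intro sublinear_onD(2)[OF q] scale_mem x) simp
  finally have "r * q x \<le> q (complex_of_real r *\<^sub>C x)"
    using r by (simp add: field_simps)
  with sublinear_onD(2)[OF q r x] show ?thesis by simp
qed

text \<open>A sublinear functional that is minimal below \<open>q\<close> is additive because it coincides with its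
  own tilts in all directions.\<close>

definition tilt :: "('v \<Rightarrow> real) \<Rightarrow> 'v \<Rightarrow> 'v \<Rightarrow> real" where
  "tilt q x y =
     (if y \<in> points X then INF t\<in>{0..}. q (y + complex_of_real t *\<^sub>C x) - t * q x else 0)"

text \<open>Subadditivity for \<open>t x = (y + t x) + (- y)\<close>. The bound does not depend on
  \<open>t\<close>, so the infimum in \<open>tilt\<close> is a genuine one.\<close>

lemma tilt_lower:
  assumes q: "sublinear_on (points X) q" and x: "x \<in> points X" and y: "y \<in> points X" and t: "0 \<le> t"
  shows "- q (- y) \<le> q (y + complex_of_real t *\<^sub>C x) - t * q x"
proof -
  have "t * q x = q ((y + complex_of_real t *\<^sub>C x) + - y)"
    using sublinear_scale[OF q x t] by simp
  also have "\<dots> \<le> q (y + complex_of_real t *\<^sub>C x) + q (- y)"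
    by (intro sublinear_onD(1)[OF q] add_mem scale_mem minus_mem x y)
  finally show ?thesis by simp
qed

lemma tilt_le:
  assumes q: "sublinear_on (points X) q" and x: "x \<in> points X" and y: "y \<in> points X" and t: "0 \<le> t"
  shows "tilt q x y \<le> q (y + complex_of_real t *\<^sub>C x) - t * q x"
proof -
  have "bdd_below ((\<lambda>t. q (y + complex_of_real t *\<^sub>C x) - t * q x) ` {0..})"
    using tilt_lower[OF q x y] by (intro bdd_belowI2[where m = "- q (- y)"]) auto
  then show ?thesis unfolding tilt_def using y t by (auto intro: cINF_lower)
qed

lemma tilt_approx:
  assumes y: "y \<in> points X" and e: "0 < e"
  obtains t where "0 \<le> t" "q (y + complex_of_real t *\<^sub>C x) - t * q x < tilt q x y + e"
proof -
  let ?f = "\<lambda>t. q (y + complex_of_real t *\<^sub>C x) - t * q x"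
  have "(INF t\<in>{0..}. ?f t) < tilt q x y + e" using y e by (simp add: tilt_def)
  then have "\<exists>z\<in>?f ` {0..}. z < tilt q x y + e"
    by (intro cInf_lessD) auto
  then show ?thesis using that by auto
qed

lemma sublinear_on_tilt:
  assumes q: "sublinear_on (points X) q" and x: "x \<in> points X"
  shows "sublinear_on (points X) (tilt q x)"
  unfolding sublinear_on_def
proof (intro conjI ballI allI impI)
  fix y z assume y: "y \<in> points X" and z: "z \<in> points X"
  show "tilt q x (y + z) \<le> tilt q x y + tilt q x z"
  proof (rule field_le_epsilon)
    fix e :: real assume "0 < e"
    then have e: "0 < e / 2" by simp
    obtain t where t: "0 \<le> t" "q (y + complex_of_real t *\<^sub>C x) - t * q x < tilt q x y + e/2"
      using tilt_approx[OF y e] .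
    obtain s where s: "0 \<le> s" "q (z + complex_of_real s *\<^sub>C x) - s * q x < tilt q x z + e/2"
      using tilt_approx[OF z e] .
    have "tilt q x (y + z) \<le> q ((y + z) + complex_of_real (t + s) *\<^sub>C x) - (t + s) * q x"
      using t s by (intro tilt_le q x add_mem y z) auto
    also have "(y + z) + complex_of_real (t + s) *\<^sub>C x =
        (y + complex_of_real t *\<^sub>C x) + (z + complex_of_real s *\<^sub>C x)"
      by (simp add: scaleC_add_left algebra_simps)
    also have "q \<dots> \<le> q (y + complex_of_real t *\<^sub>C x) + q (z + complex_of_real s *\<^sub>C x)"
      by (intro sublinear_onD(1)[OF q] add_mem scale_mem x y z)
    finally show "tilt q x (y + z) \<le> tilt q x y + tilt q x z + e"
      using t s by (simp add: algebra_simps)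
  qed
next
  fix r :: real and y assume r: "0 < r" and y: "y \<in> points X"
  show "tilt q x (complex_of_real r *\<^sub>C y) \<le> r * tilt q x y"
  proof (rule field_le_epsilon)
    fix e :: real assume "0 < e"
    then have e: "0 < e / r" using r by simp
    obtain t where t: "0 \<le> t" "q (y + complex_of_real t *\<^sub>C x) - t * q x < tilt q x y + e/r"
      using tilt_approx[OF y e] .
    have "tilt q x (complex_of_real r *\<^sub>C y) \<le>
        q (complex_of_real r *\<^sub>C y + complex_of_real (r * t) *\<^sub>C x) - (r * t) * q x"
      using t r by (intro tilt_le q x scale_mem y) auto
    also have "complex_of_real r *\<^sub>C y + complex_of_real (r * t) *\<^sub>C x =
        complex_of_real r *\<^sub>C (y + complex_of_real t *\<^sub>C x)"
      by (simp add: scaleC_add_right scaleC_scaleC)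
    also have "q \<dots> \<le> r * q (y + complex_of_real t *\<^sub>C x)"
      by (intro sublinear_onD(2)[OF q] add_mem scale_mem x y r)
    also have "\<dots> - (r * t) * q x \<le> r * (tilt q x y + e / r)"
      using mult_left_mono[OF less_imp_le[OF t(2)], of r] r by (simp add: algebra_simps)
    finally show "tilt q x (complex_of_real r *\<^sub>C y) \<le> r * tilt q x y + e"
      using r by (simp add: algebra_simps)
  qed
qed

text \<open>Zorn's lemma for the reversed pointwise order. A nonempty chain is bounded by its
  pointwise infimum, which is finite because every sublinear \<open>q\<close> below \<open>p\<close>
  satisfies \<open>- p (- x) \<le> q x\<close>.\<close>

lemma minimal_sublinear_exists:
  assumes p: "sublinear_on (points X) p"
  shows "\<exists>m. sublinear_on (points X) m \<and> (\<forall>x\<in>points X. m x \<le> p x) \<and>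
    (\<forall>q. sublinear_on (points X) q \<and> (\<forall>y\<in>points X. q y \<le> m y) \<longrightarrow> (\<forall>x\<in>points X. q x = m x))"
proof -
  \<comment> \<open>The value 0 off the space is prescribed so that functions can be compared at all
    arguments of the ambient type: values off the space could otherwise be lowered forever and no
    minimum would exist.\<close>
  define Q where "Q = {q. sublinear_on (points X) q \<and> (\<forall>x\<in>points X. q x \<le> p x) \<and>
    (\<forall>x. x \<notin> points X \<longrightarrow> q x = 0)}"
  let ?P = "\<lambda>a b. \<forall>x. (b::'v \<Rightarrow> real) x \<le> a x"
  define p' where "p' = (\<lambda>x. if x \<in> points X then p x else 0)"
  have cong: "sublinear_on (points X) (\<lambda>x. if x \<in> points X then q x else 0)"
    if "sublinear_on (points X) q" for q
    using that add_mem scale_mem unfolding sublinear_on_def by simp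
  have p'Q: "p' \<in> Q" unfolding Q_def p'_def using cong[OF p] by auto
  have lower: "- p (- x) \<le> q x" if "q \<in> Q" "x \<in> points X" for q x
  proof -
    have "- q (- x) \<le> q x" using that sublinear_lower unfolding Q_def by auto
    moreover have "q (- x) \<le> p (- x)" using that minus_mem unfolding Q_def by auto
    ultimately show ?thesis by linarith
  qed
  have "\<exists>m\<in>Q. \<forall>a\<in>Q. ?P m a \<longrightarrow> a = m"
  proof (rule predicate_Zorn)
    show "partial_order_on Q (relation_of ?P Q)"
    proof (rule partial_order_on_relation_ofI)
      show "?P a c" if "?P a b" "?P b c" for a b c using that by (meson order_trans)
      show "a = b" if "?P a b" "?P b a" for a b using that by (intro ext antisym) auto
    qed simp
    fix C assume C: "C \<in> Chains (relation_of ?P Q)"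
    show "\<exists>u\<in>Q. \<forall>a\<in>C. ?P a u"
    proof (cases "C = {}")
      case True
      then show ?thesis using p'Q by blast
    next
      case False
      have CQ: "C \<subseteq> Q" using C by (auto simp: Chains_def relation_of_def)
      have tot: "(\<forall>x. b x \<le> a x) \<or> (\<forall>x. a x \<le> b x)" if "a \<in> C" "b \<in> C" for a b
        using C that by (auto simp: Chains_def relation_of_def)
      define u where "u = (\<lambda>x. if x \<in> points X then INF q\<in>C. q x else 0)"
      have bdd: "bdd_below ((\<lambda>q. q x) ` C)" if "x \<in> points X" for x
        using lower that CQ by (intro bdd_belowI2[where m = "- p (- x)"]) auto
      have u_le: "u x \<le> q x" if "q \<in> C" for q x
      proof (cases "x \<in> points X")
        case True
        then show ?thesis using that by (auto simp: u_def intro!: cINF_lower bdd)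
      next
        case False
        then show ?thesis using that CQ by (auto simp: u_def Q_def)
      qed
      have u_approx: "\<exists>q\<in>C. q x < u x + e" if "x \<in> points X" "0 < e" for x e
      proof -
        have "(INF q\<in>C. q x) < u x + e" using that by (simp add: u_def)
        then show ?thesis using cInf_lessD[of "(\<lambda>q. q x) ` C"] False by auto
      qed
      have "sublinear_on (points X) u"
        unfolding sublinear_on_def
      proof (intro conjI ballI allI impI)
        fix x y assume x: "x \<in> points X" and y: "y \<in> points X"
        show "u (x + y) \<le> u x + u y"
        proof (rule field_le_epsilon)
          fix e :: real assume "0 < e"
          then have e: "0 < e / 2" by simp
          obtain a where a: "a \<in> C" "a x < u x + e/2" using u_approx[OF x e] by blast
          obtain b where b: "b \<in> C" "b y < u y + e/2" using u_approx[OF y e] by blast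
          \<comment> \<open>Members of a chain are comparable, so the smaller of \<open>a\<close>
            and \<open>b\<close> is nearly optimal at \<open>x\<close> and at \<open>y\<close>
            simultaneously.\<close>
          obtain c where c: "c \<in> C" "c x \<le> a x" "c y \<le> b y"
            using tot[OF a(1) b(1)] a(1) b(1) by blast
          have "u (x + y) \<le> c (x + y)" by (rule u_le[OF c(1)])
          also have "\<dots> \<le> c x + c y"
            using c(1) CQ by (intro sublinear_onD(1)[OF _ x y]) (auto simp: Q_def)
          finally show "u (x + y) \<le> u x + u y + e" using a b c by simp
        qed
      next
        fix r :: real and x assume r: "0 < r" and x: "x \<in> points X"
        show "u (complex_of_real r *\<^sub>C x) \<le> r * u x"
        proof (rule field_le_epsilon)
          fix e :: real assume "0 < e"
          then have e: "0 < e / r" using r by simp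
          obtain a where a: "a \<in> C" "a x < u x + e/r" using u_approx[OF x e] by blast
          have "u (complex_of_real r *\<^sub>C x) \<le> a (complex_of_real r *\<^sub>C x)" by (rule u_le[OF a(1)])
          also have "\<dots> \<le> r * a x"
            using a(1) CQ by (intro sublinear_onD(2)[OF _ r x]) (auto simp: Q_def)
          also have "\<dots> \<le> r * (u x + e / r)" using a r by simp
          finally show "u (complex_of_real r *\<^sub>C x) \<le> r * u x + e" using r by (simp add: algebra_simps)
        qed
      qed
      moreover have "u x \<le> p x" if "x \<in> points X" for x
      proof -
        obtain q where "q \<in> C" using False by blast
        then show ?thesis using u_le[of q x] CQ that by (force simp: Q_def)
      qed
      ultimately have "u \<in> Q" by (auto simp: Q_def u_def)
      then show ?thesis using u_le by blast
    qed
  qed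
  then obtain m where m: "m \<in> Q" and min: "\<And>a. a \<in> Q \<Longrightarrow> ?P m a \<Longrightarrow> a = m" by blast
  show ?thesis
  proof (intro exI[of _ m] conjI allI impI ballI; (elim conjE)?)
    show "sublinear_on (points X) m" using m by (simp add: Q_def)
    show "m x \<le> p x" if "x \<in> points X" for x using m that by (simp add: Q_def)
    fix q x assume q: "sublinear_on (points X) q" "\<forall>y\<in>points X. q y \<le> m y" and x: "x \<in> points X"
    let ?q = "\<lambda>x. if x \<in> points X then q x else 0"
    have "?q \<in> Q" using q m cong[OF q(1)] unfolding Q_def by (simp, meson order_trans)
    moreover have "?P m ?q" using q m by (auto simp: Q_def)
    ultimately have "?q = m" by (rule min)
    then show "q x = m x" using x by (auto dest: fun_cong)
  qed
qed

text \<open>The minimal functional \<open>m\<close> is taken below \<open>tilt p u\<close> rather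
  than just below \<open>p\<close>. At \<open>- u\<close> this tilt is at most
  \<open>p 0 - p u\<close>, so \<open>- m u \<le> - p u\<close>: the functional is norming at
  \<open>u\<close> without any extension from a line.\<close>

lemma real_Hahn_Banach:
  assumes p: "sublinear_on (points X) p" and u: "u \<in> points X"
  shows "\<exists>f. (\<forall>x\<in>points X. \<forall>y\<in>points X. f (x + y) = f x + f y) \<and>
    (\<forall>r. \<forall>x\<in>points X. f (complex_of_real r *\<^sub>C x) = r * f x) \<and>
    (\<forall>x\<in>points X. f x \<le> p x) \<and> p u \<le> f u"
proof -
  obtain m where m: "sublinear_on (points X) m" and mp: "\<And>x. x \<in> points X \<Longrightarrow> m x \<le> tilt p u x"
    and min: "\<And>q x. sublinear_on (points X) q \<Longrightarrow> (\<And>y. y \<in> points X \<Longrightarrow> q y \<le> m y) \<Longrightarrow>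
       x \<in> points X \<Longrightarrow> q x = m x"
    using minimal_sublinear_exists[OF sublinear_on_tilt[OF p u]] by blast
  have le0: "tilt q x y \<le> q y"
    if "sublinear_on (points X) q" "x \<in> points X" "y \<in> points X" for q x y
    using tilt_le[OF that, of 0] by simp
  have le1: "tilt q x y \<le> q (y + x) - q x"
    if "sublinear_on (points X) q" "x \<in> points X" "y \<in> points X" for q x y
    using tilt_le[OF that, of 1] by (simp add: scaleC_one)
  have add: "m (x + y) = m x + m y" if x: "x \<in> points X" and y: "y \<in> points X" for x y
  proof (rule antisym)
    have "tilt m x y = m y"
      by (rule min[OF sublinear_on_tilt[OF m x] le0[OF m x] y])
    then show "m x + m y \<le> m (x + y)" using le1[OF m x y] by (simp add: add.commute)
  qed (rule sublinear_onD(1)[OF m x y])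
  have neg: "m (- x) = - m x" if "x \<in> points X" for x
    using add[OF that minus_mem[OF that]] sublinear_zero[OF m] by simp
  show ?thesis
  proof (intro exI[of _ m] conjI ballI allI)
    show "m (complex_of_real r *\<^sub>C x) = r * m x" if x: "x \<in> points X" for r x
    proof (cases "0 \<le> r")
      case False
      have "m (complex_of_real r *\<^sub>C x) = m (- (complex_of_real (- r) *\<^sub>C x))"
        by (simp add: scaleC_minus_left)
      also have "\<dots> = r * m x"
        using False neg[OF scale_mem[OF x], of "complex_of_real (- r)"] sublinear_scale[OF m x, of "- r"]
        by simp
      finally show ?thesis .
    qed (rule sublinear_scale[OF m x])
    show "m x \<le> p x" if "x \<in> points X" for x
      using mp[OF that] le0[OF p u that] by simp
    show "p u \<le> m u"
      using mp[OF minus_mem[OF u]] le1[OF p u minus_mem[OF u]] neg[OF u] sublinear_zero[OF p] by simp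
    show "m (x + y) = m x + m y" if "x \<in> points X" "y \<in> points X" for x y using that by (rule add)
  qed
qed

text \<open>\<open>f x - \<i> * f (\<i> x)\<close> is the complex linear functional with real part
  \<open>f\<close>. The factor 2 comes from estimating the modulus by the sum of the moduli of real
  and imaginary part; only its finiteness matters for the imbedding into \<open>A0\<close>.\<close>

lemma Hahn_Banach_norming:
  assumes u: "u \<in> points X"
  obtains \<phi> where "bounded_functional X \<phi>" "\<forall>x\<in>points X. cmod (\<phi> x) \<le> 2 * nrm X x"
    "nrm X u \<le> cmod (\<phi> u)"
proof -
  obtain f where f: "\<And>x y. x \<in> points X \<Longrightarrow> y \<in> points X \<Longrightarrow> f (x + y) = f x + f y"
    "\<And>r x. x \<in> points X \<Longrightarrow> f (complex_of_real r *\<^sub>C x) = r * f x"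
    "\<And>x. x \<in> points X \<Longrightarrow> f x \<le> nrm X x" "nrm X u \<le> f u"
    using real_Hahn_Banach[OF sublinear_on_nrm u] by blast
  have neg: "f (- x) = - f x" if "x \<in> points X" for x
    using f(2)[OF that, of "-1"] by (simp add: scaleC_minus_one)
  have abs: "\<bar>f x\<bar> \<le> nrm X x" if "x \<in> points X" for x
    using f(3)[OF that] f(3)[OF minus_mem[OF that]] neg[OF that] nrm_minus[OF that] by linarith
  define \<phi> where "\<phi> = (\<lambda>x. Complex (f x) (- f (\<i> *\<^sub>C x)))"
  have add: "\<phi> (x + y) = \<phi> x + \<phi> y" if "x \<in> points X" "y \<in> points X" for x y
      using that by (simp add: \<phi>_def scaleC_add_right f(1) scale_mem complex_eq_iff)
  have scale: "\<phi> (c *\<^sub>C x) = c * \<phi> x" if x: "x \<in> points X" for c x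
    proof -
      have "c *\<^sub>C x = complex_of_real (Re c) *\<^sub>C x + complex_of_real (Im c) *\<^sub>C (\<i> *\<^sub>C x)"
        unfolding scaleC_scaleC scaleC_add_left[symmetric]
        by (rule arg_cong[where f = "\<lambda>c. c *\<^sub>C x"]) (simp add: complex_eq_iff)
      then have 1: "f (c *\<^sub>C x) = Re c * f x + Im c * f (\<i> *\<^sub>C x)"
        by (simp add: f(1,2) scale_mem x)
      have "\<i> *\<^sub>C (c *\<^sub>C x) = (complex_of_real (Re c) * \<i> - complex_of_real (Im c)) *\<^sub>C x"
        unfolding scaleC_scaleC by (rule arg_cong[where f = "\<lambda>c. c *\<^sub>C x"]) (simp add: complex_eq_iff)
      also have "\<dots> = complex_of_real (Re c) *\<^sub>C (\<i> *\<^sub>C x) + complex_of_real (- Im c) *\<^sub>C x"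
        by (simp add: scaleC_diff_left scaleC_scaleC scaleC_minus_left)
      finally have 2: "f (\<i> *\<^sub>C (c *\<^sub>C x)) = Re c * f (\<i> *\<^sub>C x) - Im c * f x"
        by (simp add: f(1,2) scale_mem x del: of_real_minus)
      show ?thesis unfolding \<phi>_def using 1 2 by (simp add: complex_eq_iff)
    qed
  have bound: "cmod (\<phi> x) \<le> 2 * nrm X x" if x: "x \<in> points X" for x
    proof -
      have "cmod (\<phi> x) \<le> \<bar>f x\<bar> + \<bar>f (\<i> *\<^sub>C x)\<bar>"
        using cmod_le[of "\<phi> x"] by (simp add: \<phi>_def)
      then show ?thesis using abs[OF x] abs[OF scale_mem[OF x], of \<i>] nrm_scale[OF x, of \<i>] by simp
    qed
  show thesis
  proof (rule that[of \<phi>])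
    show "bounded_functional X \<phi>"
      unfolding bounded_functional_def using add scale bound by blast
    show "\<forall>x\<in>points X. cmod (\<phi> x) \<le> 2 * nrm X x" using bound by blast
    show "nrm X u \<le> cmod (\<phi> u)"
      using f(4) complex_Re_le_cmod[of "\<phi> u"] by (simp add: \<phi>_def)
  qed
qed

section \<open>Weakly bounded sequences are bounded\<close>

text \<open>Gliding hump. The signs of the terms of the series \<open>\<Sum>n. \<plusminus> 9\<^sup>- \<^sup>n \<psi>\<^sub>n\<close>, where \<open>\<psi>\<^sub>n\<close> norms the
  \<open>n\<close>-th member of a fast growing subsequence, are chosen so that its partial sums stay large on
  these members; the sum is then a functional that is unbounded on the sequence.\<close>

lemma weakly_bounded_imp_bounded:
  fixes u :: "nat \<Rightarrow> 'v"
  assumes u: "\<And>k. u k \<in> points X"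
    and weak: "\<And>\<phi>. bounded_functional X \<phi> \<Longrightarrow> bounded (range (\<lambda>k. \<phi> (u k)))"
  obtains N where "\<And>k. nrm X (u k) \<le> N"
proof (rule ccontr)
  assume "\<not> thesis"
  \<comment> \<open>The growth is chosen so that the \<open>n\<close>-th hump still exceeds
    \<open>n\<close> after multiplication by the coefficient \<open>1 / 9 ^ n\<close>.\<close>
  then have "\<exists>k. real n * 9 ^ n < nrm X (u k)" for n
    using that by (meson not_le)
  then obtain r where r: "\<And>n. real n * 9 ^ n < nrm X (u (r n))" by metis
  define v where "v = (\<lambda>n. u (r n))"
  have v: "v n \<in> points X" for n using u by (simp add: v_def)
  have "\<exists>\<phi>. bounded_functional X \<phi> \<and> (\<forall>x\<in>points X. cmod (\<phi> x) \<le> 2 * nrm X x) \<and> nrm X (v n) \<le> cmod (\<phi> (v n))" for n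
    using Hahn_Banach_norming[OF v[of n]] by metis
  then obtain \<psi> where \<psi>: "\<And>n. bounded_functional X (\<psi> n)" "\<And>n x. x \<in> points X \<Longrightarrow> cmod (\<psi> n x) \<le> 2 * nrm X x"
    "\<And>n. nrm X (v n) \<le> cmod (\<psi> n (v n))" by metis
  define Q where "Q = (\<lambda>n \<Phi> \<Phi>'.
    (\<forall>x\<in>points X. cmod (\<Phi>' x - \<Phi> x) \<le> 2 * nrm X x / 9 ^ n) \<and> nrm X (v n) / 9 ^ n \<le> cmod (\<Phi>' (v n)))"
  have "\<exists>\<Phi>. \<forall>n. bounded_functional X (\<Phi> n) \<and> Q n (\<Phi> n) (\<Phi> (Suc n))"
  proof (rule dependent_nat_choice)
    show "\<exists>\<Phi>. bounded_functional X \<Phi>" using \<psi>(1) by blast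
    fix \<Phi> n assume \<Phi>: "bounded_functional X \<Phi>"
    define P where "P = (\<lambda>s x. \<Phi> x + s * (\<psi> n x / 9 ^ n))"
    have "bounded_functional X (P s)" for s
    proof -
      obtain C where C: "\<And>x. x \<in> points X \<Longrightarrow> cmod (\<Phi> x) \<le> C * nrm X x"
        using \<Phi> unfolding bounded_functional_def by blast
      have "cmod (P s x) \<le> (C + cmod s * (2 / 9 ^ n)) * nrm X x" if x: "x \<in> points X" for x
      proof -
        have "cmod (P s x) \<le> cmod (\<Phi> x) + cmod s * (cmod (\<psi> n x) / 9 ^ n)"
          unfolding P_def using norm_triangle_ineq[of "\<Phi> x" "s * (\<psi> n x / 9 ^ n)"]
          by (simp add: norm_mult norm_divide norm_power)
        also have "\<dots> \<le> C * nrm X x + cmod s * (2 * nrm X x / 9 ^ n)"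
          by (intro add_mono C x mult_left_mono divide_right_mono \<psi>(2)) auto
        finally show ?thesis by (simp add: algebra_simps)
      qed
      then show ?thesis
        using \<Phi> \<psi>(1)[of n] unfolding bounded_functional_def P_def
        by (auto simp: add_divide_distrib distrib_left)
    qed
    moreover have "cmod (P s x - \<Phi> x) \<le> 2 * nrm X x / 9 ^ n" if "cmod s = 1" "x \<in> points X" for s x
      using \<psi>(2)[OF that(2), of n] that by (simp add: P_def norm_mult norm_divide norm_power divide_right_mono)
    moreover have "\<exists>s\<in>{1,-1}. nrm X (v n) / 9 ^ n \<le> cmod (P s (v n))"
    proof -
      \<comment> \<open>The two candidates differ at \<open>v n\<close> by twice the hump, so one of
        them is at least as large as the hump there, whatever value \<open>\<Phi>\<close>
        has.\<close>
      have "2 * cmod (\<psi> n (v n) / 9 ^ n) = cmod (P 1 (v n) - P (-1) (v n))"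
        by (simp add: P_def norm_mult norm_divide)
      also have "\<dots> \<le> cmod (P 1 (v n)) + cmod (P (-1) (v n))" by (rule norm_triangle_ineq4)
      finally have "cmod (\<psi> n (v n) / 9 ^ n) \<le> cmod (P 1 (v n)) \<or> cmod (\<psi> n (v n) / 9 ^ n) \<le> cmod (P (-1) (v n))"
        by linarith
      moreover have "nrm X (v n) / 9 ^ n \<le> cmod (\<psi> n (v n) / 9 ^ n)"
        using \<psi>(3)[of n] by (simp add: norm_divide norm_power divide_right_mono)
      ultimately show ?thesis by force
    qed
    moreover have "cmod s = 1" if "s \<in> {1,-1}" for s using that by auto
    ultimately show "\<exists>\<Phi>'. bounded_functional X \<Phi>' \<and> Q n \<Phi> \<Phi>'" unfolding Q_def by blast
  qed
  then obtain \<Phi> where \<Phi>: "\<And>n. bounded_functional X (\<Phi> n)" "\<And>n x. x \<in> points X \<Longrightarrow> cmod (\<Phi> (Suc n) x - \<Phi> n x) \<le> 2 * nrm X x / 9 ^ n"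
    "\<And>n. nrm X (v n) / 9 ^ n \<le> cmod (\<Phi> (Suc n) (v n))"
    unfolding Q_def by blast
  \<comment> \<open>The bounds on the increments from stage \<open>n\<close> on form a geometric
    series with ratio 1/9, and 2 / (1 - 1/9) = 9/4.\<close>
  have geo: "(\<lambda>i. 2 * nrm X x / 9 ^ (i + n)) sums (9 / 4 * nrm X x / 9 ^ n)" for x n
  proof -
    have "(\<lambda>i. (2 * nrm X x / 9 ^ n) * (1/9) ^ i) sums ((2 * nrm X x / 9 ^ n) * (1 / (1 - 1/9)))"
      by (intro sums_mult geometric_sums) simp
    then show ?thesis by (simp add: power_add field_simps)
  qed
  have summ: "summable (\<lambda>i. cmod (\<Phi> (Suc (i + n)) x - \<Phi> (i + n) x))"
    and tail: "(\<Sum>i. cmod (\<Phi> (Suc (i + n)) x - \<Phi> (i + n) x)) \<le> 9 / 4 * nrm X x / 9 ^ n"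
    if x: "x \<in> points X" for x n
  proof -
    show s: "summable (\<lambda>i. cmod (\<Phi> (Suc (i + n)) x - \<Phi> (i + n) x))"
      using \<Phi>(2)[OF x] by (intro summable_comparison_test'[OF sums_summable[OF geo[of x n]]]) auto
    show "(\<Sum>i. cmod (\<Phi> (Suc (i + n)) x - \<Phi> (i + n) x)) \<le> 9 / 4 * nrm X x / 9 ^ n"
      using suminf_le[OF \<Phi>(2)[OF x] s sums_summable[OF geo]] sums_unique[OF geo, of x n] by simp
  qed
  define \<phi> where "\<phi> = (\<lambda>x. lim (\<lambda>n. \<Phi> n x))"
  have conv: "(\<lambda>n. \<Phi> n x) \<longlonglongrightarrow> \<phi> x" if x: "x \<in> points X" for x
  proof -
    have "summable (\<lambda>i. \<Phi> (Suc i) x - \<Phi> i x)"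
      by (rule summable_norm_cancel) (use summ[OF x, of 0] in simp)
    then have "convergent (\<lambda>n. \<Sum>i<n. \<Phi> (Suc i) x - \<Phi> i x)"
      by (rule iffD1[OF summable_iff_convergent])
    then obtain L where "(\<lambda>n. \<Sum>i<n. \<Phi> (Suc i) x - \<Phi> i x) \<longlonglongrightarrow> L"
      unfolding convergent_def by blast
    then have "(\<lambda>n. \<Phi> n x - \<Phi> 0 x) \<longlonglongrightarrow> L"
      by (simp only: sum_lessThan_telescope[of "\<lambda>n. \<Phi> n x"])
    from tendsto_add[OF this tendsto_const[of "\<Phi> 0 x"]]
    have "(\<lambda>n. \<Phi> n x) \<longlonglongrightarrow> L + \<Phi> 0 x" by simp
    then show ?thesis unfolding \<phi>_def by (simp add: limI)
  qed
  have close: "cmod (\<phi> x - \<Phi> n x) \<le> 9 / 4 * nrm X x / 9 ^ n" if x: "x \<in> points X" for x n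
  proof -
    have "(\<lambda>i. \<Phi> (i + n) x) \<longlonglongrightarrow> \<phi> x" using conv[OF x] by (rule LIMSEQ_ignore_initial_segment)
    then have "(\<lambda>i. \<Phi> (Suc i + n) x - \<Phi> (i + n) x) sums (\<phi> x - \<Phi> (0 + n) x)"
      by (rule telescope_sums)
    then have "\<phi> x - \<Phi> n x = (\<Sum>i. \<Phi> (Suc (i + n)) x - \<Phi> (i + n) x)"
      by (simp add: sums_iff)
    also have "cmod \<dots> \<le> (\<Sum>i. cmod (\<Phi> (Suc (i + n)) x - \<Phi> (i + n) x))"
      by (rule summable_norm[OF summ[OF x]])
    also note tail[OF x]
    finally show ?thesis .
  qed
  have "bounded_functional X \<phi>"
    unfolding bounded_functional_def
  proof (intro conjI ballI allI)
    fix x y assume x: "x \<in> points X" and y: "y \<in> points X"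
    have "(\<lambda>n. \<Phi> n (x + y)) \<longlonglongrightarrow> \<phi> x + \<phi> y"
      using tendsto_add[OF conv[OF x] conv[OF y]] \<Phi>(1) x y unfolding bounded_functional_def by simp
    then show "\<phi> (x + y) = \<phi> x + \<phi> y" by (rule LIMSEQ_unique[OF conv[OF add_mem[OF x y]]])
  next
    fix c x assume x: "x \<in> points X"
    have "(\<lambda>n. \<Phi> n (c *\<^sub>C x)) \<longlonglongrightarrow> c * \<phi> x"
      using tendsto_mult_left[OF conv[OF x], of c] \<Phi>(1) x unfolding bounded_functional_def by simp
    then show "\<phi> (c *\<^sub>C x) = c * \<phi> x" by (rule LIMSEQ_unique[OF conv[OF scale_mem[OF x]]])
  next
    show "\<exists>C. \<forall>x\<in>points X. cmod (\<phi> x) \<le> C * nrm X x"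
    proof -
      obtain C where C: "\<And>x. x \<in> points X \<Longrightarrow> cmod (\<Phi> 0 x) \<le> C * nrm X x"
        using \<Phi>(1)[of 0] unfolding bounded_functional_def by blast
      have "cmod (\<phi> x) \<le> (9/4 + C) * nrm X x" if x: "x \<in> points X" for x
        using close[OF x, of 0] C[OF x] norm_triangle_sub[of "\<phi> x" "\<Phi> 0 x"] by (simp add: algebra_simps)
      then show ?thesis by blast
    qed
  qed
  then have "bounded (range (\<lambda>k. \<phi> (u k)))" by (rule weak)
  then obtain K where K: "\<And>k. cmod (\<phi> (u k)) \<le> K" by (auto simp: bounded_iff)
  obtain n :: nat where n: "4 / 3 * K < real n" using reals_Archimedean2 by blast
  have "nrm X (v n) / 9 ^ n \<le> cmod (\<Phi> (Suc n) (v n))" by (rule \<Phi>(3))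
  also have "\<dots> \<le> cmod (\<phi> (v n)) + cmod (\<phi> (v n) - \<Phi> (Suc n) (v n))"
    by (metis norm_minus_commute norm_triangle_sub)
  \<comment> \<open>The increments after the \<open>n\<close>-th add up to at most 9/4 * 1/9 = 1/4
    of the bound \<open>nrm X (v n) / 9 ^ n\<close>, so three quarters of it survive in the limit.
    This is what the ratio 1/9 is for.\<close>
  also have "\<dots> \<le> K + 9 / 4 * nrm X (v n) / 9 ^ Suc n"
    using K[of "r n"] close[OF v, of n "Suc n"] by (simp add: v_def)
  finally have "3 / 4 * (nrm X (v n) / 9 ^ n) \<le> K" by (simp add: field_simps)
  moreover have "real n < nrm X (v n) / 9 ^ n" using r[of n] by (simp add: v_def field_simps)
  ultimately show False using n by linarith
qed

end

section \<open>Weighted Lebesgue norms\<close>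

text \<open>The integral of the real method with an arbitrary \<open>k\<close> in place of the
  K-functional, so that Minkowski's inequality and the effect of dilations become statements about
  functions of \<open>t\<close>.\<close>

definition weighted_integral :: "real \<Rightarrow> real \<Rightarrow> (real \<Rightarrow> real) \<Rightarrow> ennreal" where
  "weighted_integral \<theta> p k = (\<integral>\<^sup>+ t\<in>{0<..}. ennreal ((t powr (- \<theta>) * k t) powr p / t) \<partial>lborel)"

definition weighted_norm :: "real \<Rightarrow> ereal \<Rightarrow> (real \<Rightarrow> real) \<Rightarrow> ennreal" where
  "weighted_norm \<theta> q k =
     (if q = \<infinity> then (SUP t\<in>{0<..}. ennreal (t powr (- \<theta>) * k t))
      else let p = real_of_ereal q; I = weighted_integral \<theta> p k
           in if I = \<infinity> then \<infinity> else ennreal (enn2real I powr (1 / p)))"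

lemma weighted_norm_infinity_le_iff:
  assumes "0 \<le> C"
  shows "weighted_norm \<theta> \<infinity> k \<le> ennreal C \<longleftrightarrow> (\<forall>t>0. t powr (- \<theta>) * k t \<le> C)"
  using assms by (auto simp: weighted_norm_def SUP_le_iff)

text \<open>Converts norm bounds into integral bounds; later estimates then avoid the infinite case
  and the root of order \<open>p\<close>.\<close>

lemma weighted_norm_le_iff:
  assumes p: "0 < p" and C: "0 \<le> C"
  shows "weighted_norm \<theta> (ereal p) k \<le> ennreal C \<longleftrightarrow> weighted_integral \<theta> p k \<le> ennreal (C powr p)"
proof (cases "weighted_integral \<theta> p k")
  case (real i)
  have "i powr (1 / p) \<le> C \<longleftrightarrow> i \<le> C powr p"
  proof
    assume "i powr (1 / p) \<le> C"
    then have "(i powr (1 / p)) powr p \<le> C powr p" using p by (intro powr_mono2) auto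
    then show "i \<le> C powr p" using p real(1) by (simp add: powr_powr)
  next
    assume "i \<le> C powr p"
    then have "i powr (1 / p) \<le> (C powr p) powr (1 / p)" using p real(1) by (intro powr_mono2) auto
    then show "i powr (1 / p) \<le> C" using p C by (simp add: powr_powr)
  qed
  then show ?thesis using real C by (simp add: weighted_norm_def)
next
  case top
  then show ?thesis by (simp add: weighted_norm_def top_unique)
qed

lemma exponent_cases:
  assumes "(1::ereal) \<le> q"
  obtains (infinity) "q = \<infinity>" | (finite) p where "q = ereal p" "1 \<le> p"
  using assms by (cases q) auto

lemma weighted_integral_mono:
  assumes "0 \<le> p" "\<And>t. 0 < t \<Longrightarrow> 0 \<le> k t" "\<And>t. 0 < t \<Longrightarrow> k t \<le> k' t"
  shows "weighted_integral \<theta> p k \<le> weighted_integral \<theta> p k'"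
  unfolding weighted_integral_def using assms
  by (intro nn_integral_mono)
     (auto simp: indicator_def intro!: ennreal_leI divide_right_mono powr_mono2 mult_left_mono)

lemma weighted_norm_mono:
  assumes q: "1 \<le> q" and k: "\<And>t. 0 < t \<Longrightarrow> 0 \<le> k t" "\<And>t. 0 < t \<Longrightarrow> k t \<le> k' t"
    and C: "0 \<le> C" "weighted_norm \<theta> q k' \<le> ennreal C"
  shows "weighted_norm \<theta> q k \<le> ennreal C"
  using q
proof (cases rule: exponent_cases)
  case infinity
  have "t powr (- \<theta>) * k t \<le> C" if "0 < t" for t
  proof -
    have "t powr (- \<theta>) * k t \<le> t powr (- \<theta>) * k' t"
      using k(2)[OF that] by (intro mult_left_mono) auto
    also have "\<dots> \<le> C" using C that infinity by (simp add: weighted_norm_infinity_le_iff)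
    finally show ?thesis .
  qed
  then show ?thesis using C(1) infinity by (simp add: weighted_norm_infinity_le_iff)
next
  case (finite p)
  then show ?thesis
    using weighted_integral_mono[of p k k' \<theta>] k C by (auto simp: weighted_norm_le_iff)
qed

text \<open>Convexity of the \<open>p\<close>-th power at the points \<open>a / C1\<close> and
  \<open>b / C2\<close> with weights \<open>C1 / (C1 + C2)\<close> and
  \<open>C2 / (C1 + C2)\<close>. Integrated over \<open>t\<close>, this is Minkowski's inequality
  for functions with norms at most \<open>C1\<close> and \<open>C2\<close>.\<close>

lemma powr_add_convex:
  fixes a b C1 C2 p :: real
  assumes p: "1 \<le> p" and ab: "0 \<le> a" "0 \<le> b" and C: "0 < C1" "0 < C2"
  shows "(a + b) powr p \<le> (C1 + C2) powr p *
    (C1 / (C1 + C2) * (a powr p / C1 powr p) + C2 / (C1 + C2) * (b powr p / C2 powr p))"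
proof -
  define w where "w = C2 / (C1 + C2)"
  have w: "0 < w" "w < 1" and w': "C1 / (C1 + C2) = 1 - w" using C by (auto simp: w_def field_simps)
  define x where "x = a / C1"
  define y where "y = b / C2"
  have xy: "0 \<le> x" "0 \<le> y" using ab C by (auto simp: x_def y_def)
  \<comment> \<open>Settles the case of a vanishing argument by hand; convexity is applied at
    positive arguments only.\<close>
  have small: "(s * z) powr p \<le> s * z powr p" if "0 < s" "s < 1" "0 \<le> z" for s z :: real
  proof -
    have "s powr p \<le> s powr 1" using that p by (intro powr_mono') auto
    then show ?thesis using that by (simp add: powr_mult mult_right_mono)
  qed
  have "((1 - w) * x + w * y) powr p \<le> (1 - w) * x powr p + w * y powr p"
  proof (cases "x = 0 \<or> y = 0")
    case True
    then show ?thesis using small[of "1 - w" x] small[of w y] xy w p by auto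
  next
    case False
    then show ?thesis
      using convex_onD[OF powr_convex[OF p], of w x y] xy w by auto
  qed
  moreover have "a + b = (C1 + C2) * ((1 - w) * x + w * y)"
  proof -
    have "(C1 + C2) * (1 - w) = C1" "(C1 + C2) * w = C2"
      using C unfolding w'[symmetric] by (auto simp: w_def)
    then have "(C1 + C2) * ((1 - w) * x + w * y) = C1 * x + C2 * y"
      unfolding distrib_left mult.assoc[symmetric] by simp
    then show ?thesis using C by (simp add: x_def y_def)
  qed
  moreover have "0 \<le> (1 - w) * x + w * y" using xy w by simp
  ultimately show ?thesis
    using ab C unfolding w' w_def[symmetric]
    by (simp add: powr_mult x_def y_def powr_divide mult_left_mono)
qed

text \<open>Minkowski's inequality by the pointwise convexity estimate, whose weights make the two
  integral bounds add up to \<open>(C + C') powr p\<close>. The weights divide by \<open>C\<close>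
  and \<open>C'\<close>, hence the strict positivity. Monotonicity, which K-functionals have in
  \<open>t\<close>, provides measurability.\<close>

lemma weighted_norm_add:
  assumes q: "1 \<le> q"
    and k: "mono_on {0<..} k" "\<And>t. 0 < t \<Longrightarrow> 0 \<le> k t"
    and k': "mono_on {0<..} k'" "\<And>t. 0 < t \<Longrightarrow> 0 \<le> k' t"
    and C: "0 < C" "weighted_norm \<theta> q k \<le> ennreal C"
    and C': "0 < C'" "weighted_norm \<theta> q k' \<le> ennreal C'"
  shows "weighted_norm \<theta> q (\<lambda>t. k t + k' t) \<le> ennreal (C + C')"
  using q
proof (cases rule: exponent_cases)
  case infinity
  have "t powr (- \<theta>) * (k t + k' t) \<le> C + C'" if "0 < t" for t
    using C C' that infinity by (auto simp: weighted_norm_infinity_le_iff distrib_left intro!: add_mono)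
  then show ?thesis
    unfolding infinity using C(1) C'(1) by (subst weighted_norm_infinity_le_iff) auto
next
  case (finite p)
  have meas: "(\<lambda>t. ennreal ((t powr (- \<theta>) * f t) powr p / t) * indicator {0<..} t) \<in> borel_measurable lborel"
    if "mono_on {0<..} f" for f :: "real \<Rightarrow> real"
  proof -
    have "(\<lambda>t. indicator {0<..} t *\<^sub>R f t) \<in> borel_measurable borel"
      using borel_measurable_mono_on_fnc[OF that] by (subst (asm) borel_measurable_restrict_space_iff) auto
    then have "(\<lambda>t. ennreal ((t powr (- \<theta>) * (indicator {0<..} t *\<^sub>R f t)) powr p / t) * indicator {0<..} t)
        \<in> borel_measurable lborel"
      by measurable
    also have "(\<lambda>t. ennreal ((t powr (- \<theta>) * (indicator {0<..} t *\<^sub>R f t)) powr p / t) * indicator {0<..} t) =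
      (\<lambda>t. ennreal ((t powr (- \<theta>) * f t) powr p / t) * indicator {0<..} t)"
      by (auto simp: indicator_def fun_eq_iff)
    finally show ?thesis .
  qed
  define \<alpha> where "\<alpha> = (C + C') powr p * (C / (C + C') / C powr p)"
  define \<beta> where "\<beta> = (C + C') powr p * (C' / (C + C') / C' powr p)"
  have nonneg: "0 \<le> \<alpha>" "0 \<le> \<beta>" using C(1) C'(1) by (auto simp: \<alpha>_def \<beta>_def)
  have "weighted_integral \<theta> p (\<lambda>t. k t + k' t) \<le>
    (\<integral>\<^sup>+ t. ennreal \<alpha> * (ennreal ((t powr (- \<theta>) * k t) powr p / t) * indicator {0<..} t) +
         ennreal \<beta> * (ennreal ((t powr (- \<theta>) * k' t) powr p / t) * indicator {0<..} t) \<partial>lborel)"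
    unfolding weighted_integral_def
  proof (rule nn_integral_mono)
    fix t :: real
    have "(t powr (- \<theta>) * (k t + k' t)) powr p / t \<le>
        \<alpha> * ((t powr (- \<theta>) * k t) powr p / t) + \<beta> * ((t powr (- \<theta>) * k' t) powr p / t)" if t: "0 < t"
    proof -
      have "(t powr (- \<theta>) * k t + t powr (- \<theta>) * k' t) powr p \<le>
         \<alpha> * (t powr (- \<theta>) * k t) powr p + \<beta> * (t powr (- \<theta>) * k' t) powr p"
        using powr_add_convex[OF finite(2) _ _ C(1) C'(1), of "t powr (- \<theta>) * k t" "t powr (- \<theta>) * k' t"]
          k(2)[OF t] k'(2)[OF t] by (simp add: \<alpha>_def \<beta>_def algebra_simps)
      from divide_right_mono[OF this, of t] show ?thesis using t by (simp add: distrib_left add_divide_distrib)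
    qed
    then show "ennreal ((t powr (- \<theta>) * (k t + k' t)) powr p / t) * indicator {0<..} t \<le>
      ennreal \<alpha> * (ennreal ((t powr (- \<theta>) * k t) powr p / t) * indicator {0<..} t) +
      ennreal \<beta> * (ennreal ((t powr (- \<theta>) * k' t) powr p / t) * indicator {0<..} t)"
      using nonneg by (auto simp: indicator_def ennreal_mult'[symmetric] ennreal_plus[symmetric]
          simp del: ennreal_plus intro!: ennreal_leI)
  qed
  also have "\<dots> = ennreal \<alpha> * weighted_integral \<theta> p k + ennreal \<beta> * weighted_integral \<theta> p k'"
    unfolding weighted_integral_def
    using meas[OF k(1)] meas[OF k'(1)] by (simp add: nn_integral_add nn_integral_cmult)
  also have "\<dots> \<le> ennreal \<alpha> * ennreal (C powr p) + ennreal \<beta> * ennreal (C' powr p)"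
    using C C' finite by (intro add_mono mult_left_mono) (auto simp: weighted_norm_le_iff)
  also have "\<dots> = ennreal (\<alpha> * C powr p + \<beta> * C' powr p)"
    using nonneg by (simp add: ennreal_mult' ennreal_plus)
  also have "\<alpha> * C powr p + \<beta> * C' powr p = (C + C') powr p"
  proof -
    have "\<alpha> * C powr p = (C + C') powr p * (C / (C + C'))"
      "\<beta> * C' powr p = (C + C') powr p * (C' / (C + C'))"
      using C(1) C'(1) by (auto simp: \<alpha>_def \<beta>_def)
    then have "\<alpha> * C powr p + \<beta> * C' powr p = (C + C') powr p * ((C + C') / (C + C'))"
      by (simp only: distrib_left add_divide_distrib)
    then show ?thesis using C(1) C'(1) by simp
  qed
  finally show ?thesis
    unfolding finite(1) using C(1) C'(1) finite(2) by (subst weighted_norm_le_iff) auto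
qed

text \<open>The measure \<open>dt / t\<close> is dilation invariant: the factor \<open>s\<close> of
  the substitution cancels against \<open>1 / (s * t)\<close>, and only the weight leaves a trace,
  namely \<open>s powr \<theta>\<close>.\<close>

lemma weighted_integral_dilate:
  assumes k: "mono_on {0<..} k" "\<And>t. 0 < t \<Longrightarrow> 0 \<le> k t" and c: "0 < c" and s: "0 < s"
  shows "weighted_integral \<theta> p (\<lambda>t. c * k (s * t)) = ennreal ((c * s powr \<theta>) powr p) * weighted_integral \<theta> p k"
proof -
  let ?f = "\<lambda>t. ennreal ((t powr (- \<theta>) * k t) powr p / t) * indicator {0<..} t"
  have "(\<lambda>t. indicator {0<..} t *\<^sub>R k t) \<in> borel_measurable borel"
    using borel_measurable_mono_on_fnc[OF k(1)] by (subst (asm) borel_measurable_restrict_space_iff) auto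
  then have "(\<lambda>t. ennreal ((t powr (- \<theta>) * (indicator {0<..} t *\<^sub>R k t)) powr p / t) * indicator {0<..} t)
      \<in> borel_measurable borel"
    by measurable
  also have "(\<lambda>t. ennreal ((t powr (- \<theta>) * (indicator {0<..} t *\<^sub>R k t)) powr p / t) * indicator {0<..} t) = ?f"
    by (auto simp: indicator_def fun_eq_iff)
  finally have meas [measurable]: "?f \<in> borel_measurable borel" .
  have "ennreal ((c * s powr \<theta>) powr p) * weighted_integral \<theta> p k =
      ennreal ((c * s powr \<theta>) powr p) * (ennreal s * (\<integral>\<^sup>+ t. ?f (0 + s * t) \<partial>lborel))"
    unfolding weighted_integral_def using nn_integral_real_affine[OF meas, of s 0] s by simp
  also have "\<dots> = (\<integral>\<^sup>+ t. ennreal ((c * s powr \<theta>) powr p) * (ennreal s * ?f (0 + s * t)) \<partial>lborel)"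
  proof -
    have "(\<lambda>t. ?f (0 + s * t)) \<in> borel_measurable lborel" by measurable
    then show ?thesis by (simp add: nn_integral_cmult)
  qed
  also have "\<dots> = weighted_integral \<theta> p (\<lambda>t. c * k (s * t))"
    unfolding weighted_integral_def
  proof (rule nn_integral_cong)
    fix t :: real
    have "(c * s powr \<theta>) powr p * (s * (((s * t) powr (- \<theta>) * k (s * t)) powr p / (s * t))) =
        (t powr (- \<theta>) * (c * k (s * t))) powr p / t" if t: "0 < t"
    proof -
      have "(c * s powr \<theta>) powr p * ((s * t) powr (- \<theta>) * k (s * t)) powr p =
          (c * s powr \<theta> * ((s * t) powr (- \<theta>) * k (s * t))) powr p"
        by (rule powr_mult[symmetric])
      also have "c * s powr \<theta> * ((s * t) powr (- \<theta>) * k (s * t)) = t powr (- \<theta>) * (c * k (s * t))"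
        using s t by (simp add: powr_mult powr_minus)
      finally show ?thesis using s t by (simp add: field_simps)
    qed
    then show "ennreal ((c * s powr \<theta>) powr p) * (ennreal s * ?f (0 + s * t)) =
        ennreal ((t powr (- \<theta>) * (c * k (s * t))) powr p / t) * indicator {0<..} t"
      using s by (auto simp: indicator_def zero_less_mult_iff ennreal_mult'[symmetric])
  qed
  finally show ?thesis ..
qed

text \<open>Source of the interpolation exponents: for \<open>c = C0\<close> and
  \<open>s = C1 / C0\<close> the factor is
  \<open>C0 powr (1 - \<theta>) * C1 powr \<theta>\<close>.\<close>

lemma weighted_norm_dilate:
  assumes q: "1 \<le> q" and k: "mono_on {0<..} k" "\<And>t. 0 < t \<Longrightarrow> 0 \<le> k t"
    and c: "0 < c" and s: "0 < s" and C: "0 \<le> C" "weighted_norm \<theta> q k \<le> ennreal C"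
  shows "weighted_norm \<theta> q (\<lambda>t. c * k (s * t)) \<le> ennreal (c * s powr \<theta> * C)"
  using q
proof (cases rule: exponent_cases)
  case infinity
  have "t powr (- \<theta>) * (c * k (s * t)) \<le> c * s powr \<theta> * C" if t: "0 < t" for t
  proof -
    have "(s * t) powr (- \<theta>) * k (s * t) \<le> C"
      using C s t infinity by (simp add: weighted_norm_infinity_le_iff)
    then have "c * s powr \<theta> * ((s * t) powr (- \<theta>) * k (s * t)) \<le> c * s powr \<theta> * C"
      using c by (intro mult_left_mono) auto
    also have "c * s powr \<theta> * ((s * t) powr (- \<theta>) * k (s * t)) = t powr (- \<theta>) * (c * k (s * t))"
      using s t by (simp add: powr_mult powr_minus)
    finally show ?thesis .
  qed
  then show ?thesis using C(1) c infinity by (simp add: weighted_norm_infinity_le_iff)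
next
  case (finite p)
  have "weighted_integral \<theta> p (\<lambda>t. c * k (s * t)) = ennreal ((c * s powr \<theta>) powr p) * weighted_integral \<theta> p k"
    by (rule weighted_integral_dilate[OF k c s])
  also have "\<dots> \<le> ennreal ((c * s powr \<theta>) powr p) * ennreal (C powr p)"
    using C finite by (intro mult_left_mono) (auto simp: weighted_norm_le_iff)
  also have "\<dots> = ennreal ((c * s powr \<theta> * C) powr p)"
    using c C(1) by (simp add: ennreal_mult'[symmetric] powr_mult)
  finally show ?thesis using c C(1) finite by (simp add: weighted_norm_le_iff)
qed

text \<open>Up to a dilation and a factor, \<open>min 1 t\<close> dominates the K-functional of a
  point lying in both spaces. For finite exponent the integrand is
  \<open>t powr ((1 - \<theta>) * p - 1)\<close> near 0 and
  \<open>t powr (- \<theta> * p - 1)\<close> near infinity, both integrable as \<theta> lies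
  strictly between 0 and 1.\<close>

lemma weighted_norm_min_finite:
  assumes \<theta>: "0 < \<theta>" "\<theta> < 1" and q: "1 \<le> q"
  shows "\<exists>C\<ge>0. weighted_norm \<theta> q (\<lambda>t. min 1 t) \<le> ennreal C"
  using q
proof (cases rule: exponent_cases)
  case infinity
  have "t powr (- \<theta>) * min 1 t \<le> 1" if t: "0 < t" for t
  proof (cases "t \<le> 1")
    case True
    have "t powr (- \<theta>) * t = t powr (1 - \<theta>)" using t by (simp add: powr_diff powr_minus field_simps)
    also have "\<dots> \<le> 1" using t True \<theta> by (intro powr_le1) auto
    finally show ?thesis using True by (simp add: min_def)
  next
    case False
    then have "t powr (- \<theta>) \<le> t powr 0" using \<theta> by (intro powr_mono) auto
    then show ?thesis using False by (simp add: min_def)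
  qed
  then have "weighted_norm \<theta> q (\<lambda>t. min 1 t) \<le> ennreal 1"
    unfolding infinity by (subst weighted_norm_infinity_le_iff) auto
  then show ?thesis by (meson zero_le_one)
next
  case (finite p)
  define a where "a = (1 - \<theta>) * p - 1"
  define b where "b = - \<theta> * p - 1"
  have a: "- 1 < a" and b: "b < - 1" using \<theta> finite(2) by (auto simp: a_def b_def)
  have "weighted_integral \<theta> p (\<lambda>t. min 1 t) \<le>
      (\<integral>\<^sup>+ t. ennreal (t powr a) * indicator {0..1} t + ennreal (t powr b) * indicator {1..} t \<partial>lborel)"
    unfolding weighted_integral_def
  proof (rule nn_integral_mono)
    fix t :: real
    have "(t powr (- \<theta>) * min 1 t) powr p / t = t powr a" if "0 < t" "t \<le> 1"
    proof -
      have "t powr (- \<theta>) * min 1 t = t powr (1 - \<theta>)"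
        using that by (simp add: min_def powr_diff powr_minus field_simps)
      then have "(t powr (- \<theta>) * min 1 t) powr p = t powr ((1 - \<theta>) * p)" by (simp only: powr_powr)
      then show ?thesis using that by (simp add: a_def powr_diff)
    qed
    moreover have "(t powr (- \<theta>) * min 1 t) powr p / t = t powr b" if "1 < t"
      using that by (simp add: min_def powr_powr b_def powr_diff)
    ultimately show "ennreal ((t powr (- \<theta>) * min 1 t) powr p / t) * indicator {0<..} t \<le>
      ennreal (t powr a) * indicator {0..1} t + ennreal (t powr b) * indicator {1..} t"
      by (cases "t \<le> 1") (auto simp: indicator_def)
  qed
  also have "\<dots> = (\<integral>\<^sup>+ t. ennreal (t powr a) * indicator {0..1} t \<partial>lborel) +
      (\<integral>\<^sup>+ t. ennreal (t powr b) * indicator {1..} t \<partial>lborel)"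
    by (intro nn_integral_add) measurable
  also have "\<dots> = ennreal (1 powr (a + 1) / (a + 1)) + ennreal (- (1 powr (b + 1)) / (b + 1))"
    using nn_integral_has_integral_lebesgue'[OF _ has_integral_powr_from_0[OF a, of 1]]
      nn_integral_has_integral_lebesgue'[OF _ has_integral_powr_to_inf[OF b, of 1]] by simp
  also have "\<dots> < \<infinity>" by (simp flip: ennreal_plus)
  finally obtain r where r: "0 \<le> r" "weighted_integral \<theta> p (\<lambda>t. min 1 t) = ennreal r"
    by (cases "weighted_integral \<theta> p (\<lambda>t. min 1 t)") auto
  have "weighted_norm \<theta> q (\<lambda>t. min 1 t) \<le> ennreal (r powr (1 / p))"
    unfolding finite(1) using finite(2) r by (subst weighted_norm_le_iff) (auto simp: powr_powr)
  then show ?thesis by (meson powr_ge_zero)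
qed

text \<open>For finite exponent only the interval from 1 to 2 is used. There the weight and the
  density \<open>1 / t\<close> are both at least 1/2; the former costs a factor 2, the latter a
  factor \<open>2 powr (1 / p) \<le> 2\<close>, which makes 4. For the supremum norm
  \<open>t = 1\<close> suffices.\<close>

lemma weighted_norm_lower:
  assumes \<theta>: "0 < \<theta>" "\<theta> < 1" and q: "1 \<le> q" and c: "0 \<le> c" "\<And>t. 1 \<le> t \<Longrightarrow> c \<le> k t"
    and C: "0 \<le> C" "weighted_norm \<theta> q k \<le> ennreal C"
  shows "c \<le> 4 * C"
  using q
proof (cases rule: exponent_cases)
  case infinity
  have "\<forall>t>0. t powr (- \<theta>) * k t \<le> C"
    using C(2) unfolding infinity weighted_norm_infinity_le_iff[OF C(1)] .
  from this[rule_format, of 1] have "k 1 \<le> C" by simp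
  then show ?thesis using c(2)[of 1] C(1) by simp
next
  case (finite p)
  have "ennreal ((c / 2) powr p / 2) = (\<integral>\<^sup>+ t. ennreal ((c / 2) powr p / 2) * indicator {1..2::real} t \<partial>lborel)"
    by (simp add: nn_integral_cmult)
  also have "\<dots> \<le> weighted_integral \<theta> p k"
    unfolding weighted_integral_def
  proof (rule nn_integral_mono)
    fix t :: real
    have "(c / 2) powr p / 2 \<le> (t powr (- \<theta>) * k t) powr p / t" if t: "1 \<le> t" "t \<le> 2"
    proof -
      have "inverse t = t powr (- 1)" using t by (simp add: powr_minus)
      also have "\<dots> \<le> t powr (- \<theta>)" using t \<theta> by (intro powr_mono) auto
      finally have "inverse t \<le> t powr (- \<theta>)" .
      moreover have "1 / 2 \<le> inverse t" using t by (simp add: field_simps)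
      ultimately have "1 / 2 \<le> t powr (- \<theta>)" by linarith
      then have "1 / 2 * c \<le> t powr (- \<theta>) * k t" using c t by (intro mult_mono) auto
      then have "(c / 2) powr p \<le> (t powr (- \<theta>) * k t) powr p"
        using finite(2) c by (intro powr_mono2) auto
      then show ?thesis using t by (intro frac_le) auto
    qed
    then show "ennreal ((c / 2) powr p / 2) * indicator {1..2} t \<le>
      ennreal ((t powr (- \<theta>) * k t) powr p / t) * indicator {0<..} t"
      by (auto simp: indicator_def intro!: ennreal_leI)
  qed
  also have "\<dots> \<le> ennreal (C powr p)" using C finite by (simp add: weighted_norm_le_iff)
  finally have "(c / 2) powr p \<le> 2 powr 1 * C powr p" by simp
  also have "\<dots> \<le> 2 powr p * C powr p" using finite(2) by (intro mult_right_mono powr_mono) auto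
  also have "\<dots> = (2 * C) powr p" using C by (simp add: powr_mult)
  finally have "c / 2 \<le> 2 * C"
    using powr_less_mono2[of p "2 * C" "c / 2"] finite(2) C by force
  then show ?thesis by simp
qed

section \<open>The K-functional\<close>

locale seminormed_couple = A0: seminormed A0 + A1: seminormed A1
  for A0 A1 :: "('v::complex_tvs) nspace"
begin

lemma sum_pointsE:
  assumes "a \<in> points (sum_space A0 A1)"
  obtains a0 a1 where "a0 \<in> points A0" "a1 \<in> points A1" "a = a0 + a1"
  using assms by (auto simp: sum_space_def)

lemma sum_pointsI: "a0 \<in> points A0 \<Longrightarrow> a1 \<in> points A1 \<Longrightarrow> a0 + a1 \<in> points (sum_space A0 A1)"
  by (auto simp: sum_space_def)

lemma points0_le: "x \<in> points A0 \<Longrightarrow> x \<in> points (sum_space A0 A1)"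
  using sum_pointsI[OF _ A1.zero_mem] by fastforce

lemma points1_le: "x \<in> points A1 \<Longrightarrow> x \<in> points (sum_space A0 A1)"
  using sum_pointsI[OF A0.zero_mem] by fastforce

lemma nrm_sum_space: "nrm (sum_space A0 A1) a = K_functional A0 A1 1 a"
  by (simp add: sum_space_def K_functional_def)

lemma K_functional_le:
  assumes "0 \<le> t" "a0 \<in> points A0" "a1 \<in> points A1"
  shows "K_functional A0 A1 t (a0 + a1) \<le> nrm A0 a0 + t * nrm A1 a1"
  unfolding K_functional_def
proof (rule cInf_lower)
  show "bdd_below {nrm A0 x + t * nrm A1 y |x y. x \<in> points A0 \<and> y \<in> points A1 \<and> a0 + a1 = x + y}"
    using assms(1) A0.nrm_nonneg A1.nrm_nonneg by (intro bdd_belowI[where m = 0]) auto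
qed (use assms in blast)

lemma K_functional_geI:
  assumes "a \<in> points (sum_space A0 A1)"
    and "\<And>a0 a1. a0 \<in> points A0 \<Longrightarrow> a1 \<in> points A1 \<Longrightarrow> a = a0 + a1 \<Longrightarrow> c \<le> nrm A0 a0 + t * nrm A1 a1"
  shows "c \<le> K_functional A0 A1 t a"
  unfolding K_functional_def
  by (rule cInf_greatest) (use assms in \<open>auto simp: sum_space_def\<close>)

lemma K_functional_nonneg: "0 \<le> t \<Longrightarrow> a \<in> points (sum_space A0 A1) \<Longrightarrow> 0 \<le> K_functional A0 A1 t a"
  using A0.nrm_nonneg A1.nrm_nonneg by (intro K_functional_geI) auto

lemma K_functional_approx:
  assumes "a \<in> points (sum_space A0 A1)" "0 < e"
  obtains a0 a1 where "a0 \<in> points A0" "a1 \<in> points A1" "a = a0 + a1"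
    "nrm A0 a0 + t * nrm A1 a1 < K_functional A0 A1 t a + e"
proof -
  let ?S = "{nrm A0 a0 + t * nrm A1 a1 | a0 a1. a0 \<in> points A0 \<and> a1 \<in> points A1 \<and> a = a0 + a1}"
  have "?S \<noteq> {}" using assms(1) by (auto simp: sum_space_def)
  moreover have "Inf ?S < K_functional A0 A1 t a + e" using assms(2) by (simp add: K_functional_def)
  ultimately have "\<exists>x\<in>?S. x < K_functional A0 A1 t a + e" by (rule cInf_lessD)
  then show ?thesis using that by blast
qed

lemma K_functional_mono_on:
  assumes a: "a \<in> points (sum_space A0 A1)"
  shows "mono_on {0<..} (\<lambda>t. K_functional A0 A1 t a)"
proof (rule mono_onI)
  fix s t :: real assume st: "s \<in> {0<..}" "t \<in> {0<..}" "s \<le> t"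
  show "K_functional A0 A1 s a \<le> K_functional A0 A1 t a"
  proof (rule K_functional_geI[OF a])
    fix a0 a1 assume *: "a0 \<in> points A0" "a1 \<in> points A1" "a = a0 + a1"
    have "s * nrm A1 a1 \<le> t * nrm A1 a1" using st A1.nrm_nonneg[OF *(2)] by (intro mult_right_mono)
    then show "K_functional A0 A1 s a \<le> nrm A0 a0 + t * nrm A1 a1"
      using K_functional_le[OF _ *(1,2), of s] * st by simp
  qed
qed

lemma K_functional_add:
  assumes t: "0 \<le> t" and a: "a \<in> points (sum_space A0 A1)" and b: "b \<in> points (sum_space A0 A1)"
  shows "K_functional A0 A1 t (a + b) \<le> K_functional A0 A1 t a + K_functional A0 A1 t b"
proof (rule field_le_epsilon)
  fix e :: real assume "0 < e"
  then have e: "0 < e / 2" by simp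
  obtain a0 a1 where 1: "a0 \<in> points A0" "a1 \<in> points A1" "a = a0 + a1"
    "nrm A0 a0 + t * nrm A1 a1 < K_functional A0 A1 t a + e / 2" using K_functional_approx[OF a e] .
  obtain b0 b1 where 2: "b0 \<in> points A0" "b1 \<in> points A1" "b = b0 + b1"
    "nrm A0 b0 + t * nrm A1 b1 < K_functional A0 A1 t b + e / 2" using K_functional_approx[OF b e] .
  have "a + b = (a0 + b0) + (a1 + b1)" using 1 2 by (simp add: algebra_simps)
  then have "K_functional A0 A1 t (a + b) \<le> nrm A0 (a0 + b0) + t * nrm A1 (a1 + b1)"
    using K_functional_le[OF t A0.add_mem[OF 1(1) 2(1)] A1.add_mem[OF 1(2) 2(2)]] by simp
  also have "\<dots> \<le> (nrm A0 a0 + nrm A0 b0) + t * (nrm A1 a1 + nrm A1 b1)"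
    by (intro add_mono mult_left_mono A0.nrm_add A1.nrm_add 1 2 t)
  finally show "K_functional A0 A1 t (a + b) \<le> K_functional A0 A1 t a + K_functional A0 A1 t b + e"
    using 1(4) 2(4) by (simp add: algebra_simps)
qed

text \<open>\<open>T\<close> carries decompositions of \<open>a\<close> to decompositions of
  \<open>T a\<close>. Writing the second bound as \<open>c * s\<close> displays the effect as a
  dilation of \<open>t\<close> by \<open>s\<close>.\<close>

lemma K_functional_map:
  assumes B: "seminormed_couple B0 B1"
    and T: "\<And>x y. x \<in> points A0 \<Longrightarrow> y \<in> points A1 \<Longrightarrow> T (x + y) = T x + T y"
    and T0: "\<And>x. x \<in> points A0 \<Longrightarrow> T x \<in> points B0 \<and> nrm B0 (T x) \<le> c * nrm A0 x"
    and T1: "\<And>x. x \<in> points A1 \<Longrightarrow> T x \<in> points B1 \<and> nrm B1 (T x) \<le> c * s * nrm A1 x"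
    and c: "0 < c" and t: "0 \<le> t" and a: "a \<in> points (sum_space A0 A1)"
  shows "K_functional B0 B1 t (T a) \<le> c * K_functional A0 A1 (s * t) a"
proof -
  interpret B: seminormed_couple B0 B1 by (rule B)
  have "K_functional B0 B1 t (T a) / c \<le> K_functional A0 A1 (s * t) a"
  proof (rule K_functional_geI[OF a])
    fix a0 a1 assume *: "a0 \<in> points A0" "a1 \<in> points A1" "a = a0 + a1"
    have "K_functional B0 B1 t (T a) \<le> nrm B0 (T a0) + t * nrm B1 (T a1)"
      unfolding *(3) T[OF *(1,2)]
      by (intro B.K_functional_le t conjunct1[OF T0] conjunct1[OF T1] *)
    also have "\<dots> \<le> c * nrm A0 a0 + t * (c * s * nrm A1 a1)"
      by (intro add_mono mult_left_mono t conjunct2[OF T0] conjunct2[OF T1] *)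
    finally show "K_functional B0 B1 t (T a) / c \<le> nrm A0 a0 + s * t * nrm A1 a1"
      using c by (simp add: field_simps)
  qed
  then show ?thesis using c by (simp add: field_simps)
qed

lemma map_sum_points:
  assumes B: "seminormed_couple B0 B1"
    and T: "\<And>x y. x \<in> points A0 \<Longrightarrow> y \<in> points A1 \<Longrightarrow> T (x + y) = T x + T y"
    and T0: "\<And>x. x \<in> points A0 \<Longrightarrow> T x \<in> points B0"
    and T1: "\<And>x. x \<in> points A1 \<Longrightarrow> T x \<in> points B1"
    and a: "a \<in> points (sum_space A0 A1)"
  shows "T a \<in> points (sum_space B0 B1)"
proof -
  obtain a0 a1 where *: "a0 \<in> points A0" "a1 \<in> points A1" "a = a0 + a1" using a by (rule sum_pointsE)
  show ?thesis
    unfolding *(3) T[OF *(1,2)] by (intro seminormed_couple.sum_pointsI[OF B] T0 T1 *)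
qed

sublocale sum: seminormed "sum_space A0 A1"
proof
  show "0 \<in> points (sum_space A0 A1)" by (rule points0_le[OF A0.zero_mem])
  fix x c assume x: "x \<in> points (sum_space A0 A1)"
  show "c *\<^sub>C x \<in> points (sum_space A0 A1)"
  proof -
    obtain a0 a1 where *: "a0 \<in> points A0" "a1 \<in> points A1" "x = a0 + a1" using x by (rule sum_pointsE)
    show ?thesis
      unfolding *(3) scaleC_add_right by (intro sum_pointsI A0.scale_mem A1.scale_mem *)
  qed
  show "0 \<le> nrm (sum_space A0 A1) x" using x by (simp add: nrm_sum_space K_functional_nonneg)
  show "nrm (sum_space A0 A1) (c *\<^sub>C x) \<le> cmod c * nrm (sum_space A0 A1) x"
  proof (cases "c = 0")
    case True
    then show ?thesis
      using K_functional_le[OF _ A0.zero_mem A1.zero_mem, of 1] by (simp add: nrm_sum_space)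
  next
    case False
    have "seminormed_couple A0 A1" by unfold_locales
    from K_functional_map[OF this, of "\<lambda>x. c *\<^sub>C x" "cmod c" 1 1 x]
    show ?thesis using False x A0.scale_mem A1.scale_mem A0.nrm_scale A1.nrm_scale
      by (simp add: nrm_sum_space scaleC_add_right)
  qed
  fix y assume y: "y \<in> points (sum_space A0 A1)"
  show "x + y \<in> points (sum_space A0 A1)"
  proof -
    obtain a0 a1 where 1: "a0 \<in> points A0" "a1 \<in> points A1" "x = a0 + a1" using x by (rule sum_pointsE)
    obtain b0 b1 where 2: "b0 \<in> points A0" "b1 \<in> points A1" "y = b0 + b1" using y by (rule sum_pointsE)
    have "x + y = (a0 + b0) + (a1 + b1)" using 1 2 by (simp add: algebra_simps)
    then show ?thesis
      using sum_pointsI[OF A0.add_mem[OF 1(1) 2(1)] A1.add_mem[OF 1(2) 2(2)]] by simp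
  qed
  show "nrm (sum_space A0 A1) (x + y) \<le> nrm (sum_space A0 A1) x + nrm (sum_space A0 A1) y"
    using K_functional_add[OF _ x y, of 1] by (simp add: nrm_sum_space)
qed

text \<open>If \<open>A1\<close> lies in \<open>A0\<close>, both parts of a decomposition can be
  measured in \<open>A0\<close>, and a weight \<open>t \<ge> 1\<close> on the second part only
  increases the right-hand side. Both methods obtain their imbedding into \<open>A0\<close> from
  this.\<close>

lemma nrm0_le_sum:
  assumes C: "1 \<le> C" "\<And>x. x \<in> points A1 \<Longrightarrow> x \<in> points A0 \<and> nrm A0 x \<le> C * nrm A1 x"
    and a: "a \<in> points (sum_space A0 A1)" and t: "1 \<le> t"
  shows "a \<in> points A0" "nrm A0 a \<le> C * K_functional A0 A1 t a"
proof -
  show "a \<in> points A0"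
  proof -
    obtain a0 a1 where "a0 \<in> points A0" "a1 \<in> points A1" "a = a0 + a1" using a by (rule sum_pointsE)
    then show ?thesis using A0.add_mem[of a0 a1] C(2)[of a1] by simp
  qed
  have "nrm A0 a / C \<le> K_functional A0 A1 t a"
  proof (rule K_functional_geI[OF a])
    fix a0 a1 assume *: "a0 \<in> points A0" "a1 \<in> points A1" "a = a0 + a1"
    have "nrm A0 a \<le> nrm A0 a0 + C * nrm A1 a1" using A0.nrm_add[of a0 a1] * C(2)[OF *(2)] by simp
    also have "\<dots> \<le> C * nrm A0 a0 + C * (t * nrm A1 a1)"
      using C(1) t A0.nrm_nonneg[OF *(1)] A1.nrm_nonneg[OF *(2)]
      by (intro add_mono mult_left_mono) (auto simp: mult_le_cancel_right1)
    finally show "nrm A0 a / C \<le> nrm A0 a0 + t * nrm A1 a1" using C(1) by (simp add: field_simps)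
  qed
  then show "nrm A0 a \<le> C * K_functional A0 A1 t a" using C(1) by (simp add: field_simps)
qed

end

section \<open>Interpolation methods\<close>

text \<open>The properties of an interpolation method of exponent \<open>\<theta>\<close> on which the proof of cocompactness
  relies, common to the real and the complex method.\<close>

locale interpolation_method =
  fixes \<Phi> :: "('v::complex_tvs) nspace \<Rightarrow> 'v nspace \<Rightarrow> 'v nspace" and \<theta> :: real
  assumes exponent: "0 < \<theta>" "\<theta> < 1"
    and seminormed_interp: "seminormed_couple A0 A1 \<Longrightarrow> seminormed (\<Phi> A0 A1)"
    and imbedded_endpoint: "seminormed_couple A0 A1 \<Longrightarrow> continuously_imbedded A1 A0 \<Longrightarrow>
      continuously_imbedded (\<Phi> A0 A1) A0"
    and interpolate_operator: "seminormed_couple A0 A1 \<Longrightarrow> seminormed_couple B0 B1 \<Longrightarrow>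
      clinear_on (points (sum_space A0 A1)) T \<Longrightarrow> 0 < C0 \<Longrightarrow> 0 < C1 \<Longrightarrow>
      (\<And>x. x \<in> points A0 \<Longrightarrow> T x \<in> points B0 \<and> nrm B0 (T x) \<le> C0 * nrm A0 x) \<Longrightarrow>
      (\<And>x. x \<in> points A1 \<Longrightarrow> T x \<in> points B1 \<and> nrm B1 (T x) \<le> C1 * nrm A1 x) \<Longrightarrow>
      a \<in> points (\<Phi> A0 A1) \<Longrightarrow>
      T a \<in> points (\<Phi> B0 B1) \<and> nrm (\<Phi> B0 B1) (T a) \<le> C0 powr (1 - \<theta>) * C1 powr \<theta> * nrm (\<Phi> A0 A1) a"
    and interpolate_point: "seminormed_couple A0 A1 \<Longrightarrow> \<exists>G\<ge>0. \<forall>x m0 m1.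
      x \<in> points A0 \<longrightarrow> x \<in> points A1 \<longrightarrow> 0 < m0 \<longrightarrow> 0 < m1 \<longrightarrow> nrm A0 x \<le> m0 \<longrightarrow> nrm A1 x \<le> m1 \<longrightarrow>
      x \<in> points (\<Phi> A0 A1) \<and> nrm (\<Phi> A0 A1) x \<le> G * m0 powr (1 - \<theta>) * m1 powr \<theta>"

text \<open>Enlarging the constant to at least 1 makes it a positive operator bound, which can also
  be divided by.\<close>

lemma continuously_imbeddedE:
  assumes "seminormed X" "continuously_imbedded X Y"
  obtains C where "1 \<le> C" "\<And>x. x \<in> points X \<Longrightarrow> x \<in> points Y \<and> nrm Y x \<le> C * nrm X x"
proof -
  obtain C where C: "points X \<subseteq> points Y" "\<And>x. x \<in> points X \<Longrightarrow> nrm Y x \<le> C * nrm X x"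
    using assms(2) unfolding continuously_imbedded_def by blast
  have "C * nrm X x \<le> max 1 C * nrm X x" if "x \<in> points X" for x
    using seminormed.nrm_nonneg[OF assms(1) that] by (intro mult_right_mono) auto
  with C have "x \<in> points Y \<and> nrm Y x \<le> max 1 C * nrm X x" if "x \<in> points X" for x
    using that by (blast intro: order_trans)
  then show ?thesis using that[of "max 1 C"] by simp
qed

section \<open>The real method\<close>

lemma real_interp_norm_eq:
  "real_interp_norm A0 A1 \<theta> q a = weighted_norm \<theta> q (\<lambda>t. K_functional A0 A1 t a)"
  by (simp add: real_interp_norm_def weighted_norm_def weighted_integral_def)

lemma real_interp_pointsI:
  assumes "a \<in> points (sum_space A0 A1)" "0 \<le> C"
    "weighted_norm \<theta> q (\<lambda>t. K_functional A0 A1 t a) \<le> ennreal C"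
  shows "a \<in> points (real_interp A0 A1 \<theta> q) \<and> nrm (real_interp A0 A1 \<theta> q) a \<le> C"
proof -
  have "weighted_norm \<theta> q (\<lambda>t. K_functional A0 A1 t a) < \<infinity>"
    using le_less_trans[OF assms(3) ennreal_less_top] by simp
  then show ?thesis
    using assms by (simp add: real_interp_def real_interp_norm_eq enn2real_leI)
qed

lemma real_interp_pointsD:
  assumes "a \<in> points (real_interp A0 A1 \<theta> q)"
  shows "a \<in> points (sum_space A0 A1)" "0 \<le> nrm (real_interp A0 A1 \<theta> q) a"
    "weighted_norm \<theta> q (\<lambda>t. K_functional A0 A1 t a) \<le> ennreal (nrm (real_interp A0 A1 \<theta> q) a)"
  using assms by (auto simp: real_interp_def real_interp_norm_eq)

text \<open>The K-functional of \<open>T a\<close> at \<open>t\<close> is at most \<open>C0\<close>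
  times that of \<open>a\<close> at \<open>C1 / C0 * t\<close>, and the norm of this dilate has the
  required exponents.\<close>

lemma real_interp_operator:
  assumes A: "seminormed_couple A0 A1" and B: "seminormed_couple B0 B1" and q: "1 \<le> q"
    and T: "\<And>x y. x \<in> points A0 \<Longrightarrow> y \<in> points A1 \<Longrightarrow> T (x + y) = T x + T y"
    and C: "0 < C0" "0 < C1"
    and T0: "\<And>x. x \<in> points A0 \<Longrightarrow> T x \<in> points B0 \<and> nrm B0 (T x) \<le> C0 * nrm A0 x"
    and T1: "\<And>x. x \<in> points A1 \<Longrightarrow> T x \<in> points B1 \<and> nrm B1 (T x) \<le> C1 * nrm A1 x"
    and a: "a \<in> points (real_interp A0 A1 \<theta> q)"
  shows "T a \<in> points (real_interp B0 B1 \<theta> q) \<and>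
    nrm (real_interp B0 B1 \<theta> q) (T a) \<le> C0 powr (1 - \<theta>) * C1 powr \<theta> * nrm (real_interp A0 A1 \<theta> q) a"
proof -
  interpret A: seminormed_couple A0 A1 by (rule A)
  interpret B: seminormed_couple B0 B1 by (rule B)
  let ?n = "nrm (real_interp A0 A1 \<theta> q) a"
  note a' = real_interp_pointsD[OF a]
  define s where "s = C1 / C0"
  have s: "0 < s" using C by (simp add: s_def)
  have Ta: "T a \<in> points (sum_space B0 B1)"
    by (rule A.map_sum_points[OF B T conjunct1[OF T0] conjunct1[OF T1] a'(1)])
  have dilate: "weighted_norm \<theta> q (\<lambda>t. C0 * K_functional A0 A1 (s * t) a) \<le> ennreal (C0 * s powr \<theta> * ?n)"
    using A.K_functional_nonneg[OF _ a'(1)]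
    by (intro weighted_norm_dilate[OF q A.K_functional_mono_on[OF a'(1)] _ C(1) s a'(2,3)]) auto
  have K: "K_functional B0 B1 t (T a) \<le> C0 * K_functional A0 A1 (s * t) a" if "0 < t" for t
  proof (rule A.K_functional_map[OF B T T0 _ C(1) _ a'(1)])
    show "T x \<in> points B1 \<and> nrm B1 (T x) \<le> C0 * s * nrm A1 x" if "x \<in> points A1" for x
      using T1[OF that] C(1) by (simp add: s_def)
  qed (use that in auto)
  have "weighted_norm \<theta> q (\<lambda>t. K_functional B0 B1 t (T a)) \<le> ennreal (C0 * s powr \<theta> * ?n)"
    by (rule weighted_norm_mono[OF q _ K _ dilate]) (use B.K_functional_nonneg[OF _ Ta] C a'(2) in auto)
  then have "T a \<in> points (real_interp B0 B1 \<theta> q) \<and> nrm (real_interp B0 B1 \<theta> q) (T a) \<le> C0 * s powr \<theta> * ?n"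
    using C a'(2) by (intro real_interp_pointsI[OF Ta]) auto
  moreover have "C0 * s powr \<theta> = C0 powr (1 - \<theta>) * C1 powr \<theta>"
    using C by (simp add: s_def powr_divide powr_diff)
  ultimately show ?thesis by simp
qed

lemma seminormed_real_interp:
  assumes A: "seminormed_couple A0 A1" and q: "1 \<le> q"
  shows "seminormed (real_interp A0 A1 \<theta> q)"
proof -
  interpret A: seminormed_couple A0 A1 by (rule A)
  let ?X = "real_interp A0 A1 \<theta> q"
  have zero: "0 \<in> points ?X \<and> nrm ?X 0 \<le> 0"
  proof (rule real_interp_pointsI[OF A.sum.zero_mem order_refl])
    have K0: "K_functional A0 A1 t 0 = 0" if "0 \<le> t" for t
      using A.K_functional_le[OF that A.A0.zero_mem A.A1.zero_mem]
        A.K_functional_nonneg[OF that A.sum.zero_mem] by simp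
    show "weighted_norm \<theta> q (\<lambda>t. K_functional A0 A1 t 0) \<le> ennreal 0"
      using q
    proof (cases rule: exponent_cases)
      case infinity
      then show ?thesis using K0 by (simp only: weighted_norm_infinity_le_iff order_refl) simp
    next
      case (finite p)
      have "weighted_integral \<theta> p (\<lambda>t. K_functional A0 A1 t 0) = (\<integral>\<^sup>+ (t::real). 0 \<partial>lborel)"
        unfolding weighted_integral_def
        by (intro nn_integral_cong) (use finite(2) K0 in \<open>auto simp: indicator_def\<close>)
      then show ?thesis using finite by (subst finite(1), subst weighted_norm_le_iff) auto
    qed
  qed
  have add: "x + y \<in> points ?X \<and> nrm ?X (x + y) \<le> nrm ?X x + nrm ?X y"
    if x: "x \<in> points ?X" and y: "y \<in> points ?X" for x y
  proof -
    note x' = real_interp_pointsD[OF x] and y' = real_interp_pointsD[OF y]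
    have sum: "x + y \<in> points (sum_space A0 A1)" by (rule A.sum.add_mem[OF x'(1) y'(1)])
    \<comment> \<open>The slack \<open>e\<close> keeps both bounds strictly positive, as
      \<open>weighted_norm_add\<close> demands, even where a norm vanishes; it is removed
      afterwards.\<close>
    have *: "x + y \<in> points ?X \<and> nrm ?X (x + y) \<le> (nrm ?X x + e) + (nrm ?X y + e)" if e: "0 < e" for e
    proof (rule real_interp_pointsI[OF sum])
      show "0 \<le> (nrm ?X x + e) + (nrm ?X y + e)" using x'(2) y'(2) e by simp
      have sum_bound: "weighted_norm \<theta> q (\<lambda>t. K_functional A0 A1 t x + K_functional A0 A1 t y)
          \<le> ennreal ((nrm ?X x + e) + (nrm ?X y + e))"
      proof (rule weighted_norm_add[OF q])
        show "weighted_norm \<theta> q (\<lambda>t. K_functional A0 A1 t x) \<le> ennreal (nrm ?X x + e)"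
          by (rule order_trans[OF x'(3)]) (use e in \<open>auto intro!: ennreal_leI\<close>)
        show "weighted_norm \<theta> q (\<lambda>t. K_functional A0 A1 t y) \<le> ennreal (nrm ?X y + e)"
          by (rule order_trans[OF y'(3)]) (use e in \<open>auto intro!: ennreal_leI\<close>)
      qed (use x'(1,2) y'(1,2) e in \<open>auto intro: A.K_functional_mono_on A.K_functional_nonneg\<close>)
      show "weighted_norm \<theta> q (\<lambda>t. K_functional A0 A1 t (x + y))
          \<le> ennreal ((nrm ?X x + e) + (nrm ?X y + e))"
        by (rule weighted_norm_mono[OF q _ _ _ sum_bound])
           (use x'(2) y'(2) e in \<open>auto intro!: A.K_functional_nonneg sum A.K_functional_add x'(1) y'(1)\<close>)
    qed
    have "nrm ?X (x + y) \<le> nrm ?X x + nrm ?X y"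
    proof (rule field_le_epsilon)
      fix e :: real assume "0 < e"
      then show "nrm ?X (x + y) \<le> nrm ?X x + nrm ?X y + e" using *[of "e / 2"] by simp
    qed
    then show ?thesis using *[of 1] by simp
  qed
  have scale: "c *\<^sub>C x \<in> points ?X \<and> nrm ?X (c *\<^sub>C x) \<le> cmod c * nrm ?X x"
    if x: "x \<in> points ?X" for c x
  proof (cases "c = 0")
    case True
    then show ?thesis using zero by simp
  next
    case False
    \<comment> \<open>Multiplication by \<open>c\<close> is an operator with the bound
      \<open>cmod c\<close> on both spaces, and the two exponents add up to 1.\<close>
    then have "cmod c powr (1 - \<theta>) * cmod c powr \<theta> = cmod c" by (simp flip: powr_add)
    then show ?thesis
      using real_interp_operator[OF A A q, of "\<lambda>x. c *\<^sub>C x" "cmod c" "cmod c" x \<theta>] False x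
        A.A0.scale_mem A.A1.scale_mem A.A0.nrm_scale A.A1.nrm_scale by (simp add: scaleC_add_right)
  qed
  show ?thesis
    using zero add scale real_interp_pointsD(2) by unfold_locales blast+
qed

lemma real_interp_imbedded_endpoint:
  assumes A: "seminormed_couple A0 A1" and im: "continuously_imbedded A1 A0"
    and \<theta>: "0 < \<theta>" "\<theta> < 1" and q: "1 \<le> q"
  shows "continuously_imbedded (real_interp A0 A1 \<theta> q) A0"
proof -
  interpret A: seminormed_couple A0 A1 by (rule A)
  obtain C where C: "1 \<le> C" "\<And>x. x \<in> points A1 \<Longrightarrow> x \<in> points A0 \<and> nrm A0 x \<le> C * nrm A1 x"
    using continuously_imbeddedE[OF A.A1.seminormed_axioms im] by blast
  have "a \<in> points A0 \<and> nrm A0 a \<le> 4 * C * nrm (real_interp A0 A1 \<theta> q) a"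
    if a: "a \<in> points (real_interp A0 A1 \<theta> q)" for a
  proof -
    note a' = real_interp_pointsD[OF a]
    have a0: "a \<in> points A0" using A.nrm0_le_sum(1)[OF C a'(1) order_refl] .
    have "nrm A0 a / C \<le> 4 * nrm (real_interp A0 A1 \<theta> q) a"
    proof (rule weighted_norm_lower[OF \<theta> q _ _ a'(2,3)])
      show "0 \<le> nrm A0 a / C" using C(1) A.A0.nrm_nonneg[OF a0] by simp
      show "nrm A0 a / C \<le> K_functional A0 A1 t a" if "1 \<le> t" for t
        using A.nrm0_le_sum(2)[OF C a'(1) that] C(1) by (simp add: field_simps)
    qed
    then show ?thesis using a0 C(1) by (simp add: field_simps)
  qed
  then show ?thesis unfolding continuously_imbedded_def by blast
qed

text \<open>The trivial decompositions \<open>x + 0\<close> and \<open>0 + x\<close> bound the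
  K-functional by \<open>m0\<close> and by \<open>t * m1\<close>, hence by a dilate of
  \<open>min 1 t\<close>; \<open>G\<close> bounds the norm of that profile. Positive bounds
  \<open>m0\<close> and \<open>m1\<close> replace the norms because the dilation is by their
  quotient.\<close>

lemma real_interp_point:
  assumes A: "seminormed_couple A0 A1" and \<theta>: "0 < \<theta>" "\<theta> < 1" and q: "1 \<le> q"
  shows "\<exists>G\<ge>0. \<forall>x m0 m1.
      x \<in> points A0 \<longrightarrow> x \<in> points A1 \<longrightarrow> 0 < m0 \<longrightarrow> 0 < m1 \<longrightarrow> nrm A0 x \<le> m0 \<longrightarrow> nrm A1 x \<le> m1 \<longrightarrow>
      x \<in> points (real_interp A0 A1 \<theta> q) \<and>
      nrm (real_interp A0 A1 \<theta> q) x \<le> G * m0 powr (1 - \<theta>) * m1 powr \<theta>"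
proof -
  interpret A: seminormed_couple A0 A1 by (rule A)
  obtain G where G: "0 \<le> G" "weighted_norm \<theta> q (\<lambda>t. min 1 t) \<le> ennreal G"
    using weighted_norm_min_finite[OF \<theta> q] by blast
  have "x \<in> points (real_interp A0 A1 \<theta> q) \<and>
      nrm (real_interp A0 A1 \<theta> q) x \<le> G * m0 powr (1 - \<theta>) * m1 powr \<theta>"
    if x: "x \<in> points A0" "x \<in> points A1" and m: "0 < m0" "0 < m1" "nrm A0 x \<le> m0" "nrm A1 x \<le> m1"
    for x m0 m1
  proof -
    have "weighted_norm \<theta> q (\<lambda>t. m0 * min 1 (m1 / m0 * t)) \<le> ennreal (m0 * (m1 / m0) powr \<theta> * G)"
      using m G by (intro weighted_norm_dilate[OF q]) (auto intro: mono_onI)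
    also have "m0 * (m1 / m0) powr \<theta> * G = G * m0 powr (1 - \<theta>) * m1 powr \<theta>"
      using m by (simp add: powr_divide powr_diff)
    finally have *: "weighted_norm \<theta> q (\<lambda>t. m0 * min 1 (m1 / m0 * t)) \<le>
        ennreal (G * m0 powr (1 - \<theta>) * m1 powr \<theta>)" .
    have K: "K_functional A0 A1 t x \<le> m0 * min 1 (m1 / m0 * t)" if t: "0 < t" for t
    proof -
      have "K_functional A0 A1 t x \<le> m0"
        using A.K_functional_le[OF _ x(1) A.A1.zero_mem, of t] t m by simp
      moreover have "K_functional A0 A1 t x \<le> t * m1"
        using A.K_functional_le[OF _ A.A0.zero_mem x(2), of t] t m
        by (smt (verit) A.A0.nrm_zero add_0 mult_left_mono)
      ultimately show ?thesis using m by (simp add: min_def mult.commute)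
    qed
    have "weighted_norm \<theta> q (\<lambda>t. K_functional A0 A1 t x) \<le> ennreal (G * m0 powr (1 - \<theta>) * m1 powr \<theta>)"
      by (rule weighted_norm_mono[OF q _ K _ *])
         (use A.K_functional_nonneg[OF _ A.points0_le[OF x(1)]] G m in auto)
    then show ?thesis using G m by (intro real_interp_pointsI A.points0_le x) auto
  qed
  then show ?thesis using G(1) by blast
qed

lemma interpolation_method_real:
  assumes "0 < \<theta>" "\<theta> < 1" "1 \<le> q"
  shows "interpolation_method (\<lambda>A0 A1. real_interp (A0 :: ('v::complex_tvs) nspace) A1 \<theta> q) \<theta>"
proof (rule interpolation_method.intro, goal_cases)
  case (5 A0 A1 B0 B1 T C0 C1 a)
  interpret A: seminormed_couple A0 A1 by (rule 5)
  have "T (x + y) = T x + T y" if "x \<in> points A0" "y \<in> points A1" for x y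
    using 5(3) A.points0_le[OF that(1)] A.points1_le[OF that(2)] by (simp add: clinear_on_def)
  then show ?case using 5 assms by (intro real_interp_operator) auto
next
  case (6 A0 A1)
  then show ?case using assms by (rule real_interp_point)
qed (use assms in \<open>auto intro: seminormed_real_interp real_interp_imbedded_endpoint\<close>)

section \<open>Continuous and analytic functions with values in a seminormed space\<close>

text \<open>The absolute value is there because \<open>Y\<close> is an arbitrary record, whose
  \<open>nrm\<close> may be negative.\<close>

lemma tends_to_in_mono:
  assumes "tends_to_in X f l F" "\<forall>\<^sub>F x in F. \<bar>nrm Y (g x - m)\<bar> \<le> C * nrm X (f x - l)"
  shows "tends_to_in Y g m F"
  unfolding tends_to_in_def
proof (rule Lim_null_comparison)
  show "\<forall>\<^sub>F x in F. norm (nrm Y (g x - m)) \<le> C * nrm X (f x - l)" using assms(2) by simp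
  show "((\<lambda>x. C * nrm X (f x - l)) \<longlongrightarrow> 0) F"
    using tendsto_mult_right_zero[OF assms(1)[unfolded tends_to_in_def]] .
qed

lemma (in seminormed) tends_to_in_add:
  assumes f: "tends_to_in X f l F" and g: "tends_to_in X g m F"
    and mem: "\<forall>\<^sub>F x in F. f x \<in> points X" "\<forall>\<^sub>F x in F. g x \<in> points X" "l \<in> points X" "m \<in> points X"
  shows "tends_to_in X (\<lambda>x. f x + g x) (l + m) F"
  unfolding tends_to_in_def
proof (rule Lim_null_comparison)
  show "\<forall>\<^sub>F x in F. norm (nrm X (f x + g x - (l + m))) \<le> nrm X (f x - l) + nrm X (g x - m)"
    using mem(1,2)
  proof eventually_elim
    case (elim x)
    have *: "f x - l \<in> points X" "g x - m \<in> points X" using elim mem(3,4) by (auto intro: diff_mem)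
    then have "0 \<le> nrm X ((f x - l) + (g x - m))" by (intro nrm_nonneg add_mem)
    with nrm_add[OF *] show ?case by (simp add: algebra_simps)
  qed
  show "((\<lambda>x. nrm X (f x - l) + nrm X (g x - m)) \<longlongrightarrow> 0) F"
    using tendsto_add[OF f[unfolded tends_to_in_def] g[unfolded tends_to_in_def]] by simp
qed

lemma (in seminormed) tends_to_in_const: "l \<in> points X \<Longrightarrow> tends_to_in X (\<lambda>x. l) l F"
  by (simp add: tends_to_in_def)

lemma (in seminormed) tends_to_in_nrm:
  assumes f: "tends_to_in X f l F" and mem: "\<forall>\<^sub>F x in F. f x \<in> points X" "l \<in> points X"
  shows "((\<lambda>x. nrm X (f x)) \<longlongrightarrow> nrm X l) F"
proof -
  have "((\<lambda>x. nrm X (f x) - nrm X l) \<longlongrightarrow> 0) F"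
  proof (rule Lim_null_comparison)
    show "\<forall>\<^sub>F x in F. norm (nrm X (f x) - nrm X l) \<le> nrm X (f x - l)"
      using mem(1) by eventually_elim (use abs_nrm_diff_le mem(2) in auto)
  qed (use f in \<open>simp add: tends_to_in_def\<close>)
  then show ?thesis by (simp add: LIM_zero_iff)
qed

lemma (in seminormed) tends_to_in_scale:
  assumes f: "tends_to_in X f l F" and \<phi>: "(\<phi> \<longlongrightarrow> c) F"
    and mem: "\<forall>\<^sub>F x in F. f x \<in> points X" "l \<in> points X"
  shows "tends_to_in X (\<lambda>x. \<phi> x *\<^sub>C f x) (c *\<^sub>C l) F"
  unfolding tends_to_in_def
proof (rule Lim_null_comparison)
  show "\<forall>\<^sub>F x in F. norm (nrm X (\<phi> x *\<^sub>C f x - c *\<^sub>C l))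
      \<le> cmod (\<phi> x) * nrm X (f x - l) + cmod (\<phi> x - c) * nrm X l"
    using mem(1)
  proof eventually_elim
    case (elim x)
    have eq: "\<phi> x *\<^sub>C f x - c *\<^sub>C l = \<phi> x *\<^sub>C (f x - l) + (\<phi> x - c) *\<^sub>C l"
      by (simp add: scaleC_diff_right scaleC_diff_left)
    have *: "\<phi> x *\<^sub>C (f x - l) \<in> points X" "(\<phi> x - c) *\<^sub>C l \<in> points X"
      using elim mem(2) by (auto intro: diff_mem scale_mem)
    show ?case
      unfolding eq using nrm_add[OF *] nrm_nonneg[OF add_mem[OF *]]
        nrm_scale[OF diff_mem[OF elim mem(2)], of "\<phi> x"] nrm_scale[OF mem(2), of "\<phi> x - c"] by simp
  qed
  have "((\<lambda>x. cmod (\<phi> x) * nrm X (f x - l) + cmod (\<phi> x - c) * nrm X l) \<longlongrightarrow>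
      cmod c * 0 + cmod (c - c) * nrm X l) F"
    using f unfolding tends_to_in_def by (intro tendsto_intros \<phi>)
  then show "((\<lambda>x. cmod (\<phi> x) * nrm X (f x - l) + cmod (\<phi> x - c) * nrm X l) \<longlongrightarrow> 0) F" by simp
qed

lemma eventually_within_mem: "\<forall>\<^sub>F w in at z within S. w \<in> S"
  by (simp add: eventually_at_filter)

lemma continuous_on_intoD:
  assumes "continuous_on_into X S f" "z \<in> S"
  shows "f z \<in> points X" "tends_to_in X f (f z) (at z within S)" "\<forall>\<^sub>F w in at z within S. f w \<in> points X"
  using assms eventually_within_mem[of S z] by (auto simp: continuous_on_into_def elim!: eventually_mono)

lemma (in seminormed) continuous_on_into_add:
  assumes "continuous_on_into X S f" "continuous_on_into X S g"
  shows "continuous_on_into X S (\<lambda>z. f z + g z)"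
  unfolding continuous_on_into_def
proof (intro ballI conjI)
  fix z assume "z \<in> S"
  note f = continuous_on_intoD[OF assms(1) this] and g = continuous_on_intoD[OF assms(2) this]
  show "f z + g z \<in> points X" by (rule add_mem[OF f(1) g(1)])
  show "tends_to_in X (\<lambda>z. f z + g z) (f z + g z) (at z within S)"
    by (rule tends_to_in_add[OF f(2) g(2) f(3) g(3) f(1) g(1)])
qed

lemma (in seminormed) continuous_on_into_scale:
  assumes "continuous_on_into X S f" "continuous_on S \<phi>"
  shows "continuous_on_into X S (\<lambda>z. \<phi> z *\<^sub>C f z)"
  unfolding continuous_on_into_def
proof (intro ballI conjI)
  fix z assume z: "z \<in> S"
  note f = continuous_on_intoD[OF assms(1) z]
  show "\<phi> z *\<^sub>C f z \<in> points X" by (rule scale_mem[OF f(1)])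
  show "tends_to_in X (\<lambda>z. \<phi> z *\<^sub>C f z) (\<phi> z *\<^sub>C f z) (at z within S)"
    using assms(2) z by (intro tends_to_in_scale f) (auto simp: continuous_on_def)
qed

lemma (in seminormed) continuous_on_into_const: "x \<in> points X \<Longrightarrow> continuous_on_into X S (\<lambda>z. x)"
  by (simp add: continuous_on_into_def tends_to_in_const)

lemma clinear_on_diff:
  assumes T: "clinear_on (points X) T" and X: "seminormed X" and xy: "x \<in> points X" "y \<in> points X"
  shows "T (x - y) = T x - T y"
proof -
  have "T (x + (-1) *\<^sub>C y) = T x + (-1) *\<^sub>C T y"
    using T xy seminormed.scale_mem[OF X xy(2)] unfolding clinear_on_def by simp
  then show ?thesis by (simp add: scaleC_minus_one)
qed

lemma tends_to_in_map:
  assumes X: "seminormed X" and Y: "seminormed Y" and T: "clinear_on (points X) T"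
    and C: "\<And>x. x \<in> points X \<Longrightarrow> T x \<in> points Y \<and> nrm Y (T x) \<le> C * nrm X x"
    and f: "tends_to_in X f l F" "\<forall>\<^sub>F x in F. f x \<in> points X" "l \<in> points X"
  shows "tends_to_in Y (\<lambda>x. T (f x)) (T l) F"
proof (rule tends_to_in_mono[OF f(1)])
  show "\<forall>\<^sub>F x in F. \<bar>nrm Y (T (f x) - T l)\<bar> \<le> C * nrm X (f x - l)"
    using f(2)
  proof eventually_elim
    case (elim x)
    then have "f x - l \<in> points X" using X f(3) by (simp add: seminormed.diff_mem)
    from C[OF this] seminormed.nrm_nonneg[OF Y] show ?case
      using clinear_on_diff[OF T X elim f(3)] by fastforce
  qed
qed

lemma continuous_on_into_map:
  assumes X: "seminormed X" and Y: "seminormed Y" and T: "clinear_on (points X) T"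
    and C: "\<And>x. x \<in> points X \<Longrightarrow> T x \<in> points Y \<and> nrm Y (T x) \<le> C * nrm X x"
    and f: "continuous_on_into X S f"
  shows "continuous_on_into Y S (\<lambda>z. T (f z))"
  unfolding continuous_on_into_def
  using C continuous_on_intoD[OF f] by (blast intro: tends_to_in_map[OF X Y T C])

lemma analytic_intoE:
  assumes "analytic_into X S f" "z \<in> S" "open S"
  obtains d where "f z \<in> points X" "d \<in> points X"
    "tends_to_in X (\<lambda>w. inverse (w - z) *\<^sub>C (f w - f z)) d (at z)" "\<forall>\<^sub>F w in at z. f w \<in> points X"
proof -
  have "\<forall>\<^sub>F w in at z. w \<in> S" using assms(2,3) eventually_at_topological by blast
  then have "\<forall>\<^sub>F w in at z. f w \<in> points X"
    by eventually_elim (use assms(1) in \<open>auto simp: analytic_into_def\<close>)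
  with assms that show ?thesis unfolding analytic_into_def by blast
qed

lemma (in seminormed) analytic_into_add:
  assumes "analytic_into X S f" "analytic_into X S g" "open S"
  shows "analytic_into X S (\<lambda>z. f z + g z)"
  unfolding analytic_into_def
proof (intro ballI conjI)
  fix z assume z: "z \<in> S"
  obtain d where f: "f z \<in> points X" "d \<in> points X"
    "tends_to_in X (\<lambda>w. inverse (w - z) *\<^sub>C (f w - f z)) d (at z)" "\<forall>\<^sub>F w in at z. f w \<in> points X"
    using analytic_intoE[OF assms(1) z assms(3)] .
  obtain e where g: "g z \<in> points X" "e \<in> points X"
    "tends_to_in X (\<lambda>w. inverse (w - z) *\<^sub>C (g w - g z)) e (at z)" "\<forall>\<^sub>F w in at z. g w \<in> points X"
    using analytic_intoE[OF assms(2) z assms(3)] .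
  show "f z + g z \<in> points X" by (rule add_mem[OF f(1) g(1)])
  have "\<forall>\<^sub>F w in at z. inverse (w - z) *\<^sub>C (f w - f z) \<in> points X"
    using f(4) by eventually_elim (intro scale_mem diff_mem f(1))
  moreover have "\<forall>\<^sub>F w in at z. inverse (w - z) *\<^sub>C (g w - g z) \<in> points X"
    using g(4) by eventually_elim (intro scale_mem diff_mem g(1))
  ultimately have "tends_to_in X (\<lambda>w. inverse (w - z) *\<^sub>C (f w - f z) + inverse (w - z) *\<^sub>C (g w - g z)) (d + e) (at z)"
    by (rule tends_to_in_add[OF f(3) g(3) _ _ f(2) g(2)])
  also have "(\<lambda>w. inverse (w - z) *\<^sub>C (f w - f z) + inverse (w - z) *\<^sub>C (g w - g z)) =
      (\<lambda>w. inverse (w - z) *\<^sub>C (f w + g w - (f z + g z)))"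
    by (simp only: scaleC_add_right[symmetric]) (simp add: algebra_simps)
  finally show "\<exists>d\<in>points X. tends_to_in X (\<lambda>w. inverse (w - z) *\<^sub>C (f w + g w - (f z + g z))) d (at z)"
    using add_mem[OF f(2) g(2)] by blast
qed

lemma (in seminormed) analytic_into_scale:
  assumes f: "analytic_into X S f" and \<phi>: "\<phi> holomorphic_on S" and S: "open S"
  shows "analytic_into X S (\<lambda>z. \<phi> z *\<^sub>C f z)"
  unfolding analytic_into_def
proof (intro ballI conjI)
  fix z assume z: "z \<in> S"
  obtain d where f: "f z \<in> points X" "d \<in> points X"
    "tends_to_in X (\<lambda>w. inverse (w - z) *\<^sub>C (f w - f z)) d (at z)" "\<forall>\<^sub>F w in at z. f w \<in> points X"
    using analytic_intoE[OF f z S] .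
  show "\<phi> z *\<^sub>C f z \<in> points X" by (rule scale_mem[OF f(1)])
  have der: "(\<phi> has_field_derivative deriv \<phi> z) (at z)"
    using \<phi> S z by (rule holomorphic_derivI)
  then have cont: "(\<phi> \<longlongrightarrow> \<phi> z) (at z)" using DERIV_isCont isCont_def by blast
  have quot: "((\<lambda>w. inverse (w - z) * (\<phi> w - \<phi> z)) \<longlongrightarrow> deriv \<phi> z) (at z)"
    using der by (simp add: has_field_derivative_iff divide_inverse mult.commute)
  have mem: "\<forall>\<^sub>F w in at z. inverse (w - z) *\<^sub>C (f w - f z) \<in> points X"
    using f(4) by eventually_elim (intro scale_mem diff_mem f(1))
  \<comment> \<open>The product rule: the difference quotient of the product splits into
    \<open>\<phi> w\<close> times that of \<open>f\<close> and that of \<open>\<phi>\<close> times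
    the fixed vector \<open>f z\<close>.\<close>
  have "tends_to_in X (\<lambda>w. \<phi> w *\<^sub>C (inverse (w - z) *\<^sub>C (f w - f z)) + (inverse (w - z) * (\<phi> w - \<phi> z)) *\<^sub>C f z)
      (\<phi> z *\<^sub>C d + deriv \<phi> z *\<^sub>C f z) (at z)"
  proof (rule tends_to_in_add)
    show "tends_to_in X (\<lambda>w. \<phi> w *\<^sub>C (inverse (w - z) *\<^sub>C (f w - f z))) (\<phi> z *\<^sub>C d) (at z)"
      by (rule tends_to_in_scale[OF f(3) cont mem f(2)])
    show "tends_to_in X (\<lambda>w. (inverse (w - z) * (\<phi> w - \<phi> z)) *\<^sub>C f z) (deriv \<phi> z *\<^sub>C f z) (at z)"
      by (rule tends_to_in_scale[OF tends_to_in_const[OF f(1)] quot _ f(1)]) (simp add: f(1))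
    show "\<forall>\<^sub>F w in at z. \<phi> w *\<^sub>C (inverse (w - z) *\<^sub>C (f w - f z)) \<in> points X"
      using mem by eventually_elim (rule scale_mem)
  qed (auto intro!: always_eventually scale_mem f)
  also have "(\<lambda>w. \<phi> w *\<^sub>C (inverse (w - z) *\<^sub>C (f w - f z)) + (inverse (w - z) * (\<phi> w - \<phi> z)) *\<^sub>C f z) =
      (\<lambda>w. inverse (w - z) *\<^sub>C (\<phi> w *\<^sub>C f w - \<phi> z *\<^sub>C f z))"
    by (simp add: fun_eq_iff scaleC_scaleC scaleC_diff_right scaleC_diff_left right_diff_distrib mult.commute)
  finally show "\<exists>d\<in>points X. tends_to_in X (\<lambda>w. inverse (w - z) *\<^sub>C (\<phi> w *\<^sub>C f w - \<phi> z *\<^sub>C f z)) d (at z)"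
    using add_mem[OF scale_mem[OF f(2)] scale_mem[OF f(1)]] by blast
qed

lemma (in seminormed) analytic_into_const: "x \<in> points X \<Longrightarrow> analytic_into X S (\<lambda>z. x)"
  unfolding analytic_into_def tends_to_in_def by (auto intro!: bexI[OF _ zero_mem])

lemma analytic_into_map:
  assumes X: "seminormed X" and Y: "seminormed Y" and T: "clinear_on (points X) T"
    and C: "\<And>x. x \<in> points X \<Longrightarrow> T x \<in> points Y \<and> nrm Y (T x) \<le> C * nrm X x"
    and f: "analytic_into X S f" and S: "open S"
  shows "analytic_into Y S (\<lambda>z. T (f z))"
  unfolding analytic_into_def
proof (intro ballI conjI)
  interpret X: seminormed X by (rule X)
  fix z assume z: "z \<in> S"
  obtain d where f: "f z \<in> points X" "d \<in> points X"
    "tends_to_in X (\<lambda>w. inverse (w - z) *\<^sub>C (f w - f z)) d (at z)" "\<forall>\<^sub>F w in at z. f w \<in> points X"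
    using analytic_intoE[OF f z S] .
  show "T (f z) \<in> points Y" using C[OF f(1)] by blast
  have mem: "\<forall>\<^sub>F w in at z. inverse (w - z) *\<^sub>C (f w - f z) \<in> points X"
    using f(4) by eventually_elim (intro X.scale_mem X.diff_mem f(1))
  have lim: "tends_to_in Y (\<lambda>w. T (inverse (w - z) *\<^sub>C (f w - f z))) (T d) (at z)"
    by (rule tends_to_in_map[OF X Y T C f(3) mem f(2)])
  have eq: "\<forall>\<^sub>F w in at z. T (inverse (w - z) *\<^sub>C (f w - f z)) = inverse (w - z) *\<^sub>C (T (f w) - T (f z))"
    using f(4)
  proof eventually_elim
    case (elim w)
    have "T (inverse (w - z) *\<^sub>C (f w - f z)) = inverse (w - z) *\<^sub>C T (f w - f z)"
      using T X.diff_mem[OF elim f(1)] by (simp add: clinear_on_def)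
    then show ?case by (simp add: clinear_on_diff[OF T X elim f(1)])
  qed
  have "tends_to_in Y (\<lambda>w. inverse (w - z) *\<^sub>C (T (f w) - T (f z))) (T d) (at z)"
    using lim unfolding tends_to_in_def
    by (rule Lim_transform_eventually) (use eq in eventually_elim, simp)
  then show "\<exists>d\<in>points Y. tends_to_in Y (\<lambda>w. inverse (w - z) *\<^sub>C (T (f w) - T (f z))) d (at z)"
    using C[OF f(2)] by blast
qed

section \<open>The maximum principle on a strip\<close>

abbreviation strip :: "complex set" where "strip \<equiv> {z. 0 \<le> Re z \<and> Re z \<le> 1}"

abbreviation open_strip :: "complex set" where "open_strip \<equiv> {z. 0 < Re z \<and> Re z < 1}"

lemma open_open_strip: "open open_strip"
  by (intro open_Collect_conj open_halfspace_Re_gt open_halfspace_Re_lt)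

lemma norm_exp_square: "norm (exp (of_real a * (z\<^sup>2 - of_real b))) = exp (a * ((Re z)\<^sup>2 - (Im z)\<^sup>2 - b))"
  by (simp add: norm_exp_eq_Re power2_eq_square)

text \<open>Multiplication by \<open>exp (\<epsilon> (z\<^sup>2 - 1))\<close> makes the function small at the far ends of the strip.\<close>

lemma strip_maximum_principle:
  fixes g :: "complex \<Rightarrow> complex"
  assumes cont: "continuous_on strip g" and hol: "g holomorphic_on open_strip"
    and bdd: "\<And>z. z \<in> strip \<Longrightarrow> cmod (g z) \<le> C"
    and bdry: "\<And>z. Re z = 0 \<or> Re z = 1 \<Longrightarrow> cmod (g z) \<le> M"
    and z: "z \<in> strip"
  shows "cmod (g z) \<le> M"
proof (rule field_le_epsilon)
  fix \<delta> :: real assume \<delta>: "0 < \<delta>"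
  have M: "0 \<le> M" using bdry[of 0] norm_ge_zero[of "g 0"] by (simp del: norm_ge_zero)
  have le: "cmod (g z) \<le> (M + \<delta>) * exp (e * (1 + (Im z)\<^sup>2 - (Re z)\<^sup>2))" if e: "0 < e" for e
  proof -
    \<comment> \<open>The factor has modulus at most 1 on the strip, where
      \<open>(Re z)\<^sup>2 \<le> 1\<close>, and decays like a Gaussian in the imaginary part. This
      is why 1 is subtracted from the square.\<close>
    define h where "h = (\<lambda>z. g z * exp (of_real e * (z\<^sup>2 - of_real 1)))"
    have nh: "cmod (h z) = cmod (g z) * exp (e * ((Re z)\<^sup>2 - (Im z)\<^sup>2 - 1))" for z
      unfolding h_def norm_mult norm_exp_square ..
    have nh_le: "cmod (h z) \<le> cmod (g z) * exp (- e * (Im z)\<^sup>2)" if "z \<in> strip" for z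
    proof -
      have "(Re z)\<^sup>2 \<le> 1" using that by (simp add: power_le_one)
      then have "e * ((Re z)\<^sup>2 - (Im z)\<^sup>2 - 1) \<le> e * (- (Im z)\<^sup>2)"
        using e by (intro mult_left_mono) auto
      then show ?thesis unfolding nh by (intro mult_left_mono) auto
    qed
    have "((\<lambda>y. C * exp (- e * y\<^sup>2)) \<longlongrightarrow> C * 0) at_top"
      using e by (intro tendsto_mult_left) real_asymp
    then have "\<forall>\<^sub>F y in at_top. C * exp (- e * y\<^sup>2) < M + \<delta>"
      using M \<delta> by (intro order_tendstoD) auto
    then obtain R0 where R0: "\<And>y. R0 \<le> y \<Longrightarrow> C * exp (- e * y\<^sup>2) < M + \<delta>"
      unfolding eventually_at_top_linorder by blast
    \<comment> \<open>Large enough for the rectangle to contain \<open>z\<close>, and for the decay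
      to beat the crude bound \<open>C\<close> on the horizontal sides.\<close>
    define R where "R = max R0 (\<bar>Im z\<bar> + 1)"
    define S where "S = cbox (Complex 0 (- R)) (Complex 1 R)"
    have S: "w \<in> S \<longleftrightarrow> 0 \<le> Re w \<and> Re w \<le> 1 \<and> \<bar>Im w\<bar> \<le> R" for w
      unfolding S_def by (auto simp: in_cbox_complex_iff abs_le_iff)
    have Sint: "interior S = box (Complex 0 (- R)) (Complex 1 R)" by (simp add: S_def)
    have "cmod (h z) \<le> M + \<delta>"
    proof (rule maximum_modulus_frontier[of h S])
      have "interior S \<subseteq> open_strip" unfolding Sint by (auto simp: in_box_complex_iff)
      then have "g holomorphic_on interior S" using hol holomorphic_on_subset by blast
      then show "h holomorphic_on interior S" unfolding h_def by (intro holomorphic_intros)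
      have "closure S = S" by (simp add: S_def)
      moreover have "continuous_on S g" by (rule continuous_on_subset[OF cont]) (use S in auto)
      ultimately show "continuous_on (closure S) h" unfolding h_def by (auto intro!: continuous_intros)
      show "bounded S" by (simp add: S_def)
      show "z \<in> S" using z by (simp add: S R_def)
      fix w assume "w \<in> frontier S"
      then have w: "w \<in> S" "w \<notin> interior S"
        by (auto simp: frontier_def S_def)
      then have strip: "w \<in> strip" using S by auto
      have "Re w = 0 \<or> Re w = 1 \<or> \<bar>Im w\<bar> = R"
        using w unfolding Sint S by (auto simp: in_box_complex_iff)
      then consider "Re w = 0 \<or> Re w = 1" | "\<bar>Im w\<bar> = R" by blast
      then show "cmod (h w) \<le> M + \<delta>"
      proof cases
        case 1
        have "cmod (h w) \<le> cmod (g w) * exp (- e * (Im w)\<^sup>2)" by (rule nh_le[OF strip])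
        also have "\<dots> \<le> cmod (g w) * 1" using e by (intro mult_left_mono) auto
        also have "\<dots> \<le> M + \<delta>" using bdry[OF 1] \<delta> by simp
        finally show ?thesis .
      next
        case 2
        have "cmod (h w) \<le> cmod (g w) * exp (- e * (Im w)\<^sup>2)" by (rule nh_le[OF strip])
        also have "\<dots> \<le> C * exp (- e * (Im w)\<^sup>2)" using bdd[OF strip] by (intro mult_right_mono) auto
        also have "(Im w)\<^sup>2 = R\<^sup>2" using 2 by (metis power2_abs)
        also have "C * exp (- e * R\<^sup>2) \<le> M + \<delta>" using R0[of R] by (simp add: R_def)
        finally show ?thesis .
      qed
    qed
    then have "cmod (g z) * exp (e * ((Re z)\<^sup>2 - (Im z)\<^sup>2 - 1)) \<le> M + \<delta>" by (simp only: nh)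
    then have "cmod (g z) * exp (e * ((Re z)\<^sup>2 - (Im z)\<^sup>2 - 1)) * exp (e * (1 + (Im z)\<^sup>2 - (Re z)\<^sup>2))
        \<le> (M + \<delta>) * exp (e * (1 + (Im z)\<^sup>2 - (Re z)\<^sup>2))"
      by (intro mult_right_mono) auto
    then show ?thesis
      unfolding mult.assoc exp_add[symmetric] distrib_left[symmetric] by simp
  qed
  \<comment> \<open>The rectangle depended on \<open>e\<close> but the resulting bound at
    \<open>z\<close> does not mention it, so \<open>e\<close> may tend to 0 with \<open>z\<close>
    fixed.\<close>
  have "((\<lambda>e. (M + \<delta>) * exp (e * (1 + (Im z)\<^sup>2 - (Re z)\<^sup>2))) \<longlongrightarrow>
      (M + \<delta>) * exp (0 * (1 + (Im z)\<^sup>2 - (Re z)\<^sup>2))) (at_right 0)"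
    by (intro tendsto_intros)
  then show "cmod (g z) \<le> M + \<delta>"
    by (intro tendsto_lowerbound[where F = "at_right 0" and f = "\<lambda>e. (M + \<delta>) * exp (e * (1 + (Im z)\<^sup>2 - (Re z)\<^sup>2))"])
       (auto simp: eventually_at_right_less intro!: eventually_at_rightI[of 0 1] le)
qed

section \<open>The complex method\<close>

lemma F_space_bounded:
  assumes "f \<in> F_space A0 A1"
  shows "\<exists>C. \<forall>z\<in>strip. nrm (sum_space A0 A1) (f z) \<le> C"
  using assms unfolding F_space_def by blast

lemma F_spaceD:
  assumes "f \<in> F_space A0 A1"
  shows "continuous_on_into (sum_space A0 A1) strip f" "analytic_into (sum_space A0 A1) open_strip f"
    "continuous_on_into A0 UNIV (\<lambda>y. f (Complex 0 y))" "continuous_on_into A1 UNIV (\<lambda>y. f (Complex 1 y))"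
    "((\<lambda>y. nrm A0 (f (Complex 0 y))) \<longlongrightarrow> 0) at_infinity"
    "((\<lambda>y. nrm A1 (f (Complex 1 y))) \<longlongrightarrow> 0) at_infinity"
  using assms unfolding F_space_def by blast+

lemma continuous_on_Complex: "continuous_on UNIV (Complex a)"
  unfolding continuous_on_def by (auto intro!: tendsto_Complex tendsto_intros)

text \<open>\<open>F_norm\<close> is made of real suprema, which dominate their members only over
  bounded sets. Decay takes care of large arguments, compactness of the remaining interval.\<close>

lemma (in seminormed) bounded_of_vanishing_at_infinity:
  fixes f :: "real \<Rightarrow> 'v"
  assumes f: "continuous_on_into X UNIV f" and lim: "((\<lambda>y. nrm X (f y)) \<longlongrightarrow> 0) at_infinity"
  shows "bdd_above (range (\<lambda>y. nrm X (f y)))"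
proof -
  have "continuous_on UNIV (\<lambda>y. nrm X (f y))"
    unfolding continuous_on_def using continuous_on_intoD[OF f] by (auto intro!: tends_to_in_nrm)
  moreover have "\<forall>\<^sub>F y in at_infinity. nrm X (f y) < 1"
    using lim by (rule order_tendstoD) simp
  then obtain b where b: "\<And>y. b \<le> norm y \<Longrightarrow> nrm X (f y) < 1"
    by (auto simp: eventually_at_infinity)
  ultimately have "compact ((\<lambda>y. nrm X (f y)) ` {-b..b})"
    by (intro compact_continuous_image) (auto intro: continuous_on_subset)
  then obtain C where C: "\<And>y. y \<in> {-b..b} \<Longrightarrow> nrm X (f y) \<le> C"
    by (meson bdd_above.E bounded_imp_bdd_above compact_imp_bounded imageI)
  have "nrm X (f y) \<le> max C 1" for y
  proof (cases "b \<le> norm y")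
    case True
    then show ?thesis using b[of y] by linarith
  next
    case False
    then have "y \<in> {-b..b}" by auto
    then show ?thesis using C[of y] by linarith
  qed
  then show ?thesis by (intro bdd_aboveI2[where M = "max C 1"])
qed

section \<open>Operations on admissible functions in the strip\<close>

context seminormed_couple
begin

lemma F_space_boundary:
  assumes f: "f \<in> F_space A0 A1"
  shows "f (Complex 0 y) \<in> points A0" "f (Complex 1 y) \<in> points A1"
    "nrm A0 (f (Complex 0 y)) \<le> F_norm A0 A1 f" "nrm A1 (f (Complex 1 y)) \<le> F_norm A0 A1 f"
proof -
  note * = F_space_bounded[OF f] F_spaceD[OF f]
  show "f (Complex 0 y) \<in> points A0" "f (Complex 1 y) \<in> points A1"
    using continuous_on_intoD(1)[OF *(4), of y] continuous_on_intoD(1)[OF *(5), of y] by auto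
  have "nrm A0 (f (Complex 0 y)) \<le> (SUP y. nrm A0 (f (Complex 0 y)))"
    by (rule cSUP_upper[OF UNIV_I A0.bounded_of_vanishing_at_infinity[OF *(4,6)]])
  then show "nrm A0 (f (Complex 0 y)) \<le> F_norm A0 A1 f" by (simp add: F_norm_def)
  have "nrm A1 (f (Complex 1 y)) \<le> (SUP y. nrm A1 (f (Complex 1 y)))"
    by (rule cSUP_upper[OF UNIV_I A1.bounded_of_vanishing_at_infinity[OF *(5,7)]])
  then show "nrm A1 (f (Complex 1 y)) \<le> F_norm A0 A1 f" by (simp add: F_norm_def)
qed

lemma F_norm_nonneg: "f \<in> F_space A0 A1 \<Longrightarrow> 0 \<le> F_norm A0 A1 f"
  using F_space_boundary[of f 0] A0.nrm_nonneg by (meson order_trans)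

lemma F_norm_leI:
  assumes "\<And>y. nrm A0 (f (Complex 0 y)) \<le> c" "\<And>y. nrm A1 (f (Complex 1 y)) \<le> c"
  shows "F_norm A0 A1 f \<le> c"
  using assms by (auto simp: F_norm_def intro!: cSUP_least)

lemma F_space_add:
  assumes f: "f \<in> F_space A0 A1" and g: "g \<in> F_space A0 A1"
  shows "(\<lambda>z. f z + g z) \<in> F_space A0 A1"
proof -
  obtain C where bdd_f: "\<And>z. z \<in> strip \<Longrightarrow> nrm (sum_space A0 A1) (f z) \<le> C"
    using F_space_bounded[OF f] by blast
  note * = bdd_f F_spaceD[OF f]
  obtain C' where bdd_g: "\<And>z. z \<in> strip \<Longrightarrow> nrm (sum_space A0 A1) (g z) \<le> C'"
    using F_space_bounded[OF g] by blast
  note ** = bdd_g F_spaceD[OF g]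
  have "nrm (sum_space A0 A1) (f z + g z) \<le> C + C'" if z: "z \<in> strip" for z
    using sum.nrm_add[OF continuous_on_intoD(1)[OF *(2) z] continuous_on_intoD(1)[OF **(2) z]]
      *(1)[OF z] **(1)[OF z] by linarith
  moreover have "((\<lambda>y. nrm A0 (f (Complex 0 y) + g (Complex 0 y))) \<longlongrightarrow> 0) at_infinity"
  proof (rule Lim_null_comparison)
    show "\<forall>\<^sub>F y in at_infinity. norm (nrm A0 (f (Complex 0 y) + g (Complex 0 y)))
        \<le> nrm A0 (f (Complex 0 y)) + nrm A0 (g (Complex 0 y))"
      using F_space_boundary(1)[OF f] F_space_boundary(1)[OF g]
      by (auto simp: A0.nrm_nonneg A0.add_mem intro!: always_eventually A0.nrm_add)
  qed (use tendsto_add[OF *(6) **(6)] in simp)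
  moreover have "((\<lambda>y. nrm A1 (f (Complex 1 y) + g (Complex 1 y))) \<longlongrightarrow> 0) at_infinity"
  proof (rule Lim_null_comparison)
    show "\<forall>\<^sub>F y in at_infinity. norm (nrm A1 (f (Complex 1 y) + g (Complex 1 y)))
        \<le> nrm A1 (f (Complex 1 y)) + nrm A1 (g (Complex 1 y))"
      using F_space_boundary(2)[OF f] F_space_boundary(2)[OF g]
      by (auto simp: A1.nrm_nonneg A1.add_mem intro!: always_eventually A1.nrm_add)
  qed (use tendsto_add[OF *(7) **(7)] in simp)
  ultimately show ?thesis
    unfolding F_space_def using sum.continuous_on_into_add[OF *(2) **(2)]
      sum.analytic_into_add[OF *(3) **(3) open_open_strip]
      A0.continuous_on_into_add[OF *(4) **(4)] A1.continuous_on_into_add[OF *(5) **(5)] by blast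
qed

text \<open>Decay at infinity is asked of the product and not of \<open>f\<close>, so that the lemma
  covers both a change of weight for a member of \<open>F_space\<close> and a constant vector
  multiplied by a Gaussian.\<close>

lemma F_space_scale:
  assumes bdd: "\<And>z. z \<in> strip \<Longrightarrow> nrm (sum_space A0 A1) (f z) \<le> C"
    and cont: "continuous_on_into (sum_space A0 A1) strip f"
    and an: "analytic_into (sum_space A0 A1) open_strip f"
    and cont0: "continuous_on_into A0 UNIV (\<lambda>y. f (Complex 0 y))"
    and cont1: "continuous_on_into A1 UNIV (\<lambda>y. f (Complex 1 y))"
    and \<phi>: "\<phi> holomorphic_on UNIV" "\<And>z. z \<in> strip \<Longrightarrow> cmod (\<phi> z) \<le> M"
    and lim0: "((\<lambda>y. cmod (\<phi> (Complex 0 y)) * nrm A0 (f (Complex 0 y))) \<longlongrightarrow> 0) at_infinity"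
    and lim1: "((\<lambda>y. cmod (\<phi> (Complex 1 y)) * nrm A1 (f (Complex 1 y))) \<longlongrightarrow> 0) at_infinity"
  shows "(\<lambda>z. \<phi> z *\<^sub>C f z) \<in> F_space A0 A1"
proof -
  have \<phi>_cont: "continuous_on S \<phi>" for S
    using holomorphic_on_imp_continuous_on[OF \<phi>(1)] continuous_on_subset by blast
  have \<phi>_Complex: "continuous_on UNIV (\<lambda>y. \<phi> (Complex a y))" for a
    by (rule continuous_on_compose2[OF \<phi>_cont continuous_on_Complex]) auto
  have mem: "f (Complex 0 y) \<in> points A0" "f (Complex 1 y) \<in> points A1" for y
    using continuous_on_intoD(1)[OF cont0, of y] continuous_on_intoD(1)[OF cont1, of y] by auto
  have "nrm (sum_space A0 A1) (\<phi> z *\<^sub>C f z) \<le> M * C" if z: "z \<in> strip" for z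
  proof -
    have f: "f z \<in> points (sum_space A0 A1)" by (rule continuous_on_intoD(1)[OF cont z])
    have "cmod (\<phi> z) * nrm (sum_space A0 A1) (f z) \<le> M * C"
      using \<phi>(2)[OF z] bdd[OF z] sum.nrm_nonneg[OF f] order_trans[OF norm_ge_zero \<phi>(2)[OF z]]
      by (intro mult_mono) auto
    then show ?thesis by (simp add: sum.nrm_scale[OF f])
  qed
  moreover have "continuous_on_into (sum_space A0 A1) strip (\<lambda>z. \<phi> z *\<^sub>C f z)"
    by (rule sum.continuous_on_into_scale[OF cont \<phi>_cont])
  moreover have "analytic_into (sum_space A0 A1) open_strip (\<lambda>z. \<phi> z *\<^sub>C f z)"
    using holomorphic_on_subset[OF \<phi>(1)] by (intro sum.analytic_into_scale[OF an _ open_open_strip]) auto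
  moreover have "continuous_on_into A0 UNIV (\<lambda>y. \<phi> (Complex 0 y) *\<^sub>C f (Complex 0 y))"
    by (rule A0.continuous_on_into_scale[OF cont0 \<phi>_Complex])
  moreover have "continuous_on_into A1 UNIV (\<lambda>y. \<phi> (Complex 1 y) *\<^sub>C f (Complex 1 y))"
    by (rule A1.continuous_on_into_scale[OF cont1 \<phi>_Complex])
  ultimately show ?thesis
    unfolding F_space_def using lim0 lim1 A0.nrm_scale[OF mem(1)] A1.nrm_scale[OF mem(2)]
    by (simp only: mem_Collect_eq) blast
qed

lemma F_space_map:
  assumes B: "seminormed_couple B0 B1" and T: "clinear_on (points (sum_space A0 A1)) T"
    and C: "0 < C0" "0 < C1"
    and T0: "\<And>x. x \<in> points A0 \<Longrightarrow> T x \<in> points B0 \<and> nrm B0 (T x) \<le> C0 * nrm A0 x"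
    and T1: "\<And>x. x \<in> points A1 \<Longrightarrow> T x \<in> points B1 \<and> nrm B1 (T x) \<le> C1 * nrm A1 x"
    and f: "f \<in> F_space A0 A1"
  shows "(\<lambda>z. T (f z)) \<in> F_space B0 B1"
proof -
  interpret B: seminormed_couple B0 B1 by (rule B)
  obtain C where bdd_f: "\<And>z. z \<in> strip \<Longrightarrow> nrm (sum_space A0 A1) (f z) \<le> C"
    using F_space_bounded[OF f] by blast
  note * = bdd_f F_spaceD[OF f]
  have Tadd: "T (x + y) = T x + T y" if "x \<in> points A0" "y \<in> points A1" for x y
    using T points0_le[OF that(1)] points1_le[OF that(2)] by (simp add: clinear_on_def)
  have sub: "points A0 \<subseteq> points (sum_space A0 A1)" "points A1 \<subseteq> points (sum_space A0 A1)"
    using points0_le points1_le by auto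
  have lin0: "clinear_on (points A0) T" and lin1: "clinear_on (points A1) T"
    using T sub unfolding clinear_on_def by blast+
  \<comment> \<open>A common bound on both spaces gives a bound between the sums, by
    \<open>K_functional_map\<close> without dilation. The boundary lines keep their own
    constants.\<close>
  define c where "c = max C0 C1"
  have c: "0 < c" using C by (simp add: c_def)
  have T0': "T x \<in> points B0 \<and> nrm B0 (T x) \<le> c * nrm A0 x" if "x \<in> points A0" for x
  proof -
    have "C0 * nrm A0 x \<le> c * nrm A0 x" using A0.nrm_nonneg[OF that] by (intro mult_right_mono) (simp_all add: c_def)
    then show ?thesis using T0[OF that] by linarith
  qed
  have T1': "T x \<in> points B1 \<and> nrm B1 (T x) \<le> c * 1 * nrm A1 x" if "x \<in> points A1" for x
  proof -
    have "C1 * nrm A1 x \<le> c * nrm A1 x" using A1.nrm_nonneg[OF that] by (intro mult_right_mono) (simp_all add: c_def)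
    then show ?thesis using T1[OF that] by auto
  qed
  have Tsum: "T x \<in> points (sum_space B0 B1) \<and> nrm (sum_space B0 B1) (T x) \<le> c * nrm (sum_space A0 A1) x"
    if x: "x \<in> points (sum_space A0 A1)" for x
    using map_sum_points[OF B Tadd conjunct1[OF T0] conjunct1[OF T1] x]
      K_functional_map[OF B Tadd T0' T1' c _ x, of 1] by (simp add: nrm_sum_space B.nrm_sum_space)
  note bd = F_space_boundary[OF f]
  have "nrm (sum_space B0 B1) (T (f z)) \<le> c * C" if z: "z \<in> strip" for z
    using Tsum[OF continuous_on_intoD(1)[OF *(2) z]] mult_left_mono[OF *(1)[OF z], of c] c by linarith
  moreover have "continuous_on_into (sum_space B0 B1) strip (\<lambda>z. T (f z))"
    by (rule continuous_on_into_map[OF sum.seminormed_axioms B.sum.seminormed_axioms T Tsum *(2)])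
  moreover have "analytic_into (sum_space B0 B1) open_strip (\<lambda>z. T (f z))"
    by (rule analytic_into_map[OF sum.seminormed_axioms B.sum.seminormed_axioms T Tsum *(3) open_open_strip])
  moreover have "continuous_on_into B0 UNIV (\<lambda>y. T (f (Complex 0 y)))"
    by (rule continuous_on_into_map[OF A0.seminormed_axioms B.A0.seminormed_axioms lin0 T0 *(4)])
  moreover have "continuous_on_into B1 UNIV (\<lambda>y. T (f (Complex 1 y)))"
    by (rule continuous_on_into_map[OF A1.seminormed_axioms B.A1.seminormed_axioms lin1 T1 *(5)])
  moreover have "((\<lambda>y. nrm B0 (T (f (Complex 0 y)))) \<longlongrightarrow> 0) at_infinity"
  proof (rule Lim_null_comparison)
    show "\<forall>\<^sub>F y in at_infinity. norm (nrm B0 (T (f (Complex 0 y)))) \<le> C0 * nrm A0 (f (Complex 0 y))"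
      using T0[OF bd(1)] B.A0.nrm_nonneg by (intro always_eventually) auto
  qed (use tendsto_mult_right_zero[OF *(6), of C0] in simp)
  moreover have "((\<lambda>y. nrm B1 (T (f (Complex 1 y)))) \<longlongrightarrow> 0) at_infinity"
  proof (rule Lim_null_comparison)
    show "\<forall>\<^sub>F y in at_infinity. norm (nrm B1 (T (f (Complex 1 y)))) \<le> C1 * nrm A1 (f (Complex 1 y))"
      using T1[OF bd(2)] B.A1.nrm_nonneg by (intro always_eventually) auto
  qed (use tendsto_mult_right_zero[OF *(7), of C1] in simp)
  ultimately show ?thesis unfolding F_space_def by blast
qed

section \<open>Estimates for the norm of the complex method\<close>

lemma complex_interp_nrm_le:
  assumes "f \<in> F_space A0 A1" "f (of_real \<theta>) = a"
  shows "a \<in> points (complex_interp A0 A1 \<theta>)" "nrm (complex_interp A0 A1 \<theta>) a \<le> F_norm A0 A1 f"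
proof -
  show "a \<in> points (complex_interp A0 A1 \<theta>)" using assms by (auto simp: complex_interp_def)
  have "bdd_below {F_norm A0 A1 f |f. f \<in> F_space A0 A1 \<and> f (of_real \<theta>) = a}"
    using F_norm_nonneg by (intro bdd_belowI[where m = 0]) auto
  then show "nrm (complex_interp A0 A1 \<theta>) a \<le> F_norm A0 A1 f"
    using assms by (auto simp: complex_interp_def intro!: cInf_lower)
qed

lemma complex_interp_approx:
  assumes "a \<in> points (complex_interp A0 A1 \<theta>)" "0 < e"
  obtains f where "f \<in> F_space A0 A1" "f (of_real \<theta>) = a"
    "F_norm A0 A1 f < nrm (complex_interp A0 A1 \<theta>) a + e"
proof -
  let ?S = "{F_norm A0 A1 f |f. f \<in> F_space A0 A1 \<and> f (of_real \<theta>) = a}"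
  have "?S \<noteq> {}" using assms(1) by (auto simp: complex_interp_def)
  moreover have "Inf ?S < nrm (complex_interp A0 A1 \<theta>) a + e"
    using assms(2) by (simp add: complex_interp_def)
  ultimately have "\<exists>x\<in>?S. x < nrm (complex_interp A0 A1 \<theta>) a + e" by (rule cInf_lessD)
  then show ?thesis using that by blast
qed

lemma complex_interp_nrm_nonneg:
  assumes "a \<in> points (complex_interp A0 A1 \<theta>)"
  shows "0 \<le> nrm (complex_interp A0 A1 \<theta>) a"
proof (rule field_le_epsilon)
  fix e :: real assume "0 < e"
  then obtain f where "f \<in> F_space A0 A1" "F_norm A0 A1 f < nrm (complex_interp A0 A1 \<theta>) a + e"
    using complex_interp_approx[OF assms] by metis
  then show "0 \<le> nrm (complex_interp A0 A1 \<theta>) a + e" using F_norm_nonneg[of f] by linarith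
qed

text \<open>Multiplication by \<open>(m1 / m0) powr (\<theta> - z)\<close> balances the bounds on the two boundary lines.\<close>

lemma complex_interp_three_lines:
  assumes f: "f \<in> F_space A0 A1" and m: "0 < m0" "0 < m1"
    and f0: "\<And>y. nrm A0 (f (Complex 0 y)) \<le> m0" and f1: "\<And>y. nrm A1 (f (Complex 1 y)) \<le> m1"
  shows "nrm (complex_interp A0 A1 \<theta>) (f (of_real \<theta>)) \<le> m0 powr (1 - \<theta>) * m1 powr \<theta>"
proof -
  define L where "L = ln m1 - ln m0"
  define \<phi> where "\<phi> = (\<lambda>z::complex. exp (of_real L * (of_real \<theta> - z)))"
  have n\<phi>: "cmod (\<phi> z) = exp (L * (\<theta> - Re z))" for z by (simp add: \<phi>_def norm_exp_eq_Re)
  have \<phi>_bdd: "cmod (\<phi> z) \<le> exp (\<bar>L\<bar> * (\<bar>\<theta>\<bar> + 1))" if "z \<in> strip" for z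
  proof -
    have "L * (\<theta> - Re z) \<le> \<bar>L\<bar> * \<bar>\<theta> - Re z\<bar>" by (simp add: abs_mult[symmetric])
    also have "\<dots> \<le> \<bar>L\<bar> * (\<bar>\<theta>\<bar> + 1)" using that by (intro mult_left_mono) auto
    finally show ?thesis by (simp add: n\<phi>)
  qed
  obtain C where bdd_f: "\<And>z. z \<in> strip \<Longrightarrow> nrm (sum_space A0 A1) (f z) \<le> C"
    using F_space_bounded[OF f] by blast
  note * = bdd_f F_spaceD[OF f]
  have F: "(\<lambda>z. \<phi> z *\<^sub>C f z) \<in> F_space A0 A1"
  proof (rule F_space_scale[OF *(1-5) _ \<phi>_bdd])
    show "\<phi> holomorphic_on UNIV" unfolding \<phi>_def by (intro holomorphic_intros)
    show "((\<lambda>y. cmod (\<phi> (Complex 0 y)) * nrm A0 (f (Complex 0 y))) \<longlongrightarrow> 0) at_infinity"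
      "((\<lambda>y. cmod (\<phi> (Complex 1 y)) * nrm A1 (f (Complex 1 y))) \<longlongrightarrow> 0) at_infinity"
      unfolding n\<phi> complex.sel by (rule tendsto_mult_right_zero[OF *(6)] tendsto_mult_right_zero[OF *(7)])+
  qed
  let ?m = "m0 powr (1 - \<theta>) * m1 powr \<theta>"
  have m_exp: "?m = exp ((1 - \<theta>) * ln m0 + \<theta> * ln m1)" using m by (simp add: powr_def exp_add)
  have e0: "exp (L * (\<theta> - 0)) * m0 = ?m"
  proof -
    have "exp (L * (\<theta> - 0)) * m0 = exp (L * (\<theta> - 0) + ln m0)" using m by (simp add: exp_add)
    also have "L * (\<theta> - 0) + ln m0 = (1 - \<theta>) * ln m0 + \<theta> * ln m1" by (simp add: L_def algebra_simps)
    finally show ?thesis unfolding m_exp .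
  qed
  have e1: "exp (L * (\<theta> - 1)) * m1 = ?m"
  proof -
    have "exp (L * (\<theta> - 1)) * m1 = exp (L * (\<theta> - 1) + ln m1)" using m by (simp add: exp_add)
    also have "L * (\<theta> - 1) + ln m1 = (1 - \<theta>) * ln m0 + \<theta> * ln m1" by (simp add: L_def algebra_simps)
    finally show ?thesis unfolding m_exp .
  qed
  have "F_norm A0 A1 (\<lambda>z. \<phi> z *\<^sub>C f z) \<le> ?m"
  proof (rule F_norm_leI)
    fix y
    show "nrm A0 (\<phi> (Complex 0 y) *\<^sub>C f (Complex 0 y)) \<le> ?m"
      unfolding A0.nrm_scale[OF F_space_boundary(1)[OF f]] n\<phi> complex.sel e0[symmetric]
      by (intro mult_left_mono f0) simp
    show "nrm A1 (\<phi> (Complex 1 y) *\<^sub>C f (Complex 1 y)) \<le> ?m"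
      unfolding A1.nrm_scale[OF F_space_boundary(2)[OF f]] n\<phi> complex.sel e1[symmetric]
      by (intro mult_left_mono f1) simp
  qed
  moreover have "nrm (complex_interp A0 A1 \<theta>) (f (of_real \<theta>)) \<le> F_norm A0 A1 (\<lambda>z. \<phi> z *\<^sub>C f z)"
    by (rule complex_interp_nrm_le(2)[OF F]) (simp add: \<phi>_def scaleC_one)
  ultimately show ?thesis by linarith
qed

lemma complex_interp_operator:
  assumes B: "seminormed_couple B0 B1" and T: "clinear_on (points (sum_space A0 A1)) T"
    and C: "0 < C0" "0 < C1"
    and T0: "\<And>x. x \<in> points A0 \<Longrightarrow> T x \<in> points B0 \<and> nrm B0 (T x) \<le> C0 * nrm A0 x"
    and T1: "\<And>x. x \<in> points A1 \<Longrightarrow> T x \<in> points B1 \<and> nrm B1 (T x) \<le> C1 * nrm A1 x"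
    and a: "a \<in> points (complex_interp A0 A1 \<theta>)"
  shows "T a \<in> points (complex_interp B0 B1 \<theta>) \<and>
    nrm (complex_interp B0 B1 \<theta>) (T a) \<le> C0 powr (1 - \<theta>) * C1 powr \<theta> * nrm (complex_interp A0 A1 \<theta>) a"
proof -
  interpret B: seminormed_couple B0 B1 by (rule B)
  let ?c = "C0 powr (1 - \<theta>) * C1 powr \<theta>" and ?n = "nrm (complex_interp A0 A1 \<theta>) a"
  have *: "T a \<in> points (complex_interp B0 B1 \<theta>) \<and> nrm (complex_interp B0 B1 \<theta>) (T a) \<le> ?c * (?n + e)"
    if e: "0 < e" for e
  proof -
    obtain f where f: "f \<in> F_space A0 A1" "f (of_real \<theta>) = a" "F_norm A0 A1 f < ?n + e"
      using complex_interp_approx[OF a e] .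
    \<comment> \<open>Strictly positive even if the norm of \<open>a\<close> is 0, as the three
      lines estimate requires; its powers with exponents \<open>1 - \<theta>\<close> and \<theta>
      recombine to \<open>N\<close>.\<close>
    define N where "N = ?n + e"
    have N: "0 < N" using complex_interp_nrm_nonneg[OF a] e by (simp add: N_def)
    note bd = F_space_boundary[OF f(1)]
    have TF: "(\<lambda>z. T (f z)) \<in> F_space B0 B1" by (rule F_space_map[OF B T C T0 T1 f(1)])
    have "nrm (complex_interp B0 B1 \<theta>) (T (f (of_real \<theta>))) \<le> (C0 * N) powr (1 - \<theta>) * (C1 * N) powr \<theta>"
    proof (rule B.complex_interp_three_lines[OF TF])
      show "nrm B0 (T (f (Complex 0 y))) \<le> C0 * N" for y
      proof -
        have "nrm B0 (T (f (Complex 0 y))) \<le> C0 * nrm A0 (f (Complex 0 y))" using T0[OF bd(1)] by blast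
        also have "\<dots> \<le> C0 * N" using bd(3)[of y] f(3) C by (intro mult_left_mono) (simp_all add: N_def)
        finally show ?thesis .
      qed
      show "nrm B1 (T (f (Complex 1 y))) \<le> C1 * N" for y
      proof -
        have "nrm B1 (T (f (Complex 1 y))) \<le> C1 * nrm A1 (f (Complex 1 y))" using T1[OF bd(2)] by blast
        also have "\<dots> \<le> C1 * N" using bd(4)[of y] f(3) C by (intro mult_left_mono) (simp_all add: N_def)
        finally show ?thesis .
      qed
    qed (use C N in simp_all)
    also have "(C0 * N) powr (1 - \<theta>) * (C1 * N) powr \<theta> = ?c * (N powr (1 - \<theta>) * N powr \<theta>)"
      by (simp add: powr_mult)
    also have "N powr (1 - \<theta>) * N powr \<theta> = N" using N by (simp flip: powr_add)
    finally show ?thesis using B.complex_interp_nrm_le(1)[OF TF refl, of \<theta>] f(2) by (simp add: N_def)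
  qed
  have "nrm (complex_interp B0 B1 \<theta>) (T a) \<le> ?c * ?n"
  proof (rule field_le_epsilon)
    fix e :: real assume e: "0 < e"
    have c: "0 < ?c" using C by simp
    have "c * (n + e / c) = c * n + e" if "0 < c" for c n :: real using that by (simp add: distrib_left)
    from this[OF c] show "nrm (complex_interp B0 B1 \<theta>) (T a) \<le> ?c * ?n + e"
      using *[OF divide_pos_pos[OF e c]] by simp
  qed
  then show ?thesis using *[of 1] by simp
qed

text \<open>A constant function does not decay on the boundary lines, so \<open>x\<close> is
  multiplied by the exponential of the square of \<open>z\<close> minus the square of \<theta>. This
  factor is 1 at \<theta>, decays along vertical lines and has modulus at most \<open>exp 1\<close>
  on the strip, whence the constant.\<close>

lemma complex_interp_point:
  assumes \<theta>: "0 < \<theta>" "\<theta> < 1" and x: "x \<in> points A0" "x \<in> points A1"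
    and m: "0 < m0" "0 < m1" "nrm A0 x \<le> m0" "nrm A1 x \<le> m1"
  shows "x \<in> points (complex_interp A0 A1 \<theta>) \<and>
    nrm (complex_interp A0 A1 \<theta>) x \<le> exp 1 * m0 powr (1 - \<theta>) * m1 powr \<theta>"
proof -
  define \<phi> where "\<phi> = (\<lambda>z::complex. exp (of_real 1 * (z\<^sup>2 - of_real (\<theta>\<^sup>2))))"
  have n\<phi>: "cmod (\<phi> z) = exp ((Re z)\<^sup>2 - (Im z)\<^sup>2 - \<theta>\<^sup>2)" for z
    unfolding \<phi>_def norm_exp_square by simp
  have \<phi>_bdd: "cmod (\<phi> z) \<le> exp 1" if "z \<in> strip" for z
  proof -
    have "(Re z)\<^sup>2 \<le> 1" using that by (simp add: power_le_one)
    moreover have "0 \<le> (Im z)\<^sup>2" "0 \<le> \<theta>\<^sup>2" by simp_all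
    ultimately show ?thesis unfolding n\<phi> exp_le_cancel_iff by linarith
  qed
  have lim: "((\<lambda>y. cmod (\<phi> (Complex r y)) * c) \<longlongrightarrow> 0) at_infinity" for r c
  proof -
    have "((\<lambda>y. exp (r\<^sup>2 - y\<^sup>2 - \<theta>\<^sup>2) * c) \<longlongrightarrow> 0) at_infinity"
      unfolding at_infinity_eq_at_top_bot by (intro filterlim_sup) real_asymp+
    then show ?thesis by (simp add: n\<phi>)
  qed
  note xs = points0_le[OF x(1)]
  have F: "(\<lambda>z. \<phi> z *\<^sub>C x) \<in> F_space A0 A1"
  proof (rule F_space_scale[OF _ sum.continuous_on_into_const[OF xs] sum.analytic_into_const[OF xs]
        A0.continuous_on_into_const[OF x(1)] A1.continuous_on_into_const[OF x(2)] _ \<phi>_bdd lim lim])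
    show "nrm (sum_space A0 A1) x \<le> nrm (sum_space A0 A1) x" for z by simp
    show "\<phi> holomorphic_on UNIV" unfolding \<phi>_def by (intro holomorphic_intros)
  qed
  have at_\<theta>: "\<phi> (of_real \<theta>) *\<^sub>C x = x" by (simp add: \<phi>_def scaleC_one)
  have "nrm (complex_interp A0 A1 \<theta>) (\<phi> (of_real \<theta>) *\<^sub>C x) \<le> (exp 1 * m0) powr (1 - \<theta>) * (exp 1 * m1) powr \<theta>"
  proof (rule complex_interp_three_lines[OF F])
    show "nrm A0 (\<phi> (Complex 0 y) *\<^sub>C x) \<le> exp 1 * m0" for y
      unfolding A0.nrm_scale[OF x(1)] using \<phi>_bdd[of "Complex 0 y"] m(3) A0.nrm_nonneg[OF x(1)]
      by (intro mult_mono) simp_all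
    show "nrm A1 (\<phi> (Complex 1 y) *\<^sub>C x) \<le> exp 1 * m1" for y
      unfolding A1.nrm_scale[OF x(2)] using \<phi>_bdd[of "Complex 1 y"] m(4) A1.nrm_nonneg[OF x(2)]
      by (intro mult_mono) simp_all
  qed (use m in simp_all)
  also have "(exp 1 * m0) powr (1 - \<theta>) * (exp 1 * m1) powr \<theta> =
      (exp 1 powr (1 - \<theta>) * exp 1 powr \<theta>) * m0 powr (1 - \<theta>) * m1 powr \<theta>"
    by (simp add: powr_mult)
  also have "exp 1 powr (1 - \<theta>) * exp 1 powr \<theta> = exp (1::real)" by (simp flip: powr_add)
  finally show ?thesis using complex_interp_nrm_le(1)[OF F at_\<theta>] by (simp add: at_\<theta>)
qed

text \<open>Composition with a functional norming the value at \<theta> reduces the claim to the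
  scalar maximum principle. On the boundary lines the sum norm is at most the norm of
  \<open>A0\<close> or \<open>A1\<close>, hence at most \<open>F_norm\<close>; the 2 is the bound of
  the norming functional.\<close>

lemma F_space_sum_bound:
  assumes f: "f \<in> F_space A0 A1" and \<theta>: "0 < \<theta>" "\<theta> < 1"
  shows "f (of_real \<theta>) \<in> points (sum_space A0 A1)"
    "nrm (sum_space A0 A1) (f (of_real \<theta>)) \<le> 2 * F_norm A0 A1 f"
proof -
  obtain C where bdd_f: "\<And>z. z \<in> strip \<Longrightarrow> nrm (sum_space A0 A1) (f z) \<le> C"
    using F_space_bounded[OF f] by blast
  note * = bdd_f F_spaceD[OF f]
  have \<theta>_strip: "of_real \<theta> \<in> strip" using \<theta> by simp
  show mem: "f (of_real \<theta>) \<in> points (sum_space A0 A1)" by (rule continuous_on_intoD(1)[OF *(2) \<theta>_strip])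
  obtain \<psi> where \<psi>: "bounded_functional (sum_space A0 A1) \<psi>"
    "\<forall>x\<in>points (sum_space A0 A1). cmod (\<psi> x) \<le> 2 * nrm (sum_space A0 A1) x"
    "nrm (sum_space A0 A1) (f (of_real \<theta>)) \<le> cmod (\<psi> (f (of_real \<theta>)))"
    using sum.Hahn_Banach_norming[OF mem] .
  have scale: "\<psi> (c *\<^sub>C x) = c * \<psi> x" if "x \<in> points (sum_space A0 A1)" for c x
    using \<psi>(1) that by (auto simp: bounded_functional_def)
  have diff: "\<psi> (x - y) = \<psi> x - \<psi> y"
    if "x \<in> points (sum_space A0 A1)" "y \<in> points (sum_space A0 A1)" for x y
  proof -
    have "\<psi> (x + (-1) *\<^sub>C y) = \<psi> x + (-1) * \<psi> y"
      using \<psi>(1) that sum.scale_mem[OF that(2)] unfolding bounded_functional_def by simp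
    then show ?thesis by (simp add: scaleC_minus_one)
  qed
  have lim: "((\<lambda>w. \<psi> (g w)) \<longlongrightarrow> \<psi> l) F"
    if "tends_to_in (sum_space A0 A1) g l F" "\<forall>\<^sub>F w in F. g w \<in> points (sum_space A0 A1)"
      "l \<in> points (sum_space A0 A1)" for g l and F :: "complex filter"
  proof -
    have "((\<lambda>w. \<psi> (g w) - \<psi> l) \<longlongrightarrow> 0) F"
    proof (rule Lim_null_comparison)
      show "\<forall>\<^sub>F w in F. norm (\<psi> (g w) - \<psi> l) \<le> 2 * nrm (sum_space A0 A1) (g w - l)"
        using that(2) by eventually_elim (use \<psi>(2) that(3) in \<open>simp add: diff[symmetric] sum.diff_mem\<close>)
      show "((\<lambda>w. 2 * nrm (sum_space A0 A1) (g w - l)) \<longlongrightarrow> 0) F"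
        using tendsto_mult_right_zero[OF that(1)[unfolded tends_to_in_def]] .
    qed
    then show ?thesis by (simp add: LIM_zero_iff)
  qed
  have boundary: "cmod (\<psi> (f z)) \<le> 2 * F_norm A0 A1 f" if "Re z = 0 \<or> Re z = 1" for z
  proof -
    have z: "z \<in> strip" using that by auto
    have "nrm (sum_space A0 A1) (f z) \<le> F_norm A0 A1 f"
    proof (cases "Re z = 0")
      case True
      then have "z = Complex 0 (Im z)" by (simp add: complex_eq_iff)
      then show ?thesis
        using F_space_boundary(1,3)[OF f, of "Im z"] K_functional_le[OF _ _ A1.zero_mem, of 1 "f z"]
        by (simp add: nrm_sum_space)
    next
      case False
      then have "z = Complex 1 (Im z)" using that by (simp add: complex_eq_iff)
      then show ?thesis
        using F_space_boundary(2,4)[OF f, of "Im z"] K_functional_le[OF _ A0.zero_mem, of 1 "f z"]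
        by (simp add: nrm_sum_space)
    qed
    then show ?thesis using \<psi>(2) continuous_on_intoD(1)[OF *(2) z] by fastforce
  qed
  have "cmod (\<psi> (f (of_real \<theta>))) \<le> 2 * F_norm A0 A1 f"
  proof (rule strip_maximum_principle[where g = "\<lambda>z. \<psi> (f z)" and C = "2 * C"])
    show "continuous_on strip (\<lambda>z. \<psi> (f z))"
      unfolding continuous_on_def using continuous_on_intoD[OF *(2)] by (blast intro: lim)
    show "(\<lambda>z. \<psi> (f z)) holomorphic_on open_strip"
    proof (rule holomorphic_onI)
      fix z assume z: "z \<in> open_strip"
      obtain d where d: "f z \<in> points (sum_space A0 A1)" "d \<in> points (sum_space A0 A1)"
        "tends_to_in (sum_space A0 A1) (\<lambda>w. inverse (w - z) *\<^sub>C (f w - f z)) d (at z)"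
        "\<forall>\<^sub>F w in at z. f w \<in> points (sum_space A0 A1)"
        using analytic_intoE[OF *(3) z open_open_strip] .
      have "\<forall>\<^sub>F w in at z. inverse (w - z) *\<^sub>C (f w - f z) \<in> points (sum_space A0 A1)"
        using d(4) by eventually_elim (intro sum.scale_mem sum.diff_mem d(1))
      from lim[OF d(3) this d(2)]
      have "((\<lambda>w. (\<psi> (f w) - \<psi> (f z)) / (w - z)) \<longlongrightarrow> \<psi> d) (at z)"
      proof (rule Lim_transform_eventually)
        show "\<forall>\<^sub>F w in at z. \<psi> (inverse (w - z) *\<^sub>C (f w - f z)) = (\<psi> (f w) - \<psi> (f z)) / (w - z)"
          using d(4) by eventually_elim
            (simp add: scale sum.diff_mem d(1) diff divide_inverse mult.commute)
      qed
      then have "((\<lambda>z. \<psi> (f z)) has_field_derivative \<psi> d) (at z)"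
        by (simp add: has_field_derivative_iff)
      then show "(\<lambda>z. \<psi> (f z)) field_differentiable at z within open_strip"
        using field_differentiable_at_within field_differentiable_def by blast
    qed
    show "cmod (\<psi> (f z)) \<le> 2 * C" if z: "z \<in> strip" for z
      using \<psi>(2) continuous_on_intoD(1)[OF *(2) z] *(1)[OF z] by fastforce
  qed (use boundary \<theta>_strip in auto)
  with \<psi>(3) show "nrm (sum_space A0 A1) (f (of_real \<theta>)) \<le> 2 * F_norm A0 A1 f" by linarith
qed

lemma seminormed_complex_interp:
  assumes \<theta>: "0 < \<theta>" "\<theta> < 1"
  shows "seminormed (complex_interp A0 A1 \<theta>)"
proof -
  let ?X = "complex_interp A0 A1 \<theta>"
  have couple: "seminormed_couple A0 A1" by unfold_locales
  have zero: "0 \<in> points ?X \<and> nrm ?X 0 \<le> 0"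
  proof -
    \<comment> \<open>The zero vector satisfies the bounds of \<open>complex_interp_point\<close>
      with \<open>m0 = m1 = e\<close> for every positive \<open>e\<close>, so its norm is at most a
      fixed multiple of \<open>e\<close>.\<close>
    have "0 \<in> points ?X \<and> nrm ?X 0 \<le> exp 1 * e powr (1 - \<theta>) * e powr \<theta>" if "0 < e" for e
      using complex_interp_point[OF \<theta> A0.zero_mem A1.zero_mem that that] that by simp
    then have *: "0 \<in> points ?X \<and> nrm ?X 0 \<le> exp 1 * e" if "0 < e" for e
      using that by (simp add: mult.assoc flip: powr_add)
    have "nrm ?X 0 \<le> 0"
    proof (rule field_le_epsilon)
      fix e :: real assume "0 < e"
      then show "nrm ?X 0 \<le> 0 + e" using *[of "e / exp 1"] by simp
    qed
    then show ?thesis using *[of 1] by simp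
  qed
  have add: "x + y \<in> points ?X \<and> nrm ?X (x + y) \<le> nrm ?X x + nrm ?X y"
    if x: "x \<in> points ?X" and y: "y \<in> points ?X" for x y
  proof -
    have *: "x + y \<in> points ?X \<and> nrm ?X (x + y) \<le> nrm ?X x + nrm ?X y + e" if "0 < e" for e
    proof -
      have e: "0 < e / 2" using that by simp
      obtain f where f: "f \<in> F_space A0 A1" "f (of_real \<theta>) = x" "F_norm A0 A1 f < nrm ?X x + e / 2"
        using complex_interp_approx[OF x e] .
      obtain g where g: "g \<in> F_space A0 A1" "g (of_real \<theta>) = y" "F_norm A0 A1 g < nrm ?X y + e / 2"
        using complex_interp_approx[OF y e] .
      have "F_norm A0 A1 (\<lambda>z. f z + g z) \<le> F_norm A0 A1 f + F_norm A0 A1 g"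
        using F_space_boundary[OF f(1)] F_space_boundary[OF g(1)]
        by (intro F_norm_leI order_trans[OF A0.nrm_add] order_trans[OF A1.nrm_add] add_mono)
      moreover have "(\<lambda>z. f z + g z) (of_real \<theta>) = x + y" using f(2) g(2) by simp
      note complex_interp_nrm_le[OF F_space_add[OF f(1) g(1)] this]
      ultimately show ?thesis using f(3) g(3) by (auto simp: field_simps)
    qed
    have "nrm ?X (x + y) \<le> nrm ?X x + nrm ?X y" by (rule field_le_epsilon) (use * in blast)
    then show ?thesis using *[of 1] by simp
  qed
  have scale: "c *\<^sub>C x \<in> points ?X \<and> nrm ?X (c *\<^sub>C x) \<le> cmod c * nrm ?X x"
    if x: "x \<in> points ?X" for c x
  proof (cases "c = 0")
    case True
    then show ?thesis using zero by simp
  next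
    case False
    then have c: "cmod c powr (1 - \<theta>) * cmod c powr \<theta> = cmod c" "0 < cmod c"
      by (simp_all flip: powr_add)
    have "clinear_on (points (sum_space A0 A1)) (\<lambda>x. c *\<^sub>C x)"
      by (simp add: clinear_on_def scaleC_add_right scaleC_scaleC mult.commute)
    from complex_interp_operator[OF couple this c(2) c(2) _ _ x]
    show ?thesis
      unfolding c(1) using A0.scale_mem A1.scale_mem A0.nrm_scale A1.nrm_scale by simp
  qed
  show ?thesis
    using zero add scale complex_interp_nrm_nonneg by unfold_locales blast+
qed

text \<open>The bound at \<theta> in the sum norm is one in \<open>A0\<close>, because
  \<open>A1\<close> lies in \<open>A0\<close>. The slack \<open>e\<close> pays for the choice of a
  nearly optimal function.\<close>

lemma complex_interp_imbedded_endpoint: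
  assumes im: "continuously_imbedded A1 A0" and \<theta>: "0 < \<theta>" "\<theta> < 1"
  shows "continuously_imbedded (complex_interp A0 A1 \<theta>) A0"
proof -
  obtain C where C: "1 \<le> C" "\<And>x. x \<in> points A1 \<Longrightarrow> x \<in> points A0 \<and> nrm A0 x \<le> C * nrm A1 x"
    using continuously_imbeddedE[OF A1.seminormed_axioms im] by blast
  have "a \<in> points A0 \<and> nrm A0 a \<le> 2 * C * nrm (complex_interp A0 A1 \<theta>) a"
    if a: "a \<in> points (complex_interp A0 A1 \<theta>)" for a
  proof -
    have *: "a \<in> points A0 \<and> nrm A0 a \<le> 2 * C * (nrm (complex_interp A0 A1 \<theta>) a + e)" if e: "0 < e" for e
    proof -
      obtain f where f: "f \<in> F_space A0 A1" "f (of_real \<theta>) = a"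
        "F_norm A0 A1 f < nrm (complex_interp A0 A1 \<theta>) a + e"
        using complex_interp_approx[OF a e] .
      note bound = F_space_sum_bound[OF f(1) \<theta>, unfolded f(2)]
      have "nrm A0 a \<le> C * nrm (sum_space A0 A1) a"
        using nrm0_le_sum(2)[OF C bound(1) order_refl] by (simp add: nrm_sum_space)
      also have "\<dots> \<le> C * (2 * (nrm (complex_interp A0 A1 \<theta>) a + e))"
        using bound(2) f(3) C(1) by (intro mult_left_mono) auto
      finally show ?thesis using nrm0_le_sum(1)[OF C bound(1) order_refl] by (simp add: mult_ac)
    qed
    have "nrm A0 a \<le> 2 * C * nrm (complex_interp A0 A1 \<theta>) a"
    proof (rule field_le_epsilon)
      fix e :: real assume e: "0 < e"
      show "nrm A0 a \<le> 2 * C * nrm (complex_interp A0 A1 \<theta>) a + e"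
        using *[of "e / (2 * C)"] e C(1) by (simp add: distrib_left)
    qed
    then show ?thesis using *[of 1] by simp
  qed
  then show ?thesis unfolding continuously_imbedded_def by blast
qed

end

lemma interpolation_method_complex:
  assumes \<theta>: "0 < \<theta>" "\<theta> < 1"
  shows "interpolation_method (\<lambda>A0 A1. complex_interp (A0 :: ('v::complex_tvs) nspace) A1 \<theta>) \<theta>"
proof (rule interpolation_method.intro, goal_cases)
  case (3 A0 A1)
  then show ?case using \<theta> by (rule seminormed_couple.seminormed_complex_interp)
next
  case (4 A0 A1)
  then show ?case using \<theta> by (rule seminormed_couple.complex_interp_imbedded_endpoint)
next
  case (5 A0 A1 B0 B1 T C0 C1 a)
  from 5(1) show ?case
    by (rule seminormed_couple.complex_interp_operator[OF _ 5(2-5) 5(6) 5(7) 5(8)])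
next
  case (6 A0 A1)
  show ?case
    by (rule exI[of _ "exp 1"]) (use seminormed_couple.complex_interp_point[OF 6 \<theta>] in simp)
qed (use \<theta> in auto)

section \<open>Cocompactness\<close>

lemma bounded_functional_zero: "seminormed X \<Longrightarrow> bounded_functional X \<phi> \<Longrightarrow> \<phi> 0 = 0"
  using seminormed.zero_mem unfolding bounded_functional_def
  by (metis mult_zero_left scaleC_zero_left)

lemma clinear_on_zero: "0 \<in> S \<Longrightarrow> clinear_on S T \<Longrightarrow> T 0 = 0"
  unfolding clinear_on_def by (metis scaleC_zero_left)

text \<open>Boundedness of the operator makes \<open>opnorm\<close> the supremum of a bounded set,
  to which \<open>x\<close> contributes after normalisation. A point of norm 0 cannot be normalised,
  but any boundedness constant shows that its image has norm at most 0.\<close>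

lemma nrm_le_opnorm:
  assumes X: "seminormed X" and Y: "seminormed Y" and T: "bounded_operator X Y T" and x: "x \<in> points X"
  shows "nrm Y (T x) \<le> opnorm X Y T * nrm X x"
proof -
  interpret X: seminormed X by (rule X)
  interpret Y: seminormed Y by (rule Y)
  obtain C where C: "\<And>x. x \<in> points X \<Longrightarrow> nrm Y (T x) \<le> C * nrm X x"
    and lin: "clinear_on (points X) T" and map: "\<And>x. x \<in> points X \<Longrightarrow> T x \<in> points Y"
    using T unfolding bounded_operator_def by blast
  show ?thesis
  proof (cases "nrm X x = 0")
    case True
    then show ?thesis using C[OF x] by simp
  next
    case False
    then have n: "0 < nrm X x" using X.nrm_nonneg[OF x] by simp
    define c where "c = complex_of_real (inverse (nrm X x))"
    have c: "cmod c = inverse (nrm X x)" using n by (simp add: c_def del: of_real_inverse)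
    have "nrm Y (T z) \<le> max C 0" if "z \<in> points X" "nrm X z \<le> 1" for z
    proof -
      have "C * nrm X z \<le> max C 0 * nrm X z" using X.nrm_nonneg[OF that(1)] by (intro mult_right_mono) auto
      also have "\<dots> \<le> max C 0 * 1" using that by (intro mult_left_mono) auto
      finally show ?thesis using C[OF that(1)] by simp
    qed
    then have "bdd_above ((\<lambda>z. nrm Y (T z)) ` {z \<in> points X. nrm X z \<le> 1})"
      by (intro bdd_aboveI2[where M = "max C 0"]) auto
    moreover have "c *\<^sub>C x \<in> {z \<in> points X. nrm X z \<le> 1}"
      using x n c by (simp add: X.scale_mem X.nrm_scale)
    ultimately have "nrm Y (T (c *\<^sub>C x)) \<le> opnorm X Y T"
      unfolding opnorm_def by (intro cSUP_upper)
    moreover have "T (c *\<^sub>C x) = c *\<^sub>C T x" using lin x by (simp add: clinear_on_def)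
    ultimately show ?thesis using n c by (simp add: Y.nrm_scale[OF map[OF x]] field_simps)
  qed
qed

text \<open>The restrictions form a group since the inverse of a member of \<open>D\<close> is again
  in \<open>D\<close> and leaves \<open>points X\<close> invariant too; injectivity and invariance
  of a single \<open>g\<close> would not give surjectivity.\<close>

lemma acts_on_invariant:
  assumes D: "subgroup D (BijGroup S)" and lin: "\<And>g. g \<in> D \<Longrightarrow> clinear_on S g"
    and P: "points X \<subseteq> S"
    and inv: "\<And>g x. g \<in> D \<Longrightarrow> x \<in> points X \<Longrightarrow> g x \<in> points X \<and> nrm X (g x) \<le> nrm X x"
  shows "acts_on D X"
proof -
  let ?P = "points X"
  interpret D: subgroup D "BijGroup S" by (rule D)
  interpret GS: group "BijGroup S" by (rule group_BijGroup)
  interpret GP: group "BijGroup ?P" by (rule group_BijGroup)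
  have Bij: "g \<in> Bij S" if "g \<in> D" for g using D.subset that by (auto simp: BijGroup_def)
  have mult: "compose S g h \<in> D" if "g \<in> D" "h \<in> D" for g h
    using D.m_closed[OF that] Bij[OF that(1)] Bij[OF that(2)] by (simp add: BijGroup_def)
  have inverse: "\<exists>h\<in>D. \<forall>x\<in>S. h (g x) = x \<and> g (h x) = x" if g: "g \<in> D" for g
  proof
    let ?h = "inv\<^bsub>BijGroup S\<^esub> g"
    show h: "?h \<in> D" using g by (rule D.m_inv_closed)
    have "compose S ?h g = (\<lambda>x\<in>S. x)" "compose S g ?h = (\<lambda>x\<in>S. x)"
      using GS.l_inv[of g] GS.r_inv[of g] D.subset g Bij[OF g] Bij[OF h] by (auto simp: BijGroup_def)
    then show "\<forall>x\<in>S. ?h (g x) = x \<and> g (?h x) = x"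
      unfolding compose_def by (metis restrict_apply')
  qed
  have Bij_restrict: "restrict g ?P \<in> Bij ?P" if g: "g \<in> D" for g
  proof -
    obtain h where h: "h \<in> D" "\<forall>x\<in>S. h (g x) = x \<and> g (h x) = x" using inverse[OF g] by blast
    \<comment> \<open>The inverse \<open>h\<close> on \<open>S\<close> is the witness; it maps
      \<open>points X\<close> to itself because the invariance assumption applies to it as
      well.\<close>
    have "bij_betw g ?P ?P"
      using h P inv[OF g] inv[OF h(1)] by (intro bij_betw_byWitness[where f' = h]) auto
    then show ?thesis by (simp add: Bij_def)
  qed
  have "subgroup ((\<lambda>g. restrict g ?P) ` D) (BijGroup ?P)"
  proof (rule GP.subgroupI)
    show "(\<lambda>g. restrict g ?P) ` D \<subseteq> carrier (BijGroup ?P)"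
      using Bij_restrict by (auto simp: BijGroup_def)
    show "(\<lambda>g. restrict g ?P) ` D \<noteq> {}" using D.one_closed by blast
  next
    fix a assume "a \<in> (\<lambda>g. restrict g ?P) ` D"
    then obtain g where g: "g \<in> D" "a = restrict g ?P" by blast
    obtain h where h: "h \<in> D" "\<forall>x\<in>S. h (g x) = x \<and> g (h x) = x" using inverse[OF g(1)] by blast
    have "inv\<^bsub>BijGroup ?P\<^esub> a = restrict h ?P"
    proof (rule GP.inv_equality)
      show "restrict h ?P \<otimes>\<^bsub>BijGroup ?P\<^esub> a = \<one>\<^bsub>BijGroup ?P\<^esub>"
        using Bij_restrict[OF g(1)] Bij_restrict[OF h(1)] h(2) P inv[OF g(1)]
        by (auto simp: BijGroup_def g(2) compose_def fun_eq_iff restrict_def)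
    qed (use Bij_restrict[OF g(1)] Bij_restrict[OF h(1)] in \<open>auto simp: BijGroup_def g(2)\<close>)
    then show "inv\<^bsub>BijGroup ?P\<^esub> a \<in> (\<lambda>g. restrict g ?P) ` D" using h(1) by blast
  next
    fix a b assume "a \<in> (\<lambda>g. restrict g ?P) ` D" "b \<in> (\<lambda>g. restrict g ?P) ` D"
    then obtain g h where g: "g \<in> D" "a = restrict g ?P" and h: "h \<in> D" "b = restrict h ?P" by blast
    have "a \<otimes>\<^bsub>BijGroup ?P\<^esub> b = restrict (compose S g h) ?P"
      using Bij_restrict[OF g(1)] Bij_restrict[OF h(1)] P inv[OF h(1)]
      by (auto simp: BijGroup_def g(2) h(2) compose_def fun_eq_iff restrict_def)
    then show "a \<otimes>\<^bsub>BijGroup ?P\<^esub> b \<in> (\<lambda>g. restrict g ?P) ` D" using mult[OF g(1) h(1)] by blast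
  qed
  moreover have "bounded_operator X X g" if g: "g \<in> D" for g
    unfolding bounded_operator_def
  proof (intro conjI exI ballI)
    show "g \<in> ?P \<rightarrow> ?P" using inv[OF g] by blast
    show "clinear_on ?P g" using lin[OF g] P unfolding clinear_on_def by blast
    show "nrm X (g x) \<le> 1 * nrm X x" if "x \<in> ?P" for x using inv[OF g that] by simp
  qed
  ultimately show ?thesis unfolding acts_on_def by blast
qed

text \<open>The limit in \<open>Y\<close> provided by cocompactness is zero, since interleaving the sequence with zeros
  preserves \<open>D\<close>-weak convergence.\<close>

lemma cocompact_tends_to_zero:
  assumes X: "seminormed X" and Y: "seminormed Y" and coc: "cocompactly_imbedded D X Y"
    and zero: "\<And>g. g \<in> D \<Longrightarrow> g 0 = 0" and w: "D_weakly_convergent_to D X w 0"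
  shows "(\<lambda>k. nrm Y (w k)) \<longlonglongrightarrow> 0"
proof -
  interpret X: seminormed X by (rule X)
  interpret Y: seminormed Y by (rule Y)
  have XY: "points X \<subseteq> points Y"
    using coc unfolding cocompactly_imbedded_def continuously_imbedded_def by blast
  have wX: "w k \<in> points X" for k using w by (simp add: D_weakly_convergent_to_def)
  \<comment> \<open>The zeros are inserted in place, without renumbering, so each \<open>g k\<close>
    still acts on the original term or on 0.\<close>
  have part: "(\<lambda>k. nrm Y (if P k then w k else 0)) \<longlonglongrightarrow> 0" if P: "\<exists>\<^sub>F k in sequentially. \<not> P k" for P
  proof -
    let ?w = "\<lambda>k. if P k then w k else 0"
    have "D_weakly_convergent_to D X ?w 0"
      unfolding D_weakly_convergent_to_def
    proof (intro conjI allI impI X.zero_mem)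
      fix k show "?w k \<in> points X" using wX X.zero_mem by simp
    next
      fix g :: "nat \<Rightarrow> _" assume g: "\<forall>k. g k \<in> D"
      have weak: "weakly_convergent_to X (\<lambda>k. g k (w k - 0)) 0"
        using w g unfolding D_weakly_convergent_to_def by blast
      show "weakly_convergent_to X (\<lambda>k. g k (?w k - 0)) 0"
        unfolding weakly_convergent_to_def
      proof (intro conjI allI impI X.zero_mem)
        fix k show "g k (?w k - 0) \<in> points X"
          using weak zero[OF g[rule_format]] X.zero_mem unfolding weakly_convergent_to_def by simp
      next
        fix \<phi> assume \<phi>: "bounded_functional X \<phi>"
        note \<phi>0 = bounded_functional_zero[OF X \<phi>]
        have lim: "(\<lambda>k. \<phi> (g k (w k - 0))) \<longlonglongrightarrow> 0"
          using weak \<phi> \<phi>0 unfolding weakly_convergent_to_def by metis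
        have "(\<lambda>k. \<phi> (g k (?w k - 0))) \<longlonglongrightarrow> 0"
        proof (rule Lim_null_comparison)
          show "\<forall>\<^sub>F k in sequentially. norm (\<phi> (g k (?w k - 0))) \<le> norm (\<phi> (g k (w k - 0)))"
            using zero[OF g[rule_format]] \<phi>0 by (intro always_eventually) simp
        qed (use tendsto_norm_zero[OF lim] in simp)
        then show "(\<lambda>k. \<phi> (g k (?w k - 0))) \<longlonglongrightarrow> \<phi> 0" unfolding \<phi>0 .
      qed
    qed
    then obtain l where l: "l \<in> points Y" "tends_to_in Y ?w l sequentially"
      using coc unfolding cocompactly_imbedded_def by blast
    \<comment> \<open>At the infinitely many indices where the modified sequence is 0, its distance
      to \<open>l\<close> equals \<open>nrm Y l\<close>, which must therefore vanish.\<close>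
    have "nrm Y l = 0"
    proof (rule ccontr)
      assume "nrm Y l \<noteq> 0"
      then have "0 < nrm Y l" using Y.nrm_nonneg[OF l(1)] by simp
      then have "\<forall>\<^sub>F k in sequentially. nrm Y (?w k - l) < nrm Y l"
        using l(2) unfolding tends_to_in_def by (intro order_tendstoD)
      from frequently_eventually_frequently[OF P this] obtain k where "\<not> P k" "nrm Y (?w k - l) < nrm Y l"
        by (auto dest: frequently_ex)
      then show False using Y.nrm_minus[OF l(1)] by simp
    qed
    moreover have "(\<lambda>k. nrm Y (?w k)) \<longlonglongrightarrow> nrm Y l"
      using wX XY Y.zero_mem by (intro Y.tends_to_in_nrm[OF l(2) _ l(1)]) (auto intro!: always_eventually)
    ultimately show ?thesis by simp
  qed
  \<comment> \<open>Even and odd indices together exhaust the sequence, and each of the two parts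
    has infinitely many zeros.\<close>
  have "\<exists>\<^sub>F k in sequentially. \<not> even k" "\<exists>\<^sub>F k in sequentially. \<not> odd k"
    unfolding frequently_sequentially by (metis even_Suc le_Suc_eq order_refl)+
  from tendsto_add[OF part[OF this(1)] part[OF this(2)]]
  have "(\<lambda>k. nrm Y (if even k then w k else 0) + nrm Y (if odd k then w k else 0)) \<longlonglongrightarrow> 0" by simp
  also have "(\<lambda>k. nrm Y (if even k then w k else 0) + nrm Y (if odd k then w k else 0)) = (\<lambda>k. nrm Y (w k))"
    by auto
  finally show ?thesis .
qed

lemma powr_solution:
  fixes c e \<theta> :: real
  assumes "0 < c" "0 < e" "0 < \<theta>"
  obtains d where "0 < d" "c * d powr \<theta> = e"
proof
  show "0 < (e / c) powr (1 / \<theta>)" "c * ((e / c) powr (1 / \<theta>)) powr \<theta> = e"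
    using assms by (simp_all add: powr_powr)
qed

theorem (in interpolation_method) cocompactly_imbedded_interp:
  fixes A0 A1 B0 B1 :: "'v nspace" and D :: "('v \<Rightarrow> 'v) set"
  assumes A: "seminormed_couple A0 A1" and B: "seminormed_couple B0 B1"
    and A0B0: "continuously_imbedded A0 B0" and A1B1: "continuously_imbedded A1 B1"
    and A1A0: "continuously_imbedded A1 A0"
    and D: "subgroup D (BijGroup (points (sum_space B0 B1)))"
    and lin: "\<And>g. g \<in> D \<Longrightarrow> clinear_on (points (sum_space B0 B1)) g"
    and iso: "\<And>g. g \<in> D \<Longrightarrow> isometry_on A0 g \<and> isometry_on A1 g"
    and M: "covariant_mollifiers D A0 A1 B1 M"
    and coc: "cocompactly_imbedded D A1 B1"
  shows "cocompactly_imbedded D (\<Phi> A0 A1) (\<Phi> B0 B1)"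
proof -
  interpret A: seminormed_couple A0 A1 by (rule A)
  interpret B: seminormed_couple B0 B1 by (rule B)
  define X where "X = \<Phi> A0 A1"
  define Y where "Y = \<Phi> B0 B1"
  interpret X: seminormed X unfolding X_def by (rule seminormed_interp[OF A])
  interpret Y: seminormed Y unfolding Y_def by (rule seminormed_interp[OF B])
  let ?S = "points (sum_space B0 B1)"

  \<comment> \<open>Imbedding constants and the action of \<open>D\<close> on
    \<open>X\<close>\<close>
  obtain c0 where c0: "1 \<le> c0" "\<And>x. x \<in> points A0 \<Longrightarrow> x \<in> points B0 \<and> nrm B0 x \<le> c0 * nrm A0 x"
    using continuously_imbeddedE[OF A.A0.seminormed_axioms A0B0] by blast
  obtain c1 where c1: "1 \<le> c1" "\<And>x. x \<in> points A1 \<Longrightarrow> x \<in> points B1 \<and> nrm B1 x \<le> c1 * nrm A1 x"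
    using continuously_imbeddedE[OF A.A1.seminormed_axioms A1B1] by blast
  obtain c where c: "1 \<le> c" "\<And>x. x \<in> points A1 \<Longrightarrow> x \<in> points A0 \<and> nrm A0 x \<le> c * nrm A1 x"
    using continuously_imbeddedE[OF A.A1.seminormed_axioms A1A0] by blast
  obtain cX where cX: "1 \<le> cX" "\<And>x. x \<in> points X \<Longrightarrow> x \<in> points A0 \<and> nrm A0 x \<le> cX * nrm X x"
    using continuously_imbeddedE[OF X.seminormed_axioms imbedded_endpoint[OF A A1A0, folded X_def]] by blast
  have sumA: "points (sum_space A0 A1) = points A0"
    using A.nrm0_le_sum(1)[OF c _ order_refl] A.points0_le by blast
  have A0S: "points A0 \<subseteq> ?S" using c0(2) B.points0_le by blast
  have XA0: "points X \<subseteq> points A0" using cX by blast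
  have XY: "continuously_imbedded X Y"
  proof -
    have "x \<in> points Y \<and> nrm Y x \<le> c0 powr (1 - \<theta>) * c1 powr \<theta> * nrm X x" if "x \<in> points X" for x
      unfolding X_def Y_def
      \<comment> \<open>The imbedding of the interpolation spaces is the identity operator,
        interpolated between the two given imbeddings.\<close>
      by (rule interpolate_operator[OF A B, where T = "\<lambda>x. x"])
         (use that c0 c1 in \<open>auto simp: clinear_on_def X_def\<close>)
    then show ?thesis unfolding continuously_imbedded_def by blast
  qed
  have g0: "g 0 = 0" if "g \<in> D" for g by (rule clinear_on_zero[OF B.sum.zero_mem lin[OF that]])
  \<comment> \<open>\<open>isometry_on\<close> speaks of distances; comparing with the fixed point 0
    turns it into a statement on norms.\<close>
  have gA0: "g x \<in> points A0 \<and> nrm A0 (g x) \<le> 1 * nrm A0 x" if "g \<in> D" "x \<in> points A0" for g x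
    using iso[OF that(1)] that(2) A.A0.zero_mem g0[OF that(1)] unfolding isometry_on_def
    by (metis diff_0_right image_subset_iff mult_1 order_refl)
  have gA1: "g x \<in> points A1 \<and> nrm A1 (g x) \<le> 1 * nrm A1 x" if "g \<in> D" "x \<in> points A1" for g x
    using iso[OF that(1)] that(2) A.A1.zero_mem g0[OF that(1)] unfolding isometry_on_def
    by (metis diff_0_right image_subset_iff mult_1 order_refl)
  have gX: "g x \<in> points X \<and> nrm X (g x) \<le> nrm X x" if g: "g \<in> D" and x: "x \<in> points X" for g x
  proof -
    have "clinear_on (points (sum_space A0 A1)) g"
      using lin[OF g] A0S unfolding sumA clinear_on_def by blast
    \<comment> \<open>The bound 1 on both endpoint spaces interpolates to the bound 1 on
      \<open>X\<close>.\<close>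
    from interpolate_operator[OF A A this _ _ gA0[OF g] gA1[OF g] x[unfolded X_def]]
    show ?thesis by (simp add: X_def)
  qed
  have act: "acts_on D X" by (rule acts_on_invariant[OF D lin]) (use XA0 A0S gX in blast)+

  \<comment> \<open>Bounds for the mollifiers and smallness of the remainder\<close>
  have mol: "bounded_operator A0 A1 (M t)" if "0 < t" "t < 1" for t
    using M that by (simp add: covariant_mollifiers_def)
  have Mlin: "clinear_on (points A0) (M t)" if "0 < t" "t < 1" for t
    using mol[OF that] by (simp add: bounded_operator_def)
  \<comment> \<open>Here the constant may depend on \<open>t\<close>. Uniformity in \<open>t\<close>
    is available only for the norms from \<open>A0\<close> to itself and from \<open>A1\<close> to
    itself.\<close>
  have Mbound: "\<exists>m\<ge>0. \<forall>x\<in>points A0. M t x \<in> points A1 \<and> nrm A1 (M t x) \<le> m * nrm A0 x"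
    if t: "0 < t" "t < 1" for t
  proof -
    obtain m where m: "\<And>x. x \<in> points A0 \<Longrightarrow> M t x \<in> points A1 \<and> nrm A1 (M t x) \<le> m * nrm A0 x"
      using mol[OF t] unfolding bounded_operator_def by blast
    have "m * nrm A0 x \<le> max 0 m * nrm A0 x" if "x \<in> points A0" for x
      using A.A0.nrm_nonneg[OF that] by (intro mult_right_mono) auto
    then have "\<forall>x\<in>points A0. M t x \<in> points A1 \<and> nrm A1 (M t x) \<le> max 0 m * nrm A0 x"
      using m by (blast intro: order_trans)
    then show ?thesis by (meson max.cobounded1)
  qed
  obtain K where K: "\<And>t. 0 < t \<Longrightarrow> t < 1 \<Longrightarrow> opnorm A0 A0 (M t) \<le> K"
  proof -
    have "bdd_above ((\<lambda>t. opnorm A0 A0 (M t)) ` {0<..<1})" using M by (simp add: covariant_mollifiers_def)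
    then obtain K where "\<And>t. t \<in> {0<..<1} \<Longrightarrow> opnorm A0 A0 (M t) \<le> K"
      unfolding bdd_above_def by blast
    then show ?thesis using that[of K] by simp
  qed
  define K0 where "K0 = max K 1"
  have MA0: "M t x \<in> points A0 \<and> nrm A0 (M t x) \<le> K0 * nrm A0 x"
    if t: "0 < t" "t < 1" and x: "x \<in> points A0" for t x
  proof -
    obtain m where m: "0 \<le> m" "\<forall>x\<in>points A0. M t x \<in> points A1 \<and> nrm A1 (M t x) \<le> m * nrm A0 x"
      using Mbound[OF t] by blast
    \<comment> \<open>This qualitative bound makes \<open>M t\<close> a bounded operator of
      \<open>A0\<close>, after which the uniform estimate of \<open>opnorm\<close> applies to
      points.\<close>
    have "nrm A0 (M t x) \<le> (c * m) * nrm A0 x" if "x \<in> points A0" for x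
    proof -
      have "nrm A0 (M t x) \<le> c * nrm A1 (M t x)" using c(2) m(2) that by blast
      also have "\<dots> \<le> c * (m * nrm A0 x)" using m(2) that c(1) by (intro mult_left_mono) auto
      finally show ?thesis by (simp add: mult.assoc)
    qed
    then have "bounded_operator A0 A0 (M t)"
      using m(2) c(2) Mlin[OF t] unfolding bounded_operator_def by blast
    from nrm_le_opnorm[OF A.A0.seminormed_axioms A.A0.seminormed_axioms this x]
    have "nrm A0 (M t x) \<le> opnorm A0 A0 (M t) * nrm A0 x" .
    also have "\<dots> \<le> K0 * nrm A0 x"
      using K[OF t] A.A0.nrm_nonneg[OF x] by (intro mult_right_mono) (auto simp: K0_def)
    finally show ?thesis using m(2) c(2) x by blast
  qed
  have approx: "\<exists>t. 0 < t \<and> t < 1 \<and> (\<forall>x\<in>points X. x - M t x \<in> points Y \<and> nrm Y (x - M t x) \<le> e * nrm X x)"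
    if e: "0 < e" for e
  proof -
    \<comment> \<open>A bound for \<open>I - M t\<close> from \<open>A0\<close> to \<open>B0\<close>
      that is independent of \<open>t\<close>; hence \<open>d\<close> can be fixed first and
      \<open>t\<close> chosen afterwards to push the norm from \<open>A1\<close> to
      \<open>B1\<close> below \<open>d\<close>.\<close>
    define C0 where "C0 = c0 * (1 + K0)"
    have C0: "0 < C0" using c0(1) by (simp add: C0_def K0_def)
    then have "0 < C0 powr (1 - \<theta>)" by simp
    then obtain d where d: "0 < d" "C0 powr (1 - \<theta>) * d powr \<theta> = e"
      using powr_solution e exponent(1) by metis
    have "((\<lambda>t. opnorm A1 B1 (\<lambda>x. x - M t x)) \<longlongrightarrow> 0) (at_right 0)"
      using M by (simp add: covariant_mollifiers_def)
    then have "\<forall>\<^sub>F t in at_right 0. opnorm A1 B1 (\<lambda>x. x - M t x) < d"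
      using d(1) by (rule order_tendstoD)
    moreover have "\<forall>\<^sub>F t in at_right 0. 0 < t \<and> t < (1::real)"
      by (rule eventually_at_rightI[of 0 1]) auto
    ultimately have "\<forall>\<^sub>F t in at_right 0. opnorm A1 B1 (\<lambda>x. x - M t x) < d \<and> 0 < t \<and> t < 1"
      by (rule eventually_conj)
    then obtain t where t: "0 < t" "t < 1" and op: "opnorm A1 B1 (\<lambda>x. x - M t x) < d"
      using eventually_happens'[OF trivial_limit_at_right_real] by blast
    let ?T = "\<lambda>x. x - M t x"
    have linT: "clinear_on (points A0) ?T"
      using Mlin[OF t] by (simp add: clinear_on_def scaleC_diff_right)
    have T0: "?T x \<in> points B0 \<and> nrm B0 (?T x) \<le> C0 * nrm A0 x" if x: "x \<in> points A0" for x
    proof -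
      note Mx = MA0[OF t x]
      have "nrm B0 (?T x) \<le> c0 * nrm A0 (?T x)" using c0(2) A.A0.diff_mem[OF x] Mx by blast
      also have "\<dots> \<le> c0 * (nrm A0 x + K0 * nrm A0 x)"
        using A.A0.nrm_diff[OF x conjunct1[OF Mx]] Mx c0(1) by (intro mult_left_mono) auto
      finally show ?thesis using c0(2) A.A0.diff_mem[OF x] Mx by (simp add: C0_def algebra_simps)
    qed
    obtain m where m: "0 \<le> m" "\<forall>x\<in>points A0. M t x \<in> points A1 \<and> nrm A1 (M t x) \<le> m * nrm A0 x"
      using Mbound[OF t] by blast
    \<comment> \<open>Required before smallness of \<open>opnorm\<close>, a real supremum, says
      anything about individual points.\<close>
    have "bounded_operator A1 B1 ?T"
      unfolding bounded_operator_def
    proof (intro conjI exI ballI)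
      show "clinear_on (points A1) ?T" using linT c(2) unfolding clinear_on_def by blast
      have mem: "?T x \<in> points A1" if "x \<in> points A1" for x
        using m(2) c(2) that by (intro A.A1.diff_mem) auto
      then show "?T \<in> points A1 \<rightarrow> points B1" using c1(2) by blast
      fix x assume x: "x \<in> points A1"
      then have xA0: "x \<in> points A0" using c(2) by blast
      have "nrm B1 (?T x) \<le> c1 * nrm A1 (?T x)" using c1(2) mem[OF x] by blast
      also have "nrm A1 (?T x) \<le> nrm A1 x + m * (c * nrm A1 x)"
      proof -
        have "nrm A1 (?T x) \<le> nrm A1 x + nrm A1 (M t x)" using m(2) xA0 by (intro A.A1.nrm_diff x) auto
        also have "nrm A1 (M t x) \<le> m * nrm A0 x" using m(2) xA0 by blast
        also have "m * nrm A0 x \<le> m * (c * nrm A1 x)" using c(2)[OF x] m(1) by (intro mult_left_mono) auto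
        finally show ?thesis by simp
      qed
      finally show "nrm B1 (?T x) \<le> (c1 * (1 + m * c)) * nrm A1 x"
        using c1(1) by (simp add: algebra_simps)
    qed
    note T_bounded = this
    have T1: "?T x \<in> points B1 \<and> nrm B1 (?T x) \<le> d * nrm A1 x" if x: "x \<in> points A1" for x
    proof -
      have "nrm B1 (?T x) \<le> opnorm A1 B1 ?T * nrm A1 x"
        by (rule nrm_le_opnorm[OF A.A1.seminormed_axioms B.A1.seminormed_axioms T_bounded x])
      also have "\<dots> \<le> d * nrm A1 x" using op A.A1.nrm_nonneg[OF x] by (intro mult_right_mono) auto
      finally show ?thesis using T_bounded x unfolding bounded_operator_def by blast
    qed
    have "?T x \<in> points Y \<and> nrm Y (?T x) \<le> e * nrm X x" if "x \<in> points X" for x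
      using interpolate_operator[OF A B _ C0 d(1) T0 T1, of x] linT that sumA d(2)
      by (simp add: X_def Y_def)
    then show ?thesis using t by blast
  qed

  \<comment> \<open>Convergence of a \<open>D\<close>-weakly convergent sequence\<close>
  have "\<exists>l\<in>points Y. tends_to_in Y u l sequentially" if u: "D_weakly_convergent_to D X u l" for u l
  proof
    have uX: "u k \<in> points X" for k using u unfolding D_weakly_convergent_to_def by auto
    have lX: "l \<in> points X" using u unfolding D_weakly_convergent_to_def by auto
    then show lY: "l \<in> points Y" using XY unfolding continuously_imbedded_def by blast
    define v where "v = (\<lambda>k. u k - l)"
    have vX: "v k \<in> points X" for k unfolding v_def by (rule X.diff_mem[OF uX lX])
    have weak: "weakly_convergent_to X (\<lambda>k. g k (v k)) 0" if "\<forall>k. g k \<in> D" for g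
      using u that unfolding D_weakly_convergent_to_def v_def by blast
    \<comment> \<open>The identity of the group, extended by \<open>undefined\<close> off the sum
      space, is a member of \<open>D\<close>; so \<open>D\<close>-weak convergence contains ordinary
      weak convergence, and with it boundedness.\<close>
    have "(\<lambda>x\<in>?S. x) \<in> D" using subgroup.one_closed[OF D] by (simp add: BijGroup_def)
    from weak[of "\<lambda>k. \<lambda>x\<in>?S. x"] this have "weakly_convergent_to X v 0"
      using vX XA0 A0S by (simp add: subset_iff)
    then have wb: "bounded (range (\<lambda>k. \<phi> (v k)))" if "bounded_functional X \<phi>" for \<phi>
      using that convergent_imp_bounded unfolding weakly_convergent_to_def by blast
    then obtain N' where N': "\<And>k. nrm X (v k) \<le> N'" using X.weakly_bounded_imp_bounded[of v, OF vX wb] by blast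
    define N where "N = max N' 1"
    have N: "0 < N" "\<And>k. nrm X (v k) \<le> N" using N' by (auto simp: N_def intro: max.coboundedI1)

    have w_weak: "D_weakly_convergent_to D A1 (\<lambda>k. M t (v k)) 0" if t: "0 < t" "t < 1" for t
      unfolding D_weakly_convergent_to_def
    proof (intro conjI allI impI A.A1.zero_mem)
      obtain m where m: "0 \<le> m" "\<forall>x\<in>points A0. M t x \<in> points A1 \<and> nrm A1 (M t x) \<le> m * nrm A0 x"
        using Mbound[OF t] by blast
      show MvA1: "M t (v k) \<in> points A1" for k using m(2) vX XA0 by blast
      fix g :: "nat \<Rightarrow> 'v \<Rightarrow> 'v" assume g: "\<forall>k. g k \<in> D"
      \<comment> \<open>With \<open>t\<close> fixed, covariance is applied to each
        \<open>g k\<close> separately; the resulting \<open>h k\<close> form another admissible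
        sequence to test \<open>v\<close> against.\<close>
      have "\<forall>k. \<exists>h\<in>D. \<forall>x\<in>points A0. g k (M t x) = M t (h x)"
        using M g t unfolding covariant_mollifiers_def by auto
      then obtain h where h: "\<And>k. h k \<in> D" "\<And>k x. x \<in> points A0 \<Longrightarrow> g k (M t x) = M t (h k x)" by metis
      have eq: "g k (M t (v k) - 0) = M t (h k (v k))" for k using h(2) vX XA0 by auto
      show "weakly_convergent_to A1 (\<lambda>k. g k (M t (v k) - 0)) 0"
        unfolding weakly_convergent_to_def
      proof (intro conjI allI impI A.A1.zero_mem)
        show "g k (M t (v k) - 0) \<in> points A1" for k using gA1 MvA1 g by simp
        fix \<phi> assume \<phi>: "bounded_functional A1 \<phi>"
        then obtain C where C: "\<And>x. x \<in> points A1 \<Longrightarrow> cmod (\<phi> x) \<le> C * nrm A1 x"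
          unfolding bounded_functional_def by blast
        have MA1: "M t x \<in> points A1" if "x \<in> points X" for x using m(2) XA0 that by blast
        \<comment> \<open>The functional is pulled back along the bounded maps from \<open>X\<close>
          into \<open>A0\<close> and, by \<open>M t\<close>, into \<open>A1\<close>.\<close>
        have "bounded_functional X (\<lambda>x. \<phi> (M t x))"
          unfolding bounded_functional_def
        proof (intro conjI ballI allI exI)
          fix x y assume "x \<in> points X" "y \<in> points X"
          then show "\<phi> (M t (x + y)) = \<phi> (M t x) + \<phi> (M t y)"
            using Mlin[OF t] \<phi> MA1 XA0 unfolding clinear_on_def bounded_functional_def
            by (simp add: subset_iff)
        next
          fix a x assume "x \<in> points X"
          then show "\<phi> (M t (a *\<^sub>C x)) = a * \<phi> (M t x)"
            using Mlin[OF t] \<phi> MA1 XA0 unfolding clinear_on_def bounded_functional_def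
            by (simp add: subset_iff)
        next
          fix x assume x: "x \<in> points X"
          have "cmod (\<phi> (M t x)) \<le> C * nrm A1 (M t x)" by (rule C[OF MA1[OF x]])
          also have "\<dots> \<le> \<bar>C\<bar> * nrm A1 (M t x)"
            using A.A1.nrm_nonneg[OF MA1[OF x]] by (intro mult_right_mono) auto
          also have "\<dots> \<le> \<bar>C\<bar> * (m * nrm A0 x)" using m(2) x XA0 by (intro mult_left_mono) auto
          also have "\<dots> \<le> \<bar>C\<bar> * (m * (cX * nrm X x))" using m(1) cX(2)[OF x] by (intro mult_left_mono) auto
          finally show "cmod (\<phi> (M t x)) \<le> (\<bar>C\<bar> * m * cX) * nrm X x" by (simp add: mult_ac)
        qed
        moreover have "weakly_convergent_to X (\<lambda>k. h k (v k)) 0" using h(1) by (intro weak) blast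
        ultimately have "(\<lambda>k. \<phi> (M t (h k (v k)))) \<longlonglongrightarrow> \<phi> (M t 0)"
          unfolding weakly_convergent_to_def by (elim conjE allE impE)
        then show "(\<lambda>k. \<phi> (g k (M t (v k) - 0))) \<longlonglongrightarrow> \<phi> 0"
          unfolding eq using clinear_on_zero[OF A.A0.zero_mem Mlin[OF t]] by simp
      qed
    qed
    obtain G where G: "0 \<le> G" "\<And>x m0 m1. x \<in> points B0 \<Longrightarrow> x \<in> points B1 \<Longrightarrow> 0 < m0 \<Longrightarrow> 0 < m1 \<Longrightarrow>
        nrm B0 x \<le> m0 \<Longrightarrow> nrm B1 x \<le> m1 \<Longrightarrow> x \<in> points Y \<and> nrm Y x \<le> G * m0 powr (1 - \<theta>) * m1 powr \<theta>"
      using interpolate_point[OF B] unfolding Y_def by blast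
    show "tends_to_in Y u l sequentially"
      unfolding tends_to_in_def
    proof (rule tendstoI)
      fix e :: real assume "0 < e"
      \<comment> \<open>The remainder will contribute at most \<open>e / 3\<close>, as
        \<open>N\<close> bounds all \<open>nrm X (v k)\<close>, and the mollified part at most
        \<open>e / 2\<close>; the sum stays strictly below \<open>e\<close>.\<close>
      then have "0 < e / (3 * N)" "0 < e / 2" using N(1) by auto
      obtain t where t: "0 < t" "t < 1"
        and close: "\<And>x. x \<in> points X \<Longrightarrow> x - M t x \<in> points Y \<and> nrm Y (x - M t x) \<le> e / (3 * N) * nrm X x"
        using approx[OF \<open>0 < e / (3 * N)\<close>] by blast
      define w where "w = (\<lambda>k. M t (v k))"
      have vA0: "v k \<in> points A0" for k using vX XA0 by blast
      have wA1: "w k \<in> points A1" for k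
        using w_weak[OF t] unfolding D_weakly_convergent_to_def w_def by blast
      \<comment> \<open>Bounds the mollified sequence in \<open>B0\<close> by way of
        \<open>X\<close>, \<open>A0\<close>, \<open>M t\<close> on \<open>A0\<close>, and the
        imbedding into \<open>B0\<close>.\<close>
      define R where "R = c0 * (K0 * (cX * N))"
      have R: "0 < R" using c0(1) cX(1) N(1) by (simp add: R_def K0_def)
      have wR: "nrm B0 (w k) \<le> R" for k
      proof -
        have "nrm B0 (w k) \<le> c0 * nrm A0 (w k)" using c0(2) c(2)[OF wA1] by blast
        also have "\<dots> \<le> c0 * (K0 * nrm A0 (v k))"
          using MA0[OF t vA0] c0(1) unfolding w_def by (intro mult_left_mono) auto
        also have "\<dots> \<le> c0 * (K0 * (cX * nrm X (v k)))"
          using cX(2)[OF vX] c0(1) by (intro mult_left_mono) (auto simp: K0_def)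
        also have "\<dots> \<le> R" unfolding R_def
          using N(2)[of k] cX(1) c0(1) by (intro mult_left_mono) (auto simp: K0_def)
        finally show ?thesis .
      qed
      \<comment> \<open>\<open>G\<close> may be 0, while solving for \<open>d\<close> needs a
        positive coefficient; hence \<open>G + 1\<close>.\<close>
      have "0 < (G + 1) * R powr (1 - \<theta>)" using G(1) R by simp
      then obtain d where d: "0 < d" "(G + 1) * R powr (1 - \<theta>) * d powr \<theta> = e / 2"
        using powr_solution \<open>0 < e / 2\<close> exponent(1) by metis
      have "(\<lambda>k. nrm B1 (w k)) \<longlonglongrightarrow> 0"
        unfolding w_def
        by (rule cocompact_tends_to_zero[OF A.A1.seminormed_axioms B.A1.seminormed_axioms coc _ w_weak[OF t]])
           (rule g0)
      then have "\<forall>\<^sub>F k in sequentially. nrm B1 (w k) < d" using d(1) by (rule order_tendstoD)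
      then show "\<forall>\<^sub>F k in sequentially. dist (nrm Y (u k - l)) 0 < e"
      proof eventually_elim
        case (elim k)
        have "w k \<in> points B0" "w k \<in> points B1" using wA1 c(2) c0(2) c1(2) by blast+
        then have w: "w k \<in> points Y" "nrm Y (w k) \<le> G * R powr (1 - \<theta>) * d powr \<theta>"
          using G(2)[OF _ _ R d(1) wR] elim by auto
        have "G * R powr (1 - \<theta>) * d powr \<theta> \<le> (G + 1) * R powr (1 - \<theta>) * d powr \<theta>"
          by (intro mult_right_mono) auto
        then have w2: "nrm Y (w k) \<le> e / 2" using w(2) d(2) by linarith
        have vw: "v k - w k \<in> points Y" "nrm Y (v k - w k) \<le> e / (3 * N) * nrm X (v k)"
          using close[OF vX] unfolding w_def by auto
        have "e / (3 * N) * nrm X (v k) \<le> e / (3 * N) * N"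
          using N \<open>0 < e / (3 * N)\<close> by (intro mult_left_mono) auto
        moreover have "e / (3 * N) * N = e / 3" using N(1) by simp
        ultimately have "nrm Y (v k - w k) \<le> e / 3" using vw(2) by linarith
        moreover have "nrm Y (v k) \<le> nrm Y (v k - w k) + nrm Y (w k)"
          using Y.nrm_add[OF vw(1) w(1)] by simp
        moreover have "0 \<le> nrm Y (v k)"
          using Y.nrm_nonneg[OF Y.add_mem[OF vw(1) w(1)]] by simp
        ultimately show ?case using w2 \<open>0 < e\<close> by (simp add: dist_real_def v_def)
      qed
    qed
  qed
  then show ?thesis
    using act XY unfolding cocompactly_imbedded_def X_def[symmetric] Y_def[symmetric] by blast
qed

lemma banach_couple_seminormed: "banach_couple A0 A1 \<Longrightarrow> seminormed_couple A0 A1"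
  by (simp add: banach_couple_def seminormed_couple_def banach_space_seminormed)

theorem theorem2p3:
  fixes A0 A1 B0 B1 :: "('v::complex_tvs) nspace"
    and D :: "('v \<Rightarrow> 'v) set"
  assumes "banach_couple A0 A1" and "banach_couple B0 B1"
    and "continuously_imbedded A0 B0" and "continuously_imbedded A1 B1"
    and "continuously_imbedded A1 A0"
    and "subgroup D (BijGroup (points (sum_space B0 B1)))"
    and "\<forall>g\<in>D. clinear_on (points (sum_space B0 B1)) g"
    and "\<forall>g\<in>D. isometry_on A0 g \<and> isometry_on A1 g \<and> isometry_on B0 g \<and> isometry_on B1 g"
    and "\<exists>M. covariant_mollifiers D A0 A1 B1 M"
    and "cocompactly_imbedded D A1 B1"
  shows "\<forall>\<theta>::real. 0 < \<theta> \<and> \<theta> < 1 \<longrightarrow>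
           (\<forall>q::ereal. 1 \<le> q \<longrightarrow>
              cocompactly_imbedded D (real_interp A0 A1 \<theta> q) (real_interp B0 B1 \<theta> q)) \<and>
           cocompactly_imbedded D (complex_interp A0 A1 \<theta>) (complex_interp B0 B1 \<theta>)"
proof -
  obtain M where M: "covariant_mollifiers D A0 A1 B1 M" using assms(9) by blast
  have *: "cocompactly_imbedded D (\<Phi> A0 A1) (\<Phi> B0 B1)" if "interpolation_method \<Phi> \<theta>"
    for \<Phi> :: "'v nspace \<Rightarrow> 'v nspace \<Rightarrow> 'v nspace" and \<theta>
    using assms by (intro interpolation_method.cocompactly_imbedded_interp[OF that _ _ _ _ _ _ _ _ M])
      (auto intro: banach_couple_seminormed)
  show ?thesis
    using *[OF interpolation_method_real] *[OF interpolation_method_complex] by blast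
qed

end
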